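(* Let $n\ge 2$, let $G_1,\dots,G_n$ be finitely presented groups and let $S<G_1\times\cdots\times G_n$ be a subgroup. If $S$ is virtually surjective on pairs (VSP), then $S$ is finitely presented and $S$ is separable in $G_1\times\cdots\times G_n$.
   Context: A subgroup $S<G_1\times\cdots\times G_n$ ($n\ge 2$) is virtually surjective on pairs (VSP) if for all $i\ne j$ in $\{1,\dots,n\}$ the image $p_{ij}(S)$ of $S$ under the projection $p_{ij}:G_1\times\cdots\times G_n\to G_i\times G_j$ has finite index in $G_i\times G_j$. It is not assumed a priori that $S$ is finitely generated. A subgroup $S<\Gamma$ is separable (in $\Gamma$) if for every $\gamma\in\Gamma\smallsetminus S$ there exists a normal subgroup $K\triangleleft\Gamma$ of finite index such that $\gamma\notin SK$. *)

theory Defs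
  imports "HOL-Algebra.Product_Groups"
begin

section \<open>Free groups\<close>

text \<open>
  The free group on a set is realised on reduced words.  The letter \<open>(True, x)\<close> stands for the
  generator \<open>x\<close> and \<open>(False, x)\<close> for its formal inverse.
\<close>

type_synonym 'x letter = "bool \<times> 'x"

definition letter_inv :: "'x letter \<Rightarrow> 'x letter"
  where "letter_inv a = (\<not> fst a, snd a)"

fun reduced_word :: "'x letter list \<Rightarrow> bool" where
  "reduced_word [] \<longleftrightarrow> True"
| "reduced_word [a] \<longleftrightarrow> True"
| "reduced_word (a # b # w) \<longleftrightarrow> b \<noteq> letter_inv a \<and> reduced_word (b # w)"

text \<open>Left multiplication of a reduced word by a letter, with free cancellation.\<close>

fun push_letter :: "'x letter \<Rightarrow> 'x letter list \<Rightarrow> 'x letter list" where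
  "push_letter a [] = [a]"
| "push_letter a (b # w) = (if b = letter_inv a then w else a # b # w)"

definition free_group :: "'x set \<Rightarrow> 'x letter list monoid"
  where "free_group X =
    \<lparr>carrier = {w. reduced_word w \<and> set w \<subseteq> UNIV \<times> X},
     monoid.mult = (\<lambda>u v. foldr push_letter u v),
     one = []\<rparr>"

lemma letter_inv_letter_inv [simp]: "letter_inv (letter_inv a) = a"
  by (simp add: letter_inv_def)

lemma letter_inv_neq [simp]: "letter_inv a \<noteq> a" "a \<noteq> letter_inv a"
  by (cases a; simp add: letter_inv_def)+

lemma snd_letter_inv [simp]: "snd (letter_inv a) = snd a"
  by (simp add: letter_inv_def)

lemma reduced_word_tl: "reduced_word (a # w) \<Longrightarrow> reduced_word w"
  by (cases w) auto

lemma reduced_push_letter: "reduced_word w \<Longrightarrow> reduced_word (push_letter a w)"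
  by (cases w) (auto dest: reduced_word_tl)

lemma push_letter_reduced: "reduced_word (a # w) \<Longrightarrow> push_letter a w = a # w"
  by (cases w) auto

lemma push_letter_inv: "reduced_word w \<Longrightarrow> push_letter a (push_letter (letter_inv a) w) = w"
proof (cases w)
  case (Cons b v)
  assume "reduced_word w"
  then show ?thesis using Cons by (cases "b = a") (auto simp: push_letter_reduced)
qed simp

lemma reduced_foldr_push_letter: "reduced_word v \<Longrightarrow> reduced_word (foldr push_letter u v)"
  by (induction u) (auto simp: reduced_push_letter)

lemma foldr_push_letter_push_letter:
  assumes "reduced_word w"
  shows "foldr push_letter (push_letter a u) w = push_letter a (foldr push_letter u w)"
proof (cases u)
  case (Cons b v)
  then show ?thesis
    using push_letter_inv[OF reduced_foldr_push_letter[OF assms], of a v] by auto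
qed simp

lemma foldr_push_letter_assoc:
  assumes "reduced_word w"
  shows "foldr push_letter (foldr push_letter u v) w = foldr push_letter u (foldr push_letter v w)"
  by (induction u) (auto simp: foldr_push_letter_push_letter[OF assms])

lemma set_push_letter: "set (push_letter a w) \<subseteq> insert a (set w)"
  by (cases w) auto

lemma set_foldr_push_letter: "set (foldr push_letter u v) \<subseteq> set u \<union> set v"
  by (induction u) (use set_push_letter in fastforce)+

lemma foldr_push_letter_Nil: "reduced_word w \<Longrightarrow> foldr push_letter w [] = w"
proof (induction w)
  case (Cons a w)
  then show ?case using reduced_word_tl[OF Cons.prems] push_letter_reduced[OF Cons.prems] by simp
qed simp

lemma foldr_push_letter_inv_word:
  "reduced_word v \<Longrightarrow> foldr push_letter (rev (map letter_inv w)) (foldr push_letter w v) = v"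
proof (induction w)
  case (Cons a w)
  then show ?case
    using push_letter_inv[OF reduced_foldr_push_letter[OF Cons.prems], of "letter_inv a" w] by simp
qed simp

lemma group_free_group: "group (free_group X)"
proof (rule groupI)
  fix w assume w: "w \<in> carrier (free_group X)"
  let ?v = "foldr push_letter (rev (map letter_inv w)) []"
  have "set ?v \<subseteq> letter_inv ` set w"
    using set_foldr_push_letter[of "rev (map letter_inv w)" "[]"] by simp
  also have "\<dots> \<subseteq> UNIV \<times> X"
    using w by (auto simp: free_group_def letter_inv_def)
  finally have "?v \<in> carrier (free_group X)"
    by (simp add: free_group_def reduced_foldr_push_letter)
  moreover have "?v \<otimes>\<^bsub>free_group X\<^esub> w = \<one>\<^bsub>free_group X\<^esub>"
    using w foldr_push_letter_inv_word[of "[]" w]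
    by (simp add: free_group_def foldr_push_letter_assoc foldr_push_letter_Nil)
  ultimately show "\<exists>v\<in>carrier (free_group X). v \<otimes>\<^bsub>free_group X\<^esub> w = \<one>\<^bsub>free_group X\<^esub>"
    by blast
qed (use set_foldr_push_letter in
      \<open>fastforce simp: free_group_def reduced_foldr_push_letter foldr_push_letter_assoc\<close>)+

lemma free_group_universal:
  fixes G (structure)
  assumes "group G" and f: "f \<in> X \<rightarrow> carrier G"
  shows "\<exists>h\<in>hom (free_group X) G. \<forall>x\<in>X. h [(True, x)] = f x"
    and "\<lbrakk>h \<in> hom (free_group X) G; k \<in> hom (free_group X) G;
          \<And>x. x \<in> X \<Longrightarrow> h [(True, x)] = k [(True, x)]; w \<in> carrier (free_group X)\<rbrakk>
         \<Longrightarrow> h w = k w"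
proof -
  interpret group G by fact
  define e where "e a = (if fst a then f (snd a) else inv (f (snd a)))" for a
  define h where "h w = foldr (\<lambda>a g. e a \<otimes> g) w \<one>" for w
  have e: "e a \<in> carrier G" if "snd a \<in> X" for a
    using that f by (auto simp: e_def)
  have ei: "e a \<otimes> (e (letter_inv a) \<otimes> g) = g" if "snd a \<in> X" "g \<in> carrier G" for a g
  proof -
    have "f (snd a) \<in> carrier G" using that f by auto
    then show ?thesis using that(2) by (simp add: e_def letter_inv_def m_assoc[symmetric])
  qed
  have hc: "h w \<in> carrier G" if "set w \<subseteq> UNIV \<times> X" for w
    using that by (induction w) (auto simp: h_def e)
  have hp: "h (push_letter a w) = e a \<otimes> h w"
    if "snd a \<in> X" "set w \<subseteq> UNIV \<times> X" for a w
  proof (cases w)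
    case (Cons b v)
    then show ?thesis using that ei[of a "h v"] hc[of v] by (auto simp: h_def)
  qed (simp add: h_def)
  have hm: "h (foldr push_letter u v) = h u \<otimes> h v"
    if "set u \<subseteq> UNIV \<times> X" "set v \<subseteq> UNIV \<times> X" for u v
    using that(1)
  proof (induction u)
    case Nil
    then show ?case using hc[OF that(2)] by (simp add: h_def)
  next
    case (Cons a u)
    have "set (foldr push_letter u v) \<subseteq> UNIV \<times> X"
      using set_foldr_push_letter[of u v] Cons.prems that(2) by auto
    then have "h (foldr push_letter (a # u) v) = e a \<otimes> (h u \<otimes> h v)"
      using Cons by (simp add: hp mem_Times_iff)
    also have "\<dots> = h (a # u) \<otimes> h v"
      using Cons.prems e[of a] hc[of u] hc[OF that(2)]
      by (auto simp: h_def m_assoc)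
    finally show ?case .
  qed
  have "h \<in> hom (free_group X) G"
    by (auto simp: hom_def free_group_def hc hm)
  moreover have "\<forall>x\<in>X. h [(True, x)] = f x"
    using funcset_mem[OF f] by (simp add: h_def e_def)
  ultimately show "\<exists>h\<in>hom (free_group X) G. \<forall>x\<in>X. h [(True, x)] = f x"
    by blast
next
  interpret F: group "free_group X" by (rule group_free_group)
  assume h: "h \<in> hom (free_group X) G" and k: "k \<in> hom (free_group X) G"
    and eq: "\<And>x. x \<in> X \<Longrightarrow> h [(True, x)] = k [(True, x)]"
    and "w \<in> carrier (free_group X)"
  interpret h: group_hom "free_group X" G h
    using assms(1) h by (simp add: group_hom_def group_hom_axioms_def group_free_group)
  interpret k: group_hom "free_group X" G k
    using assms(1) k by (simp add: group_hom_def group_hom_axioms_def group_free_group)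
  have gen: "[(b, x)] \<in> carrier (free_group X)" if "x \<in> X" for b x
    using that by (simp add: free_group_def)
  have "h [(b, x)] = k [(b, x)]" if "x \<in> X" for b x
  proof (cases b)
    case False
    have "[(False, x)] \<otimes>\<^bsub>free_group X\<^esub> [(True, x)] = \<one>\<^bsub>free_group X\<^esub>"
      by (simp add: free_group_def letter_inv_def)
    then have "[(False, x)] = inv\<^bsub>free_group X\<^esub> [(True, x)]"
      using F.inv_equality gen that by metis
    then show ?thesis using False eq that gen by simp
  qed (use eq that in simp)
  then show "h w = k w" using \<open>w \<in> carrier (free_group X)\<close>
  proof (induction w)
    case Nil
    have "\<one>\<^bsub>free_group X\<^esub> = []" by (simp add: free_group_def)
    then show ?case using h.hom_one k.hom_one by metis
  next
    case (Cons a w)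
    obtain b x where a: "a = (b, x)" by (cases a)
    have x: "x \<in> X" and w: "w \<in> carrier (free_group X)"
      and split: "a # w = [a] \<otimes>\<^bsub>free_group X\<^esub> w"
      using Cons.prems a
      by (auto simp: free_group_def push_letter_reduced dest: reduced_word_tl)
    show ?case
      unfolding split using Cons.IH Cons.prems(1) x w gen[OF x] a by simp
  qed
qed


section \<open>Finite presentability\<close>

definition normal_closure :: "('a, 'b) monoid_scheme \<Rightarrow> 'a set \<Rightarrow> 'a set"
  where "normal_closure G R = \<Inter>{N. N \<lhd> G \<and> R \<subseteq> N}"

text \<open>
  Taking the finite generating set inside \<open>nat\<close> is no restriction, since the free group depends
  only on the cardinality of its basis.
\<close>

definition finitely_presented :: "('a, 'b) monoid_scheme \<Rightarrow> bool"
  where "finitely_presented G \<longleftrightarrow> group G \<and>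
    (\<exists>(X :: nat set) R. finite X \<and> finite R \<and> R \<subseteq> carrier (free_group X) \<and>
       free_group X Mod normal_closure (free_group X) R \<cong> G)"


section \<open>Subgroups of direct products\<close>

definition finite_index :: "('a, 'b) monoid_scheme \<Rightarrow> 'a set \<Rightarrow> bool"
  where "finite_index G H \<longleftrightarrow> finite (rcosets\<^bsub>G\<^esub> H)"

definition virtually_surjective_on_pairs ::
    "'i set \<Rightarrow> ('i \<Rightarrow> ('a, 'b) monoid_scheme) \<Rightarrow> ('i \<Rightarrow> 'a) set \<Rightarrow> bool"
  where "virtually_surjective_on_pairs I G S \<longleftrightarrow>
    (\<forall>i\<in>I. \<forall>j\<in>I. i \<noteq> j \<longrightarrow> finite_index (G i \<times>\<times> G j) ((\<lambda>x. (x i, x j)) ` S))"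

definition separable :: "('a, 'b) monoid_scheme \<Rightarrow> 'a set \<Rightarrow> bool"
  where "separable G S \<longleftrightarrow>
    (\<forall>g \<in> carrier G - S. \<exists>K. K \<lhd> G \<and> finite_index G K \<and> g \<notin> S <#>\<^bsub>G\<^esub> K)"

end

theory Submission
  imports Defs "HOL-Algebra.Bij"
begin

text \<open>
  Let \<open>N\<^sub>i = S \<inter> G\<^sub>i\<close>.  If \<open>x\<^sub>j\<close> is the \<open>i\<close>-th coordinate of an element of \<open>S\<close> that is trivial in the
  coordinate \<open>j\<close>, then the iterated commutator of the \<open>x\<^sub>j\<close>, \<open>j \<noteq> i\<close>, lies in \<open>N\<^sub>i\<close>.  By VSP the possible
  \<open>x\<^sub>j\<close> fill a subgroup of finite index in \<open>G\<^sub>i\<close>, so \<open>p\<^sub>i(S)/N\<^sub>i\<close> is virtually nilpotent.  Hence \<open>S\<close> is, up to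
  finite index, caught between two products that are joined by a polycyclic chain, and Mal'cev's
  argument for polycyclic groups shows that \<open>S\<close> is separable.

  For finite presentability we induct on the number of factors.  Let \<open>T\<close> be the image of \<open>S\<close> in the product
  of all factors but \<open>G\<^sub>j\<close>.  Then \<open>S\<close> is the fibre product of \<open>T\<close> and \<open>p\<^sub>j(S)\<close> over the virtually nilpotent
  group \<open>Q = p\<^sub>j(S)/N\<^sub>j\<close>, and \<open>S \<inter> ker p\<^sub>j\<close> is finitely generated.  Let \<open>F\<close> be a free group of finite rank that
  maps onto \<open>S\<close>, with \<open>U\<close> and \<open>V\<close> the kernels of the maps to \<open>T\<close> and \<open>p\<^sub>j(S)\<close>.  Finitely many relators in
  \<open>U \<inter> V\<close> generate a normal subgroup \<open>R\<^sub>0\<close> that contains \<open>[U, V]\<close>.  Since subgroups of free groups are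
  projective, \<open>(U \<inter> V)/R\<^sub>0\<close> embeds into a finitely generated \<open>\<int>Q\<close>-module, so it is finitely generated itself
  by P. Hall's version of the basis theorem.  This replaces the use of \<open>\<pi>\<^sub>2\<close> in the 1-2-3 theorem.
\<close>

section \<open>Generators, normal closures and coset covers\<close>

text \<open>The group \<open>Q\<close> acts on \<open>(U \<inter> V)/R\<^sub>0\<close> for the
  following reason. Since \<open>R\<^sub>0\<close> contains \<open>[U, V]\<close>, this section is
  centralised by \<open>U\<close> and by \<open>V\<close>, so the acting group is
  \<open>F/UV\<close>. The map from \<open>F\<close> to \<open>p\<^sub>j(S)\<close> has kernel
  \<open>V\<close> and sends \<open>U\<close> onto \<open>N\<^sub>j\<close>, whence
  \<open>F/UV\<close> is \<open>Q\<close>. The obstacle is that no finiteness of \<open>S\<close> is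
  given. It is extracted from the factors: a subgroup of finite index in \<open>G\<^sub>i\<close> is
  finitely generated, so iterated commutators of its generators form a finite set, and the normal
  closure of that set lies in \<open>N\<^sub>i\<close>. Conjugation inside \<open>G\<^sub>i\<close>
  is realised by elements of \<open>S\<close> that are trivial at \<open>j\<close>, because their
  coordinates still fill a subgroup of finite index. Quotients are mostly avoided. A polycyclic
  section is a chain of subgroups, a module is given by preimages in one ambient group, and finite
  index is a finite set of coset representatives. This keeps statements meaningful when the smaller
  subgroup is not normal.\<close>

lemma (in group) cancel_simps [simp]:
  assumes "x \<in> carrier G" "y \<in> carrier G"
  shows "inv x \<otimes> (x \<otimes> y) = y" "x \<otimes> (inv x \<otimes> y) = y"
  using assms by (simp_all flip: m_assoc)

lemmas (in group) word_simps = m_assoc inv_mult_group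

lemma (in group) generate_subset:
  assumes "subgroup H G" "E \<subseteq> H" "x \<in> generate G E"
  shows "x \<in> H"
  using generate_subgroup_incl[OF assms(2,1)] assms(3) by blast

lemma (in group) hom_image_generate:
  assumes "group H" "h \<in> hom G H" "E \<subseteq> carrier G"
  shows "h ` generate G E = generate H (h ` E)"
proof -
  interpret group_hom G H h
    using assms by (simp add: group_hom_def group_hom_axioms_def group_axioms)
  show ?thesis using generate_img[OF assms(3)] by simp
qed

lemma (in group) normal_conjD:
  assumes "N \<lhd> G" "x \<in> carrier G" "h \<in> N"
  shows "x \<otimes> h \<otimes> inv x \<in> N" "inv x \<otimes> h \<otimes> x \<in> N"
proof -
  have n: "y \<otimes> h \<otimes> inv y \<in> N" if "y \<in> carrier G" for y
    using that assms normal_inv_iff by blast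
  show "x \<otimes> h \<otimes> inv x \<in> N" "inv x \<otimes> h \<otimes> x \<in> N"
    using n[of x] n[of "inv x"] assms(2) by simp_all
qed

lemma (in group) normal_closure_normal:
  assumes "R \<subseteq> carrier G"
  shows "normal_closure G R \<lhd> G"
proof -
  let ?A = "{N. N \<lhd> G \<and> R \<subseteq> N}"
  have ne: "?A \<noteq> {}" using normal_self assms by blast
  have "subgroup (\<Inter>?A) G"
    by (rule subgroups_Inter) (use ne normal_imp_subgroup in auto)
  then show ?thesis
    unfolding normal_closure_def normal_inv_iff using normal_conjD(1) by blast
qed

lemma (in group) normal_closure_incl: "R \<subseteq> normal_closure G R"
  by (auto simp: normal_closure_def)

lemma (in group) normal_closure_least: "N \<lhd> G \<Longrightarrow> R \<subseteq> N \<Longrightarrow> normal_closure G R \<subseteq> N"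
  by (auto simp: normal_closure_def)

lemma (in group) normal_closure_subset_carrier:
  "R \<subseteq> carrier G \<Longrightarrow> normal_closure G R \<subseteq> carrier G"
  by (meson normal_closure_normal normal_imp_subgroup subgroup.subset)

lemma (in group) subgroup_conj_set:
  assumes "subgroup B G" "g \<in> carrier G"
  shows "subgroup {x \<in> carrier G. g \<otimes> x \<otimes> inv g \<in> B} G"
proof (rule subgroupI)
  show "{x \<in> carrier G. g \<otimes> x \<otimes> inv g \<in> B} \<noteq> {}"
    using assms subgroup.one_closed[OF assms(1)] by (auto intro!: exI[of _ \<one>])
next
  fix a assume "a \<in> {x \<in> carrier G. g \<otimes> x \<otimes> inv g \<in> B}"
  moreover have "g \<otimes> inv a \<otimes> inv g = inv (g \<otimes> a \<otimes> inv g)" if "a \<in> carrier G"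
    using that assms by (simp add: word_simps)
  ultimately show "inv a \<in> {x \<in> carrier G. g \<otimes> x \<otimes> inv g \<in> B}"
    using subgroup.m_inv_closed[OF assms(1)] by auto
next
  fix a b assume "a \<in> {x \<in> carrier G. g \<otimes> x \<otimes> inv g \<in> B}" "b \<in> {x \<in> carrier G. g \<otimes> x \<otimes> inv g \<in> B}"
  moreover have "g \<otimes> (a \<otimes> b) \<otimes> inv g = (g \<otimes> a \<otimes> inv g) \<otimes> (g \<otimes> b \<otimes> inv g)"
    if "a \<in> carrier G" "b \<in> carrier G"
    using that assms by (simp add: word_simps)
  ultimately show "a \<otimes> b \<in> {x \<in> carrier G. g \<otimes> x \<otimes> inv g \<in> B}"
    using subgroup.m_closed[OF assms(1)] by auto
qed auto

text \<open>For a fixed \<open>y\<close>, the elements whose conjugate by \<open>y\<close> stays in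
  the span form a subgroup, so generators suffice; induction on words then treats \<open>g\<close>.
  Both \<open>y\<close> and \<open>inv y\<close> have to be tested, as conjugation can map a
  subgroup onto a proper subgroup of itself.\<close>

lemma (in group) conj_generate_closed:
  assumes Y: "Y \<subseteq> carrier G" and E: "E \<subseteq> carrier G"
    and c: "\<And>y e. y \<in> Y \<Longrightarrow> e \<in> E \<Longrightarrow> y \<otimes> e \<otimes> inv y \<in> generate G E"
      "\<And>y e. y \<in> Y \<Longrightarrow> e \<in> E \<Longrightarrow> inv y \<otimes> e \<otimes> y \<in> generate G E"
    and g: "g \<in> generate G Y" and x: "x \<in> generate G E"
  shows "g \<otimes> x \<otimes> inv g \<in> generate G E"
proof -
  have sub: "subgroup (generate G E) G" using generate_is_subgroup E by blast
  have step: "y \<otimes> x \<otimes> inv y \<in> generate G E"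
    if "y \<in> carrier G" "\<And>e. e \<in> E \<Longrightarrow> y \<otimes> e \<otimes> inv y \<in> generate G E" "x \<in> generate G E" for x y
    using generate_subset[OF subgroup_conj_set[OF sub that(1)] _ that(3)] that(2) E by auto
  show ?thesis using g x
  proof (induction arbitrary: x rule: generate.induct)
    case one
    then show ?case using generate_in_carrier[OF E] by simp
  next
    case (incl y)
    then show ?case using step[of y] c(1) Y by blast
  next
    case (inv y)
    then show ?case using step[of "inv y"] c(2) Y by (auto simp: subset_iff)
  next
    case (eng a b)
    have "a \<otimes> b \<otimes> x \<otimes> inv (a \<otimes> b) = a \<otimes> (b \<otimes> x \<otimes> inv b) \<otimes> inv a"
      using eng.hyps eng.prems generate_in_carrier[OF Y] generate_in_carrier[OF E]
      by (simp add: word_simps)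
    then show ?case using eng by simp
  qed
qed

lemma (in group) normal_generateI':
  assumes "Y \<subseteq> carrier G" "generate G Y = carrier G" "E \<subseteq> carrier G"
    and "\<And>y e. y \<in> Y \<Longrightarrow> e \<in> E \<Longrightarrow> y \<otimes> e \<otimes> inv y \<in> generate G E"
      "\<And>y e. y \<in> Y \<Longrightarrow> e \<in> E \<Longrightarrow> inv y \<otimes> e \<otimes> y \<in> generate G E"
  shows "generate G E \<lhd> G"
  unfolding normal_inv_iff
  using conj_generate_closed[OF assms(1,3) assms(4,5)] generate_is_subgroup assms(2,3) by blast

text \<open>For an abelian section with bottom \<open>K\<close> this is the preimage of the
  submodule that \<open>E\<close> generates over the integral group ring of \<open>P\<close>. With
  \<open>K\<close> empty and \<open>P\<close> the whole group it is the normal closure of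
  \<open>E\<close>.\<close>

definition conj_span :: "('a, 'b) monoid_scheme \<Rightarrow> 'a set \<Rightarrow> 'a set \<Rightarrow> 'a set \<Rightarrow> 'a set"
  where "conj_span G P K E =
    generate G (K \<union> (\<Union>p\<in>P. (\<lambda>x. p \<otimes>\<^bsub>G\<^esub> x \<otimes>\<^bsub>G\<^esub> inv\<^bsub>G\<^esub> p) ` E))"

context group
begin

lemma conj_span_gens_carrier:
  assumes "P \<subseteq> carrier G" "K \<subseteq> carrier G" "E \<subseteq> carrier G"
  shows "K \<union> (\<Union>p\<in>P. (\<lambda>x. p \<otimes> x \<otimes> inv p) ` E) \<subseteq> carrier G"
  using assms by blast

lemma conj_span_subgroup:
  assumes "P \<subseteq> carrier G" "K \<subseteq> carrier G" "E \<subseteq> carrier G"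
  shows "subgroup (conj_span G P K E) G"
  unfolding conj_span_def by (rule generate_is_subgroup) (rule conj_span_gens_carrier[OF assms])

lemma conj_span_incl:
  assumes "subgroup P G" "E \<subseteq> carrier G"
  shows "K \<subseteq> conj_span G P K E" "E \<subseteq> conj_span G P K E"
proof -
  show "K \<subseteq> conj_span G P K E" unfolding conj_span_def by (blast intro: generate.incl)
  have "e \<in> (\<lambda>x. \<one> \<otimes> x \<otimes> inv \<one>) ` E" if "e \<in> E" for e
    using that assms by (auto simp: image_iff intro!: bexI[of _ e])
  then have "E \<subseteq> (\<Union>p\<in>P. (\<lambda>x. p \<otimes> x \<otimes> inv p) ` E)"
    using subgroup.one_closed[OF assms(1)] by blast
  then show "E \<subseteq> conj_span G P K E"
    unfolding conj_span_def by (blast intro: generate.incl)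
qed

lemma conj_span_conj:
  assumes "subgroup P G" "K \<subseteq> carrier G" "E \<subseteq> carrier G"
    and K: "\<And>p k. p \<in> P \<Longrightarrow> k \<in> K \<Longrightarrow> p \<otimes> k \<otimes> inv p \<in> K"
    and "p \<in> P" "x \<in> conj_span G P K E"
  shows "p \<otimes> x \<otimes> inv p \<in> conj_span G P K E"
proof -
  let ?E = "K \<union> (\<Union>p\<in>P. (\<lambda>x. p \<otimes> x \<otimes> inv p) ` E)"
  note P = subgroup.subset[OF assms(1)]
  have c: "q \<otimes> e \<otimes> inv q \<in> generate G ?E" if q: "q \<in> P" and e: "e \<in> ?E" for q e
  proof (cases "e \<in> K")
    case True then show ?thesis using K[OF q] by (blast intro: generate.incl)
  next
    case False
    then obtain r f where r: "r \<in> P" "f \<in> E" "e = r \<otimes> f \<otimes> inv r" using e by blast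
    have "q \<otimes> e \<otimes> inv q = (q \<otimes> r) \<otimes> f \<otimes> inv (q \<otimes> r)"
      using q r P assms(3) by (auto simp: word_simps subset_iff)
    then show ?thesis using r q subgroup.m_closed[OF assms(1)] by (blast intro: generate.incl)
  qed
  show ?thesis
    unfolding conj_span_def
  proof (rule conj_generate_closed[of P])
    show "inv y \<otimes> e \<otimes> y \<in> generate G ?E" if "y \<in> P" "e \<in> ?E" for y e
      using c[of "inv y" e] that P subgroup.m_inv_closed[OF assms(1)] by (auto simp: subset_iff)
  qed (use P c assms conj_span_gens_carrier in \<open>auto simp: conj_span_def intro: generate.incl\<close>)
qed

lemma conj_span_least:
  assumes "subgroup H G" "K \<subseteq> H" "\<And>p e. p \<in> P \<Longrightarrow> e \<in> E \<Longrightarrow> p \<otimes> e \<otimes> inv p \<in> H"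
  shows "conj_span G P K E \<subseteq> H"
  unfolding conj_span_def by (rule generate_subgroup_incl) (use assms in auto)

text \<open>\<open>fin_cover P K\<close> says that the subgroup \<open>K\<close> has finite index in \<open>P\<close>.\<close>

definition fin_cover :: "'a set \<Rightarrow> 'a set \<Rightarrow> bool"
  where "fin_cover P K \<longleftrightarrow> (\<exists>T. finite T \<and> T \<subseteq> P \<and> (\<forall>p\<in>P. \<exists>t\<in>T. p \<otimes> inv t \<in> K))"

lemma finite_index_iff_fin_cover:
  assumes "subgroup H G"
  shows "finite_index G H \<longleftrightarrow> fin_cover (carrier G) H"
proof
  assume "finite_index G H"
  then have f: "finite (rcosets H)" by (simp add: finite_index_def)
  define T where "T = (\<lambda>C. SOME t. t \<in> carrier G \<and> C = H #> t) ` (rcosets H)"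
  have s: "(SOME t. t \<in> carrier G \<and> C = H #> t) \<in> carrier G \<and> C = H #> (SOME t. t \<in> carrier G \<and> C = H #> t)"
    if "C \<in> rcosets H" for C
    by (rule someI_ex) (use that in \<open>auto simp: RCOSETS_def\<close>)
  have "\<exists>t\<in>T. p \<otimes> inv t \<in> H" if p: "p \<in> carrier G" for p
  proof -
    have "H #> p \<in> rcosets H" using p by (auto simp: RCOSETS_def)
    from s[OF this] this obtain t where t: "t \<in> T" "t \<in> carrier G" "H #> p = H #> t"
      unfolding T_def by blast
    have "p \<in> H #> t" using rcos_self[OF p assms] t by simp
    then show ?thesis using t p assms
      by (metis is_group subgroup.rcos_module_imp)
  qed
  moreover have "finite T" "T \<subseteq> carrier G" using f s by (auto simp: T_def)
  ultimately show "fin_cover (carrier G) H" by (auto simp: fin_cover_def)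
next
  assume "fin_cover (carrier G) H"
  then obtain T where T: "finite T" "T \<subseteq> carrier G" "\<forall>p\<in>carrier G. \<exists>t\<in>T. p \<otimes> inv t \<in> H"
    by (auto simp: fin_cover_def)
  have "rcosets H \<subseteq> (\<lambda>t. H #> t) ` T"
  proof
    fix C assume "C \<in> rcosets H"
    then obtain p where p: "p \<in> carrier G" "C = H #> p" by (auto simp: RCOSETS_def)
    then obtain t where t: "t \<in> T" "p \<otimes> inv t \<in> H" using T by blast
    then have "p \<in> H #> t" using T p assms by (metis in_mono is_group subgroup.rcos_module_rev)
    then have "H #> t = H #> p"
      using repr_independence[of p H t] T t assms by auto
    then show "C \<in> (\<lambda>t. H #> t) ` T" using p t by auto
  qed
  then show "finite_index G H" using T(1) finite_surj by (auto simp: finite_index_def)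
qed

lemma fin_cover_trans:
  assumes "subgroup L G" "subgroup K G" "subgroup P G" "K \<subseteq> P" "fin_cover P K" "fin_cover K L"
  shows "fin_cover P L"
proof -
  obtain T where T: "finite T" "T \<subseteq> P" "\<forall>p\<in>P. \<exists>t\<in>T. p \<otimes> inv t \<in> K" using assms by (auto simp: fin_cover_def)
  obtain S where S: "finite S" "S \<subseteq> K" "\<forall>p\<in>K. \<exists>t\<in>S. p \<otimes> inv t \<in> L" using assms by (auto simp: fin_cover_def)
  note cc = subgroup.subset[OF assms(3)] subgroup.subset[OF assms(2)]
  have "\<exists>u\<in>(\<lambda>(s,t). s \<otimes> t) ` (S \<times> T). p \<otimes> inv u \<in> L" if p: "p \<in> P" for p
  proof -
    obtain t where t: "t \<in> T" "p \<otimes> inv t \<in> K" using T p by blast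
    then obtain s where s: "s \<in> S" "p \<otimes> inv t \<otimes> inv s \<in> L" using S by blast
    have "p \<in> carrier G" "s \<in> carrier G" "t \<in> carrier G" using p s t S T cc by auto
    then have "p \<otimes> inv t \<otimes> inv s = p \<otimes> inv (s \<otimes> t)" by (simp add: word_simps)
    then show ?thesis using s t by (intro bexI[of _ "s \<otimes> t"]) auto
  qed
  moreover have "(\<lambda>(s,t). s \<otimes> t) ` (S \<times> T) \<subseteq> P"
    using S T assms(4) subgroup.m_closed[OF assms(3)] by (auto simp: subset_iff)
  ultimately show ?thesis unfolding fin_cover_def using S T by (metis finite_SigmaI finite_imageI)
qed

lemma fin_cover_refl:
  assumes "subgroup P G"
  shows "fin_cover P P"
  unfolding fin_cover_def
  using subgroup.one_closed[OF assms] subgroup.subset[OF assms]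
  by (intro exI[of _ "{\<one>}"]) (auto simp: subset_iff)

text \<open>Choose one element in each nonempty intersection of cosets.\<close>

lemma fin_cover_Int:
  assumes K: "subgroup K G" and L: "subgroup L G" and P: "subgroup P G"
    and "fin_cover P K" "Q \<subseteq> P"
    and Q: "subgroup Q G" "fin_cover Q L"
  shows "fin_cover Q (K \<inter> L)"
proof -
  obtain T where T: "finite T" "T \<subseteq> P" "\<forall>p\<in>P. \<exists>t\<in>T. p \<otimes> inv t \<in> K" using assms by (auto simp: fin_cover_def)
  obtain S where S: "finite S" "S \<subseteq> Q" "\<forall>p\<in>Q. \<exists>t\<in>S. p \<otimes> inv t \<in> L" using assms by (auto simp: fin_cover_def)
  note cc = subgroup.subset[OF P] subgroup.subset[OF Q(1)]
  define c where "c = (\<lambda>(s,t). SOME q. q \<in> Q \<and> q \<otimes> inv t \<in> K \<and> q \<otimes> inv s \<in> L)"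
  define U where "U = c ` {(s,t) \<in> S \<times> T. \<exists>q. q \<in> Q \<and> q \<otimes> inv t \<in> K \<and> q \<otimes> inv s \<in> L}"
  have c: "c (s,t) \<in> Q \<and> c (s,t) \<otimes> inv t \<in> K \<and> c (s,t) \<otimes> inv s \<in> L"
    if "\<exists>q. q \<in> Q \<and> q \<otimes> inv t \<in> K \<and> q \<otimes> inv s \<in> L" for s t
    unfolding c_def prod.case by (rule someI_ex) (rule that)
  have "\<exists>u\<in>U. q \<otimes> inv u \<in> K \<inter> L" if q: "q \<in> Q" for q
  proof -
    obtain t where t: "t \<in> T" "q \<otimes> inv t \<in> K" using T q assms(5) by blast
    obtain s where s: "s \<in> S" "q \<otimes> inv s \<in> L" using S q by blast
    let ?u = "c (s,t)"
    have u: "?u \<in> Q" "?u \<otimes> inv t \<in> K" "?u \<otimes> inv s \<in> L" using c q s t by blast+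
    have cr: "q \<in> carrier G" "s \<in> carrier G" "t \<in> carrier G" "?u \<in> carrier G"
      using q s t u S T cc by auto
    have e: "(q \<otimes> inv t) \<otimes> inv (?u \<otimes> inv t) = q \<otimes> inv ?u"
      "(q \<otimes> inv s) \<otimes> inv (?u \<otimes> inv s) = q \<otimes> inv ?u"
      using cr by (simp_all add: word_simps)
    have "(q \<otimes> inv t) \<otimes> inv (?u \<otimes> inv t) \<in> K"
      using t u K by (meson subgroup.m_closed subgroup.m_inv_closed)
    moreover have "(q \<otimes> inv s) \<otimes> inv (?u \<otimes> inv s) \<in> L"
      using s u L by (meson subgroup.m_closed subgroup.m_inv_closed)
    ultimately have "q \<otimes> inv ?u \<in> K \<inter> L" unfolding e by blast
    moreover have "?u \<in> U" unfolding U_def using s t q by blast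
    ultimately show ?thesis by blast
  qed
  moreover have "finite U" unfolding U_def
    by (intro finite_imageI finite_subset[OF _ finite_cartesian_product[OF S(1) T(1)]]) auto
  moreover have "U \<subseteq> Q" using c by (auto simp: U_def)
  ultimately show ?thesis unfolding fin_cover_def by blast
qed

lemma fin_cover_subset:
  assumes K: "subgroup K G" and "subgroup P G" and "subgroup Q G" "fin_cover P K" "Q \<subseteq> P"
  shows "fin_cover Q (K \<inter> Q)"
  using fin_cover_Int[OF K assms(3,2,4,5,3) fin_cover_refl[OF assms(3)]] .

lemma fin_cover_mono:
  assumes "fin_cover P K" "K \<subseteq> L"
  shows "fin_cover P L"
proof -
  obtain T where "finite T" "T \<subseteq> P" "\<forall>p\<in>P. \<exists>t\<in>T. p \<otimes> inv t \<in> K"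
    using assms(1) by (auto simp: fin_cover_def)
  then show ?thesis using assms(2) unfolding fin_cover_def by (intro exI[of _ T]) blast
qed

text \<open>Schreier's argument: with \<open>T\<close> a finite set of coset representatives, the union of the cosets
  \<open>H\<^sub>0 t\<close> is closed under right multiplication by the generators.\<close>

lemma fin_cover_finitely_generated:
  assumes H: "subgroup H G" and Y: "finite Y" "Y \<subseteq> carrier G" "generate G Y = carrier G"
    and "fin_cover (carrier G) H"
  shows "\<exists>E. finite E \<and> E \<subseteq> H \<and> generate G E = H"
proof -
  obtain T0 where T0: "finite T0" "T0 \<subseteq> carrier G" "\<forall>p\<in>carrier G. \<exists>t\<in>T0. p \<otimes> inv t \<in> H"
    using assms by (auto simp: fin_cover_def)
  \<comment> \<open>With \<open>\<one>\<close> among the representatives, the set \<open>A\<close>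
    below contains the identity, and closure under generators makes it everything.\<close>
  define T where "T = insert \<one> T0"
  define Z where "Z = Y \<union> (\<lambda>y. inv y) ` Y"
  \<comment> \<open>Representatives inside \<open>H\<close> are generators too: if
    \<open>h0 \<otimes> t\<close> and \<open>h0\<close> lie in \<open>H\<close>, so does
    \<open>t\<close>, but it need not be trivial.\<close>
  define E where "E = H \<inter> (T \<union> (\<lambda>(t,z,t'). t \<otimes> z \<otimes> inv t') ` (T \<times> Z \<times> T))"
  have T: "finite T" "T \<subseteq> carrier G" "\<one> \<in> T" "\<And>p. p \<in> carrier G \<Longrightarrow> \<exists>t\<in>T. p \<otimes> inv t \<in> H"
    using T0 by (auto simp: T_def)
  have Z: "Z \<subseteq> carrier G" using Y by (auto simp: Z_def)
  have E: "finite E" "E \<subseteq> H" using T(1) Y(1) by (auto simp: E_def Z_def)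
  have Ec: "E \<subseteq> carrier G" using E H subgroup.subset by blast
  have step: "\<exists>h\<in>generate G E. \<exists>t\<in>T. g \<otimes> z = h \<otimes> t"
    if g: "h \<in> generate G E" "t \<in> T" "g = h \<otimes> t" and z: "z \<in> Z" for g h t z
  proof -
    have c: "t \<in> carrier G" "z \<in> carrier G" using g z T Z by auto
    then obtain t' where t': "t' \<in> T" "t \<otimes> z \<otimes> inv t' \<in> H" using T(4)[of "t \<otimes> z"] by auto
    have t'c: "t' \<in> carrier G" using t' T by auto
    have "t \<otimes> z \<otimes> inv t' \<in> (\<lambda>(t,z,t'). t \<otimes> z \<otimes> inv t') ` (T \<times> Z \<times> T)"
      using t'(1) g(2) z by (auto intro!: image_eqI[of _ _ "(t,z,t')"])
    then have "t \<otimes> z \<otimes> inv t' \<in> E" using t' by (simp add: E_def)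
    then have "h \<otimes> (t \<otimes> z \<otimes> inv t') \<in> generate G E" using g by (blast intro: generate.eng generate.incl)
    moreover have "g \<otimes> z = h \<otimes> (t \<otimes> z \<otimes> inv t') \<otimes> t'"
      using g c t'c generate_in_carrier[OF Ec] by (simp add: word_simps)
    ultimately show ?thesis using t' by blast
  qed
  define A where "A = {g. \<exists>h\<in>generate G E. \<exists>t\<in>T. g = h \<otimes> t}"
  have A: "A \<subseteq> carrier G" using generate_in_carrier[OF Ec] T by (auto simp: A_def)
  have "a \<otimes> g \<in> A" if "g \<in> generate G Y" "a \<in> A" for a g
    using that
  proof (induction arbitrary: a rule: generate.induct)
    case one then show ?case using A by auto
  next
    case (incl y)
    then show ?case using step[of _ _ a y] by (auto simp: A_def Z_def)
  next
    case (inv y)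
    then show ?case using step[of _ _ a "inv y"] by (auto simp: A_def Z_def)
  next
    case (eng g1 g2)
    have "a \<otimes> (g1 \<otimes> g2) = a \<otimes> g1 \<otimes> g2"
      using eng A generate_in_carrier[OF Y(2)] by (auto simp: m_assoc)
    then show ?case using eng by simp
  qed
  moreover have "\<one> \<in> A" unfolding A_def using T(3) by (auto intro!: bexI[of _ \<one>] generate.one)
  ultimately have cA: "g \<in> A" if "g \<in> carrier G" for g using Y(3) l_one that by metis
  have "h \<in> generate G E" if h: "h \<in> H" for h
  proof -
    obtain h0 t where ht: "h0 \<in> generate G E" "t \<in> T" "h = h0 \<otimes> t"
      using cA[OF subgroup.mem_carrier[OF H h]] unfolding A_def by blast
    have h0: "h0 \<in> H" using ht(1) generate_subset[OF H E(2)] by blast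
    have "t = inv h0 \<otimes> h" using ht h0 H T subgroup.mem_carrier[OF H] by (auto simp: subset_iff)
    then have "t \<in> H" using h h0 H by (simp add: subgroup.m_closed subgroup.m_inv_closed)
    then have "t \<in> E" using ht by (simp add: E_def)
    then show ?thesis using ht by (simp add: generate.eng generate.incl)
  qed
  then have "generate G E = H" using generate_subset[OF H E(2)] by blast
  then show ?thesis using E by blast
qed

end

section \<open>Free groups and finite presentability\<close>

definition free_gens :: "'x set \<Rightarrow> 'x letter list set"
  where "free_gens X = (\<lambda>x. [(True, x)]) ` X"

lemma free_gens_carrier: "free_gens X \<subseteq> carrier (free_group X)"
  by (auto simp: free_gens_def free_group_def)

lemma generate_free_gens: "generate (free_group X) (free_gens X) = carrier (free_group X)"
proof -
  interpret F: group "free_group X" by (rule group_free_group)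
  have "w \<in> generate (free_group X) (free_gens X)" if "w \<in> carrier (free_group X)" for w
    using that
  proof (induction w)
    case Nil
    have "\<one>\<^bsub>free_group X\<^esub> = []" by (simp add: free_group_def)
    then show ?case using generate.one by metis
  next
    case (Cons a w)
    obtain b x where a: "a = (b, x)" by (cases a)
    have x: "x \<in> X" and w: "w \<in> carrier (free_group X)"
      and split: "a # w = [a] \<otimes>\<^bsub>free_group X\<^esub> w"
      using Cons.prems a
      by (auto simp: free_group_def push_letter_reduced dest: reduced_word_tl)
    have g: "[(True, x)] \<in> free_gens X" using x by (simp add: free_gens_def)
    have c: "[(c, x)] \<in> carrier (free_group X)" for c using x by (simp add: free_group_def)
    have "[(False, x)] \<otimes>\<^bsub>free_group X\<^esub> [(True, x)] = \<one>\<^bsub>free_group X\<^esub>"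
      by (simp add: free_group_def letter_inv_def)
    then have "inv\<^bsub>free_group X\<^esub> [(True, x)] = [(False, x)]"
      using F.inv_equality c by metis
    then have "[a] \<in> generate (free_group X) (free_gens X)"
      using generate.incl[OF g] generate.inv[OF g, of "free_group X"] a by (cases b) auto
    then show ?case unfolding split using Cons.IH[OF w] by (rule generate.eng)
  qed
  then show ?thesis using F.generate_incl[OF free_gens_carrier] by blast
qed

lemma free_group_onto:
  assumes "group G" "finite E" "E \<subseteq> carrier G" "generate G E = carrier G"
  shows "\<exists>(X :: nat set) h. finite X \<and> h \<in> hom (free_group X) G \<and> h ` carrier (free_group X) = carrier G"
proof -
  obtain n and f :: "nat \<Rightarrow> 'a" where f: "E = f ` {i. i < n}"
    using finite_imp_nat_seg_image_inj_on[OF assms(2)] by blast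
  let ?X = "{i. i < n}"
  obtain h where h: "h \<in> hom (free_group ?X) G" "\<forall>x\<in>?X. h [(True, x)] = f x"
    using free_group_universal(1)[OF assms(1), of f ?X] f assms(3) by blast
  have "h ` free_gens ?X = E"
    unfolding free_gens_def f image_image using h(2) by (intro image_cong) auto
  then have "h ` carrier (free_group ?X) = carrier G"
    using group.hom_image_generate[OF group_free_group assms(1) h(1) free_gens_carrier]
      generate_free_gens[of ?X] assms(4) by simp
  then show ?thesis using h(1) by (intro exI[of _ ?X] exI[of _ h]) simp
qed

lemma free_group_lift:
  assumes "group G" "group M" "\<pi> \<in> hom M G" "\<rho> \<in> hom (free_group X) G"
    and "\<rho> ` carrier (free_group X) \<subseteq> \<pi> ` carrier M"
  shows "\<exists>\<theta>\<in>hom (free_group X) M. \<forall>w\<in>carrier (free_group X). \<pi> (\<theta> w) = \<rho> w"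
proof -
  have "\<exists>m. m \<in> carrier M \<and> \<pi> m = \<rho> [(True, x)]" if "x \<in> X" for x
  proof -
    have "[(True, x)] \<in> carrier (free_group X)" using that by (simp add: free_group_def)
    then show ?thesis using assms(5) by (force simp: image_iff)
  qed
  then obtain f where f: "\<And>x. x \<in> X \<Longrightarrow> f x \<in> carrier M \<and> \<pi> (f x) = \<rho> [(True, x)]" by metis
  obtain \<theta> where \<theta>: "\<theta> \<in> hom (free_group X) M" "\<forall>x\<in>X. \<theta> [(True, x)] = f x"
    using free_group_universal(1)[OF assms(2), of f X] f by blast
  have c: "\<pi> \<circ> \<theta> \<in> hom (free_group X) G" using \<theta>(1) assms(3) by (rule hom_compose)
  have g0: "(\<lambda>x. \<rho> [(True,x)]) \<in> X \<rightarrow> carrier G"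
    using assms(4) by (auto simp: free_group_def hom_def)
  have "(\<pi> \<circ> \<theta>) w = \<rho> w" if "w \<in> carrier (free_group X)" for w
    by (rule free_group_universal(2)[OF assms(1) g0 c assms(4) _ that]) (use \<theta>(2) f in auto)
  then show ?thesis using \<theta>(1) by auto
qed

text \<open>A surjection with prescribed kernel is the form in which relators can be moved from one
  presentation to another without handling cosets.\<close>

lemma finitely_presented_iff:
  "finitely_presented G \<longleftrightarrow> group G \<and>
    (\<exists>(X :: nat set) R \<pi>. finite X \<and> finite R \<and> R \<subseteq> carrier (free_group X) \<and>
       \<pi> \<in> hom (free_group X) G \<and> \<pi> ` carrier (free_group X) = carrier G \<and>
       kernel (free_group X) G \<pi> = normal_closure (free_group X) R)"
  (is "_ \<longleftrightarrow> ?R")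
proof
  assume fp: "finitely_presented G"
  then have "group G" by (simp add: finitely_presented_def)
  from fp obtain X :: "nat set" and R where X: "finite X" "finite R" "R \<subseteq> carrier (free_group X)"
    and i: "free_group X Mod normal_closure (free_group X) R \<cong> G"
    by (auto simp: finitely_presented_def)
  interpret F: group "free_group X" by (rule group_free_group)
  let ?N = "normal_closure (free_group X) R"
  have N: "?N \<lhd> free_group X" by (rule F.normal_closure_normal[OF X(3)])
  interpret N: normal ?N "free_group X" by (rule N)
  obtain \<phi> where \<phi>: "\<phi> \<in> iso (free_group X Mod ?N) G" using i by (auto simp: is_iso_def)
  define \<pi> where "\<pi> = \<phi> \<circ> (\<lambda>w. ?N #>\<^bsub>free_group X\<^esub> w)"
  have \<pi>: "\<pi> \<in> hom (free_group X) G"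
    unfolding \<pi>_def using N.r_coset_hom_Mod \<phi> by (intro hom_compose) (auto simp: iso_def)
  have "\<pi> ` carrier (free_group X) = \<phi> ` carrier (free_group X Mod ?N)"
    by (simp add: \<pi>_def image_image carrier_FactGroup)
  also have "\<dots> = carrier G" using \<phi> by (auto simp: iso_def bij_betw_def)
  finally have onto: "\<pi> ` carrier (free_group X) = carrier G" .
  interpret Q: group_hom "free_group X Mod ?N" G \<phi>
    using N.factorgroup_is_group \<open>group G\<close> \<phi>
    by (simp add: group_hom_def group_hom_axioms_def iso_def)
  have inj: "inj_on \<phi> (carrier (free_group X Mod ?N))" using \<phi> by (auto simp: iso_def bij_betw_def)
  have "\<pi> w = \<one>\<^bsub>G\<^esub> \<longleftrightarrow> w \<in> ?N" if w: "w \<in> carrier (free_group X)" for w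
  proof -
    have q: "?N #>\<^bsub>free_group X\<^esub> w \<in> carrier (free_group X Mod ?N)" using w by (simp add: carrier_FactGroup)
    have "\<pi> w = \<one>\<^bsub>G\<^esub> \<longleftrightarrow> ?N #>\<^bsub>free_group X\<^esub> w = ?N"
      using inj_on_eq_iff[OF inj q Q.G.one_closed] Q.hom_one by (simp add: \<pi>_def)
    also have "\<dots> \<longleftrightarrow> w \<in> ?N"
      using F.coset_join1[OF _ w] F.coset_join2[OF w] N.is_subgroup N.subset by blast
    finally show ?thesis .
  qed
  then have "kernel (free_group X) G \<pi> = ?N" using N.subset by (auto simp: kernel_def)
  then show ?R using \<open>group G\<close> X \<pi> onto by blast
next
  assume ?R
  then obtain X :: "nat set" and R \<pi> where X: "finite X" "finite R" "R \<subseteq> carrier (free_group X)"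
    "\<pi> \<in> hom (free_group X) G" "\<pi> ` carrier (free_group X) = carrier G"
    "kernel (free_group X) G \<pi> = normal_closure (free_group X) R" and "group G" by blast
  interpret \<pi>: group_hom "free_group X" G \<pi>
    using X \<open>group G\<close> by (simp add: group_hom_def group_hom_axioms_def group_free_group)
  have "(\<lambda>Y. the_elem (\<pi> ` Y)) \<in> iso (free_group X Mod normal_closure (free_group X) R) G"
    using \<pi>.FactGroup_iso_set[OF X(5)] X(6) by simp
  then show "finitely_presented G" using X \<open>group G\<close> unfolding finitely_presented_def
    by (auto simp: is_iso_def)
qed

section \<open>Transport of relators between presentations\<close>

lemma (in group) normal_closure_eq_conj_span:
  assumes "R \<subseteq> carrier G"
  shows "normal_closure G R = conj_span G (carrier G) {} R"
proof
  have s: "subgroup (conj_span G (carrier G) {} R) G"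
    by (rule conj_span_subgroup) (use assms in auto)
  have "conj_span G (carrier G) {} R \<lhd> G"
    unfolding normal_inv_iff
    using s conj_span_conj[OF subgroup_self _ assms] by blast
  then show "normal_closure G R \<subseteq> conj_span G (carrier G) {} R"
    by (rule normal_closure_least) (rule conj_span_incl(2)[OF subgroup_self assms])
next
  have n: "normal_closure G R \<lhd> G" by (rule normal_closure_normal[OF assms])
  show "conj_span G (carrier G) {} R \<subseteq> normal_closure G R"
    by (rule conj_span_least)
      (use normal_imp_subgroup[OF n] normal_conjD(1)[OF n] subsetD[OF normal_closure_incl] in auto)
qed

text \<open>These are the elements on which \<open>\<phi>\<close> agrees with the identity modulo
  \<open>N\<close>, the equaliser of two homomorphisms into the quotient.\<close>

lemma (in group) subgroup_hom_twist:
  assumes N: "N \<lhd> G" and \<phi>: "\<phi> \<in> hom G G"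
  shows "subgroup {w \<in> carrier G. inv w \<otimes> \<phi> w \<in> N} G"
proof -
  interpret \<phi>: group_hom G G \<phi> using \<phi> by unfold_locales
  interpret N: normal N G by (rule N)
  show ?thesis
  proof (rule subgroupI)
    show "{w \<in> carrier G. inv w \<otimes> \<phi> w \<in> N} \<noteq> {}" by (auto intro!: exI[of _ \<one>])
  next
    fix a assume a: "a \<in> {w \<in> carrier G. inv w \<otimes> \<phi> w \<in> N}"
    have "inv (inv a) \<otimes> \<phi> (inv a) = a \<otimes> inv (inv a \<otimes> \<phi> a) \<otimes> inv a"
      using a by (simp add: word_simps)
    then show "inv a \<in> {w \<in> carrier G. inv w \<otimes> \<phi> w \<in> N}"
      using a normal_conjD(1)[OF N, of a "inv (inv a \<otimes> \<phi> a)"] by simp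
  next
    fix a b assume a: "a \<in> {w \<in> carrier G. inv w \<otimes> \<phi> w \<in> N}"
      and b: "b \<in> {w \<in> carrier G. inv w \<otimes> \<phi> w \<in> N}"
    have "inv (a \<otimes> b) \<otimes> \<phi> (a \<otimes> b) = (inv b \<otimes> (inv a \<otimes> \<phi> a) \<otimes> b) \<otimes> (inv b \<otimes> \<phi> b)"
      using a b by (simp add: word_simps)
    then show "a \<otimes> b \<in> {w \<in> carrier G. inv w \<otimes> \<phi> w \<in> N}"
      using a b normal_conjD(2)[OF N, of b "inv a \<otimes> \<phi> a"] by simp
  qed auto
qed

lemma (in group_hom) normal_preimage:
  assumes "N \<lhd> H"
  shows "{x \<in> carrier G. h x \<in> N} \<lhd> G"
proof -
  interpret N: normal N H by (rule assms)
  show ?thesis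
    unfolding G.normal_inv_iff
    by (auto intro!: G.subgroupI H.normal_conjD(1)[OF assms] exI[of _ \<one>])
qed

lemma (in group_hom) subgroup_preimage:
  assumes "subgroup N H"
  shows "subgroup {x \<in> carrier G. h x \<in> N} G"
proof -
  interpret N: subgroup N H by (rule assms)
  show ?thesis by (auto intro!: G.subgroupI exI[of _ \<one>])
qed

lemma (in group_hom) fin_cover_preimage:
  assumes N: "subgroup N H" and P: "P \<subseteq> carrier G" and c: "group.fin_cover H (h ` P) N"
  shows "G.fin_cover P {x \<in> carrier G. h x \<in> N}"
proof -
  obtain T where T: "finite T" "T \<subseteq> h ` P" "\<forall>p\<in>h ` P. \<exists>t\<in>T. p \<otimes>\<^bsub>H\<^esub> inv\<^bsub>H\<^esub> t \<in> N"
    using c H.fin_cover_def by auto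
  obtain T' where T': "T' \<subseteq> P" "finite T'" "T = h ` T'" using T finite_subset_image[OF T(1,2)] by blast
  show ?thesis
    unfolding G.fin_cover_def
  proof (intro exI conjI ballI)
    fix p assume p: "p \<in> P"
    then obtain t where t: "t \<in> T'" "h p \<otimes>\<^bsub>H\<^esub> inv\<^bsub>H\<^esub> h t \<in> N" using T(3) T'(3) by blast
    then have "p \<otimes> inv t \<in> {x \<in> carrier G. h x \<in> N}" using p P T'(1) by (auto simp: subset_iff)
    then show "\<exists>t\<in>T'. p \<otimes> inv t \<in> {x \<in> carrier G. h x \<in> N}" using t by blast
  qed (use T' in auto)
qed

text \<open>A Tietze-type transformation: modulo the elements \<open>y\<^sup>-\<^sup>1 \<sigma> (\<psi> y)\<close> for the generators \<open>y\<close>, every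
  element of \<open>P\<close> equals its image under \<open>\<sigma> \<circ> \<psi>\<close>.\<close>

lemma kernel_transfer:
  assumes "group P" "group M" "group G"
    and \<psi>: "\<psi> \<in> hom P M" and \<sigma>: "\<sigma> \<in> hom M P" and \<rho>: "\<rho> \<in> hom P G" and \<pi>: "\<pi> \<in> hom M G"
    and c: "\<And>x. x \<in> carrier P \<Longrightarrow> \<pi> (\<psi> x) = \<rho> x" "\<And>x. x \<in> carrier M \<Longrightarrow> \<rho> (\<sigma> x) = \<pi> x"
    and Y: "finite Y" "Y \<subseteq> carrier P" "generate P Y = carrier P"
    and R: "finite R" "R \<subseteq> carrier M" "kernel M G \<pi> = normal_closure M R"
  shows "\<exists>R'. finite R' \<and> R' \<subseteq> carrier P \<and> kernel P G \<rho> = normal_closure P R'"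
proof -
  interpret P: group P by fact
  interpret M: group M by fact
  interpret \<psi>: group_hom P M \<psi> using assms by (simp add: group_hom_def group_hom_axioms_def)
  interpret \<sigma>: group_hom M P \<sigma> using assms by (simp add: group_hom_def group_hom_axioms_def)
  interpret \<rho>: group_hom P G \<rho> using assms by (simp add: group_hom_def group_hom_axioms_def)
  interpret \<pi>: group_hom M G \<pi> using assms by (simp add: group_hom_def group_hom_axioms_def)
  define R' where "R' = \<sigma> ` R \<union> (\<lambda>y. inv\<^bsub>P\<^esub> y \<otimes>\<^bsub>P\<^esub> \<sigma> (\<psi> y)) ` Y"
  have R': "R' \<subseteq> carrier P" using R(2) Y(2) by (auto simp: R'_def)
  let ?N = "normal_closure P R'"
  have N: "?N \<lhd> P" by (rule P.normal_closure_normal[OF R'])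
  have "R' \<subseteq> kernel P G \<rho>"
  proof
    fix r assume "r \<in> R'"
    then consider x where "x \<in> R" "r = \<sigma> x" | y where "y \<in> Y" "r = inv\<^bsub>P\<^esub> y \<otimes>\<^bsub>P\<^esub> \<sigma> (\<psi> y)"
      unfolding R'_def by blast
    then show "r \<in> kernel P G \<rho>"
    proof cases
      case 1
      then have "x \<in> kernel M G \<pi>" using M.normal_closure_incl R(3) by blast
      then show ?thesis using 1 c(2) by (simp add: kernel_def)
    next
      case 2
      then show ?thesis using c Y(2) by (auto simp: kernel_def subset_iff)
    qed
  qed
  then have 1: "?N \<subseteq> kernel P G \<rho>" by (rule P.normal_closure_least[OF \<rho>.normal_kernel])
  have "\<sigma> ` R \<subseteq> ?N" using P.normal_closure_incl[of R'] by (auto simp: R'_def)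
  then have "normal_closure M R \<subseteq> {x \<in> carrier M. \<sigma> x \<in> ?N}"
    using R(2) by (intro M.normal_closure_least[OF \<sigma>.normal_preimage[OF N]]) auto
  then have 2: "\<sigma> x \<in> ?N" if "x \<in> carrier M" "\<pi> x = \<one>\<^bsub>G\<^esub>" for x
    using that R(3) by (auto simp: kernel_def)
  have "\<sigma> \<circ> \<psi> \<in> hom P P" using \<psi> \<sigma> by (rule hom_compose)
  from P.subgroup_hom_twist[OF N this]
  have "generate P Y \<subseteq> {w \<in> carrier P. inv\<^bsub>P\<^esub> w \<otimes>\<^bsub>P\<^esub> (\<sigma> \<circ> \<psi>) w \<in> ?N}"
  proof (rule P.generate_subgroup_incl[rotated])
    show "Y \<subseteq> {w \<in> carrier P. inv\<^bsub>P\<^esub> w \<otimes>\<^bsub>P\<^esub> (\<sigma> \<circ> \<psi>) w \<in> ?N}"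
      using P.normal_closure_incl[of R'] Y(2) by (auto simp: R'_def)
  qed
  then have 3: "inv\<^bsub>P\<^esub> w \<otimes>\<^bsub>P\<^esub> \<sigma> (\<psi> w) \<in> ?N" if "w \<in> carrier P" for w using that Y(3) by auto
  have "w \<in> ?N" if w: "w \<in> kernel P G \<rho>" for w
  proof -
    have wc: "w \<in> carrier P" and "\<pi> (\<psi> w) = \<one>\<^bsub>G\<^esub>" using w c(1) by (auto simp: kernel_def)
    then have "\<sigma> (\<psi> w) \<in> ?N" using 2 by simp
    \<comment> \<open>This product equals \<open>w\<close>. Its first factor lies in
      \<open>?N\<close> because \<open>\<psi> w\<close> is in the kernel of \<open>\<pi>\<close>,
      its second because \<open>\<sigma> \<circ> \<psi>\<close> is the identity modulo
      \<open>?N\<close>.\<close>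
    then have "\<sigma> (\<psi> w) \<otimes>\<^bsub>P\<^esub> inv\<^bsub>P\<^esub> (inv\<^bsub>P\<^esub> w \<otimes>\<^bsub>P\<^esub> \<sigma> (\<psi> w)) \<in> ?N"
      using 3[OF wc] normal_imp_subgroup[OF N] by (meson subgroup.m_closed subgroup.m_inv_closed)
    then show ?thesis using wc by (simp add: P.word_simps)
  qed
  then have "kernel P G \<rho> = ?N" using 1 by blast
  moreover have "finite R'" using R(1) Y(1) by (simp add: R'_def)
  ultimately show ?thesis using R' by blast
qed

text \<open>Finite presentability does not depend on the finite generating system. Both sources are
  free, so the two surjections onto \<open>G\<close> lift through each other, and the relators can
  be carried across.\<close>

lemma finitely_presented_kernel:
  assumes "finitely_presented G" "finite X" "\<rho> \<in> hom (free_group X) G"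
    and onto: "\<rho> ` carrier (free_group X) = carrier G"
  shows "\<exists>R. finite R \<and> R \<subseteq> carrier (free_group X) \<and> kernel (free_group X) G \<rho> = normal_closure (free_group X) R"
proof -
  have G: "group G" using assms by (simp add: finitely_presented_def)
  obtain Y :: "nat set" and R \<pi> where Y: "finite R" "R \<subseteq> carrier (free_group Y)"
    "\<pi> \<in> hom (free_group Y) G" "\<pi> ` carrier (free_group Y) = carrier G"
    "kernel (free_group Y) G \<pi> = normal_closure (free_group Y) R"
    using assms(1) unfolding finitely_presented_iff by (elim conjE exE) (rule that; assumption)
  obtain \<theta> where \<theta>: "\<theta> \<in> hom (free_group X) (free_group Y)"
    "\<forall>w\<in>carrier (free_group X). \<pi> (\<theta> w) = \<rho> w"
    using free_group_lift[OF G group_free_group Y(3) assms(3)] onto Y(4) by auto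
  obtain \<theta>' where \<theta>': "\<theta>' \<in> hom (free_group Y) (free_group X)"
    "\<forall>w\<in>carrier (free_group Y). \<rho> (\<theta>' w) = \<pi> w"
    using free_group_lift[OF G group_free_group assms(3) Y(3)] onto Y(4) by auto
  show ?thesis
    by (rule kernel_transfer[OF group_free_group group_free_group G \<theta>(1) \<theta>'(1) assms(3) Y(3)
          _ _ _ free_gens_carrier generate_free_gens Y(1,2,5)])
      (use \<theta>(2) \<theta>'(2) assms(2) in \<open>auto simp: free_gens_def\<close>)
qed

lemma finitely_presented_fin_gen:
  assumes "finitely_presented G"
  shows "\<exists>E. finite E \<and> E \<subseteq> carrier G \<and> generate G E = carrier G"
proof -
  have G: "group G" using assms by (simp add: finitely_presented_def)
  obtain X :: "nat set" and R \<pi> where X: "finite X" and "finite R" "R \<subseteq> carrier (free_group X)"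
    and \<pi>: "\<pi> \<in> hom (free_group X) G" "\<pi> ` carrier (free_group X) = carrier G"
    using assms unfolding finitely_presented_iff by (elim conjE exE) (rule that; assumption)
  have "generate G (\<pi> ` free_gens X) = carrier G"
    unfolding group.hom_image_generate[OF group_free_group G \<pi>(1) free_gens_carrier, symmetric]
      generate_free_gens by (rule \<pi>(2))
  moreover have "\<pi> ` free_gens X \<subseteq> carrier G" using \<pi>(2) free_gens_carrier by blast
  ultimately show ?thesis using X by (intro exI[of _ "\<pi> ` free_gens X"]) (simp add: free_gens_def)
qed

text \<open>Subgroups of free groups are projective.  The free group acts on \<open>F \<times> C\<close> by
  \<open>x (g, k) = (x g, e (g, x) k)\<close>, where \<open>e (g, x)\<close> depends only on the coset \<open>g M\<close> and lifts the
  Schreier generator \<open>t (x g)\<^sup>-\<^sup>1 x t (g)\<close> of \<open>M\<close>.  The section sends \<open>m\<close> to the second component of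
  \<open>m (1, 1)\<close>.\<close>

lemma free_subgroup_projective:
  fixes X :: "'x set" and C :: "('c, 'd) monoid_scheme"
  assumes M: "subgroup M (free_group X)" and C: "group C" and q: "q \<in> hom C (free_group X)"
    and onto: "M \<subseteq> q ` carrier C"
  shows "\<exists>\<sigma>\<in>hom ((free_group X)\<lparr>carrier := M\<rparr>) C. \<forall>m\<in>M. q (\<sigma> m) = m"
proof -
  define F where "F = free_group X"
  interpret F: group F unfolding F_def by (rule group_free_group)
  interpret C: group C by (rule C)
  interpret q: group_hom C F q using q by unfold_locales (simp add: F_def)
  interpret M: subgroup M F using M by (simp add: F_def)
  \<comment> \<open>The choice is made from the coset as a set, so \<open>t\<close> is constant on
    left cosets of \<open>M\<close>. The value \<open>\<one>\<close> on \<open>M\<close> is what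
    makes the final section satisfy \<open>q (\<sigma> m) = m\<close> exactly.\<close>
  define t where "t g = (if g \<in> M then \<one>\<^bsub>F\<^esub> else (SOME y. y \<in> g <#\<^bsub>F\<^esub> M))" for g
  have t: "t g \<in> g <#\<^bsub>F\<^esub> M" if "g \<in> carrier F" for g
  proof (cases "g \<in> M")
    case True
    have "\<one>\<^bsub>F\<^esub> \<in> g <#\<^bsub>F\<^esub> M"
      unfolding l_coset_def using M.m_inv_closed[OF True] that by (intro UN_I[of "inv\<^bsub>F\<^esub> g"]) auto
    then show ?thesis using True by (simp add: t_def)
  next
    case False
    have "g \<otimes>\<^bsub>F\<^esub> \<one>\<^bsub>F\<^esub> \<in> g <#\<^bsub>F\<^esub> M" unfolding l_coset_def using M.one_closed by blast
    then have "(SOME y. y \<in> g <#\<^bsub>F\<^esub> M) \<in> g <#\<^bsub>F\<^esub> M" by (rule someI)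
    then show ?thesis using False by (simp add: t_def)
  qed
  have tc: "t g \<in> carrier F" if "g \<in> carrier F" for g
    using t[OF that] that by (auto simp: l_coset_def)
  have tM: "inv\<^bsub>F\<^esub> (t g) \<otimes>\<^bsub>F\<^esub> g \<in> M" "inv\<^bsub>F\<^esub> g \<otimes>\<^bsub>F\<^esub> t g \<in> M" if g: "g \<in> carrier F" for g
    using t[OF g] g M.mem_carrier by (auto simp: l_coset_def F.word_simps)
  have coset: "(g \<otimes>\<^bsub>F\<^esub> m) <#\<^bsub>F\<^esub> M = g <#\<^bsub>F\<^esub> M" if "g \<in> carrier F" "m \<in> M" for g m
  proof -
    have "g \<otimes>\<^bsub>F\<^esub> m \<in> g <#\<^bsub>F\<^esub> M" using that by (auto simp: l_coset_def)
    then show ?thesis using F.l_repr_independence[of "g \<otimes>\<^bsub>F\<^esub> m" g M] that M.is_subgroup by simp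
  qed
  have tm: "t (g \<otimes>\<^bsub>F\<^esub> m) = t g" if g: "g \<in> carrier F" "m \<in> M" for g m
  proof -
    have "g \<otimes>\<^bsub>F\<^esub> m \<in> M \<longleftrightarrow> g \<in> M"
    proof
      assume "g \<otimes>\<^bsub>F\<^esub> m \<in> M"
      then have "(g \<otimes>\<^bsub>F\<^esub> m) \<otimes>\<^bsub>F\<^esub> inv\<^bsub>F\<^esub> m \<in> M" using g by blast
      then show "g \<in> M" using g by (simp add: F.m_assoc)
    qed (use g in blast)
    then show ?thesis using coset[OF g] by (simp add: t_def)
  qed
  define x' where "x' x = [(True, x)]" for x :: 'x
  have x': "x' x \<in> carrier F" if "x \<in> X" for x using that by (simp add: x'_def F_def free_group_def)
  define e where "e g x = (SOME k. k \<in> carrier C \<and> q k = inv\<^bsub>F\<^esub> (t (x' x \<otimes>\<^bsub>F\<^esub> g)) \<otimes>\<^bsub>F\<^esub> (x' x \<otimes>\<^bsub>F\<^esub> t g))" for g x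
  have e: "e g x \<in> carrier C" "q (e g x) = inv\<^bsub>F\<^esub> (t (x' x \<otimes>\<^bsub>F\<^esub> g)) \<otimes>\<^bsub>F\<^esub> (x' x \<otimes>\<^bsub>F\<^esub> t g)"
    if g: "g \<in> carrier F" and x: "x \<in> X" for g x
  proof -
    have "(inv\<^bsub>F\<^esub> (t (x' x \<otimes>\<^bsub>F\<^esub> g)) \<otimes>\<^bsub>F\<^esub> (x' x \<otimes>\<^bsub>F\<^esub> g)) \<otimes>\<^bsub>F\<^esub> (inv\<^bsub>F\<^esub> g \<otimes>\<^bsub>F\<^esub> t g) \<in> M"
      using tM g x' x by blast
    then have "inv\<^bsub>F\<^esub> (t (x' x \<otimes>\<^bsub>F\<^esub> g)) \<otimes>\<^bsub>F\<^esub> (x' x \<otimes>\<^bsub>F\<^esub> t g) \<in> M"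
      using g x x' tc by (simp add: F.word_simps)
    then have "\<exists>k. k \<in> carrier C \<and> q k = inv\<^bsub>F\<^esub> (t (x' x \<otimes>\<^bsub>F\<^esub> g)) \<otimes>\<^bsub>F\<^esub> (x' x \<otimes>\<^bsub>F\<^esub> t g)"
      using onto by (metis imageE subsetD)
    from someI_ex[OF this]
    show "e g x \<in> carrier C" "q (e g x) = inv\<^bsub>F\<^esub> (t (x' x \<otimes>\<^bsub>F\<^esub> g)) \<otimes>\<^bsub>F\<^esub> (x' x \<otimes>\<^bsub>F\<^esub> t g)"
      unfolding e_def by auto
  qed
  \<comment> \<open>The predicate under \<open>SOME\<close> in \<open>e\<close> depends on
    \<open>g\<close> only through values of \<open>t\<close>, so the chosen element itself is
    constant on cosets.\<close>
  have em: "e (g \<otimes>\<^bsub>F\<^esub> m) x = e g x" if "g \<in> carrier F" "m \<in> M" "x \<in> X" for g m x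
    using tm[OF that(1,2)] tm[of "x' x \<otimes>\<^bsub>F\<^esub> g" m] that x' by (simp add: e_def F.m_assoc)
  define \<Omega> where "\<Omega> = carrier F \<times> carrier C"
  define \<phi> where "\<phi> x = (\<lambda>y\<in>\<Omega>. (x' x \<otimes>\<^bsub>F\<^esub> fst y, e (fst y) x \<otimes>\<^bsub>C\<^esub> snd y))" for x
  have "\<phi> x \<in> Bij \<Omega>" if x: "x \<in> X" for x
  proof -
    have "bij_betw (\<phi> x) \<Omega> \<Omega>"
    proof (rule bij_betw_byWitness)
      let ?g = "\<lambda>g. inv\<^bsub>F\<^esub> x' x \<otimes>\<^bsub>F\<^esub> g"
      let ?f = "\<lambda>y. (?g (fst y), inv\<^bsub>C\<^esub> e (?g (fst y)) x \<otimes>\<^bsub>C\<^esub> snd y)"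
      show "\<forall>a\<in>\<Omega>. ?f (\<phi> x a) = a" "\<forall>a\<in>\<Omega>. \<phi> x (?f a) = a" "\<phi> x ` \<Omega> \<subseteq> \<Omega>" "?f ` \<Omega> \<subseteq> \<Omega>"
        using x x' e(1) by (auto simp: \<phi>_def \<Omega>_def)
    qed
    then show ?thesis by (simp add: Bij_def \<phi>_def)
  qed
  then have "\<phi> \<in> X \<rightarrow> carrier (BijGroup \<Omega>)" by (simp add: BijGroup_def)
  from free_group_universal(1)[OF group_BijGroup this]
  obtain h where h: "h \<in> hom F (BijGroup \<Omega>)" "\<And>x. x \<in> X \<Longrightarrow> h (x' x) = \<phi> x"
    unfolding F_def x'_def by blast
  interpret h: group_hom F "BijGroup \<Omega>" h
    using h(1) group_BijGroup F.is_group by (simp add: group_hom_def group_hom_axioms_def)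
  have hB: "h w \<in> Bij \<Omega>" if "w \<in> carrier F" for w
    using h.hom_closed[OF that] by (simp add: BijGroup_def)
  have hm: "h (w \<otimes>\<^bsub>F\<^esub> v) y = h w (h v y)" if "w \<in> carrier F" "v \<in> carrier F" "y \<in> \<Omega>" for w v y
    using that hB by (simp add: BijGroup_def compose_def)
  note h.hom_inv [simp del] h.hom_mult [simp del]
  have h1: "h \<one>\<^bsub>F\<^esub> y = y" if "y \<in> \<Omega>" for y
    using h.hom_one that by (simp add: BijGroup_def)
  have h\<Omega>: "h w y \<in> \<Omega>" if "w \<in> carrier F" "y \<in> \<Omega>" for w y
    using Bij_imp_funcset[OF hB[OF that(1)]] that(2) by blast
  \<comment> \<open>The second clause says that \<open>(g, k)\<close> mapped to
    \<open>t g \<otimes> q k\<close> is equivariant for left multiplication, the third that the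
    action commutes with right translation by elements of \<open>M \<times> C\<close>. Both pass
    from the generators to all words.\<close>
  define good where "good w y y' \<longleftrightarrow> fst y' = w \<otimes>\<^bsub>F\<^esub> fst y \<and>
      t (fst y') \<otimes>\<^bsub>F\<^esub> q (snd y') = w \<otimes>\<^bsub>F\<^esub> (t (fst y) \<otimes>\<^bsub>F\<^esub> q (snd y)) \<and>
      (\<forall>m\<in>M. \<forall>d\<in>carrier C. h w (fst y \<otimes>\<^bsub>F\<^esub> m, snd y \<otimes>\<^bsub>C\<^esub> d) = (fst y' \<otimes>\<^bsub>F\<^esub> m, snd y' \<otimes>\<^bsub>C\<^esub> d))" for w y y'
  have gen: "good (x' x) y (h (x' x) y)" if x: "x \<in> X" and y: "y \<in> \<Omega>" for x y
  proof -
    have c: "fst y \<in> carrier F" "snd y \<in> carrier C" "x' x \<in> carrier F" using y x x' by (auto simp: \<Omega>_def)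
    have hy: "h (x' x) (g, k) = (x' x \<otimes>\<^bsub>F\<^esub> g, e g x \<otimes>\<^bsub>C\<^esub> k)"
      if "g \<in> carrier F" "k \<in> carrier C" for g k
      using h(2)[OF x] that by (simp add: \<phi>_def \<Omega>_def)
    have y2: "h (x' x) y = (x' x \<otimes>\<^bsub>F\<^esub> fst y, e (fst y) x \<otimes>\<^bsub>C\<^esub> snd y)"
      using hy[OF c(1,2)] by simp
    show ?thesis
      unfolding good_def y2
      using c x e[OF c(1) x] em[OF c(1) _ x] tc by (auto simp: hy F.m_assoc C.m_assoc)
  qed
  have good: "\<forall>y\<in>\<Omega>. good w y (h w y)" if "w \<in> generate F (free_gens X)" for w
    using that
  proof (induction rule: generate.induct)
    case one
    have "(fst y \<otimes>\<^bsub>F\<^esub> m, snd y \<otimes>\<^bsub>C\<^esub> d) \<in> \<Omega>" if "y \<in> \<Omega>" "m \<in> M" "d \<in> carrier C" for y m d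
      using that by (auto simp: \<Omega>_def)
    then show ?case using h1 tc by (auto simp: good_def \<Omega>_def)
  next
    case (incl w)
    then obtain x where "x \<in> X" "w = x' x" by (auto simp: free_gens_def x'_def)
    then show ?case using gen by blast
  next
    case (inv w)
    then obtain x where x: "x \<in> X" "w = x' x" by (auto simp: free_gens_def x'_def)
    show ?case
    proof
      fix y assume y: "y \<in> \<Omega>"
      have w: "w \<in> carrier F" using x x' by simp
      define z where "z = h (inv\<^bsub>F\<^esub> w) y"
      have z: "z \<in> \<Omega>" using h\<Omega> w y by (simp add: z_def)
      have hz: "h w z = y" using hm[of w "inv\<^bsub>F\<^esub> w" y] w y h1 by (simp add: z_def)
      have g: "good w z y" using gen[OF x(1) z] x(2) hz by simp
      have c: "fst y \<in> carrier F" "snd y \<in> carrier C" "fst z \<in> carrier F" "snd z \<in> carrier C"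
        using y z by (auto simp: \<Omega>_def)
      have "t (fst z) \<otimes>\<^bsub>F\<^esub> q (snd z) = inv\<^bsub>F\<^esub> w \<otimes>\<^bsub>F\<^esub> (t (fst y) \<otimes>\<^bsub>F\<^esub> q (snd y))"
      proof -
        have "t (fst y) \<otimes>\<^bsub>F\<^esub> q (snd y) = w \<otimes>\<^bsub>F\<^esub> (t (fst z) \<otimes>\<^bsub>F\<^esub> q (snd z))"
          using g unfolding good_def by blast
        then show ?thesis using w c tc by simp
      qed
      moreover have "fst z = inv\<^bsub>F\<^esub> w \<otimes>\<^bsub>F\<^esub> fst y" using g w c by (simp add: good_def)
      moreover have "h (inv\<^bsub>F\<^esub> w) (fst y \<otimes>\<^bsub>F\<^esub> m, snd y \<otimes>\<^bsub>C\<^esub> d) = (fst z \<otimes>\<^bsub>F\<^esub> m, snd z \<otimes>\<^bsub>C\<^esub> d)"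
        if md: "m \<in> M" "d \<in> carrier C" for m d
      proof -
        have z': "(fst z \<otimes>\<^bsub>F\<^esub> m, snd z \<otimes>\<^bsub>C\<^esub> d) \<in> \<Omega>" using c md by (auto simp: \<Omega>_def)
        have "h w (fst z \<otimes>\<^bsub>F\<^esub> m, snd z \<otimes>\<^bsub>C\<^esub> d) = (fst y \<otimes>\<^bsub>F\<^esub> m, snd y \<otimes>\<^bsub>C\<^esub> d)"
          using g md by (simp add: good_def)
        then show ?thesis using hm[of "inv\<^bsub>F\<^esub> w" w, OF _ w z'] w h1[OF z'] by simp
      qed
      ultimately show "good (inv\<^bsub>F\<^esub> w) y (h (inv\<^bsub>F\<^esub> w) y)" by (simp add: good_def z_def)
    qed
  next
    case (eng w v)
    have wv: "w \<in> carrier F" "v \<in> carrier F"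
      using eng.hyps generate_free_gens[of X] by (auto simp: F_def)
    show ?case
    proof
      fix y assume y: "y \<in> \<Omega>"
      define z where "z = h v y"
      have z: "z \<in> \<Omega>" using h\<Omega> wv y by (simp add: z_def)
      have g: "good v y z" "good w z (h w z)" using eng.IH y z by (auto simp: z_def)
      have c: "fst y \<in> carrier F" "snd y \<in> carrier C" using y by (auto simp: \<Omega>_def)
      have hwv: "h (w \<otimes>\<^bsub>F\<^esub> v) y = h w z" using hm[OF wv y] by (simp add: z_def)
      have "h (w \<otimes>\<^bsub>F\<^esub> v) (fst y \<otimes>\<^bsub>F\<^esub> m, snd y \<otimes>\<^bsub>C\<^esub> d)
          = (fst (h w z) \<otimes>\<^bsub>F\<^esub> m, snd (h w z) \<otimes>\<^bsub>C\<^esub> d)"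
        if md: "m \<in> M" "d \<in> carrier C" for m d
      proof -
        have "h (w \<otimes>\<^bsub>F\<^esub> v) (fst y \<otimes>\<^bsub>F\<^esub> m, snd y \<otimes>\<^bsub>C\<^esub> d)
            = h w (h v (fst y \<otimes>\<^bsub>F\<^esub> m, snd y \<otimes>\<^bsub>C\<^esub> d))"
          using c md by (intro hm[OF wv]) (simp add: \<Omega>_def)
        also have "\<dots> = h w (fst z \<otimes>\<^bsub>F\<^esub> m, snd z \<otimes>\<^bsub>C\<^esub> d)"
          using g(1) md unfolding good_def by simp
        also have "\<dots> = (fst (h w z) \<otimes>\<^bsub>F\<^esub> m, snd (h w z) \<otimes>\<^bsub>C\<^esub> d)"
          using g(2) md unfolding good_def by blast
        finally show ?thesis .
      qed
      moreover have "fst (h w z) = w \<otimes>\<^bsub>F\<^esub> v \<otimes>\<^bsub>F\<^esub> fst y"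
        using g wv c by (simp add: good_def F.m_assoc)
      moreover have "t (fst (h w z)) \<otimes>\<^bsub>F\<^esub> q (snd (h w z))
          = w \<otimes>\<^bsub>F\<^esub> v \<otimes>\<^bsub>F\<^esub> (t (fst y) \<otimes>\<^bsub>F\<^esub> q (snd y))"
      proof -
        have "t (fst (h w z)) \<otimes>\<^bsub>F\<^esub> q (snd (h w z)) = w \<otimes>\<^bsub>F\<^esub> (t (fst z) \<otimes>\<^bsub>F\<^esub> q (snd z))"
          using g(2) unfolding good_def by blast
        also have "t (fst z) \<otimes>\<^bsub>F\<^esub> q (snd z) = v \<otimes>\<^bsub>F\<^esub> (t (fst y) \<otimes>\<^bsub>F\<^esub> q (snd y))"
          using g(1) unfolding good_def by blast
        finally show ?thesis using wv c tc by (simp add: F.m_assoc)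
      qed
      ultimately show "good (w \<otimes>\<^bsub>F\<^esub> v) y (h (w \<otimes>\<^bsub>F\<^esub> v) y)"
        unfolding good_def hwv by blast
    qed
  qed
  define y1 where "y1 = (\<one>\<^bsub>F\<^esub>, \<one>\<^bsub>C\<^esub>)"
  define \<sigma> where "\<sigma> m = snd (h m y1)" for m
  have y1: "y1 \<in> \<Omega>" by (simp add: y1_def \<Omega>_def)
  have g1: "good m y1 (h m y1)" if "m \<in> M" for m
  proof -
    have "m \<in> generate F (free_gens X)"
      using M.mem_carrier[OF that] unfolding F_def generate_free_gens .
    then show ?thesis using good y1 by blast
  qed
  have hmy: "h m y1 = (m, \<sigma> m)" if m: "m \<in> M" for m
  proof -
    have "fst (h m y1) = m \<otimes>\<^bsub>F\<^esub> fst y1" using g1[OF m] unfolding good_def by blast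
    then show ?thesis using M.mem_carrier[OF m] by (simp add: y1_def \<sigma>_def prod_eq_iff)
  qed
  have \<sigma>c: "\<sigma> m \<in> carrier C" if "m \<in> M" for m
    using h\<Omega>[OF M.mem_carrier[OF that] y1] by (auto simp: \<sigma>_def \<Omega>_def)
  have t1: "t m = \<one>\<^bsub>F\<^esub>" if "m \<in> M" for m using that by (simp add: t_def)
  have "q (\<sigma> m) = m" if m: "m \<in> M" for m
  proof -
    have "t (fst (h m y1)) \<otimes>\<^bsub>F\<^esub> q (snd (h m y1)) = m \<otimes>\<^bsub>F\<^esub> (t (fst y1) \<otimes>\<^bsub>F\<^esub> q (snd y1))"
      using g1[OF m] unfolding good_def by blast
    then show ?thesis
      using M.mem_carrier[OF m] \<sigma>c[OF m] t1[OF M.one_closed]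
      unfolding hmy[OF m] fst_conv snd_conv t1[OF m] by (simp add: y1_def)
  qed
  moreover have "\<sigma> (m \<otimes>\<^bsub>F\<^esub> n) = \<sigma> m \<otimes>\<^bsub>C\<^esub> \<sigma> n" if m: "m \<in> M" and n: "n \<in> M" for m n
  proof -
    have "h (m \<otimes>\<^bsub>F\<^esub> n) y1 = h m (n, \<sigma> n)"
      unfolding hm[OF M.mem_carrier[OF m] M.mem_carrier[OF n] y1] hmy[OF n] ..
    \<comment> \<open>As \<open>(n, \<sigma> n)\<close> is the right translate of \<open>y1\<close>
      by itself, commutation of \<open>m\<close> with right translations yields multiplicativity of
      \<open>\<sigma>\<close>.\<close>
    also have "(n, \<sigma> n) = (fst y1 \<otimes>\<^bsub>F\<^esub> n, snd y1 \<otimes>\<^bsub>C\<^esub> \<sigma> n)"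
      using M.mem_carrier[OF n] \<sigma>c[OF n] by (simp add: y1_def)
    also have "h m \<dots> = (fst (h m y1) \<otimes>\<^bsub>F\<^esub> n, snd (h m y1) \<otimes>\<^bsub>C\<^esub> \<sigma> n)"
      using g1[OF m] n \<sigma>c[OF n] unfolding good_def by blast
    finally show ?thesis unfolding hmy[OF m] by (simp add: \<sigma>_def)
  qed
  ultimately show ?thesis using \<sigma>c by (intro bexI[of _ \<sigma>]) (auto simp: hom_def F_def)
qed

text \<open>The preimage of \<open>H\<close> in the free group is finitely generated, and being
  projective it is a retract of a free group of finite rank. That retraction replaces freeness of
  the preimage, since \<open>kernel_transfer\<close> asks only for maps in both directions over
  \<open>H\<close>.\<close>

theorem finitely_presented_finite_index:
  assumes fp: "finitely_presented G" and H: "subgroup H G" and fi: "group.fin_cover G (carrier G) H"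
  shows "finitely_presented (G\<lparr>carrier := H\<rparr>)"
proof -
  obtain X :: "nat set" and R \<pi> where X: "finite X" "finite R" "R \<subseteq> carrier (free_group X)"
    "\<pi> \<in> hom (free_group X) G" "\<pi> ` carrier (free_group X) = carrier G"
    "kernel (free_group X) G \<pi> = normal_closure (free_group X) R" and G: "group G"
    using fp unfolding finitely_presented_iff by (elim conjE exE) (rule that; assumption)
  interpret G: group G by (rule G)
  define F where "F = free_group X"
  interpret F: group F unfolding F_def by (rule group_free_group)
  interpret \<pi>: group_hom F G \<pi> using X(4) by unfold_locales (simp add: F_def)
  let ?K = "{w \<in> carrier F. \<pi> w \<in> H}"
  have K: "subgroup ?K F" by (rule \<pi>.subgroup_preimage[OF H])
  have fK: "F.fin_cover (carrier F) ?K"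
    using \<pi>.fin_cover_preimage[OF H order_refl] fi X(5) by (simp add: F_def)
  let ?M = "F\<lparr>carrier := ?K\<rparr>" and ?H = "G\<lparr>carrier := H\<rparr>"
  have M: "group ?M" using F.subgroup_imp_group[OF K] .
  have gH: "group ?H" using G.subgroup_imp_group[OF H] .
  obtain E where E: "finite E" "E \<subseteq> ?K" "generate F E = ?K"
    using F.fin_cover_finitely_generated[OF K _ _ _ fK, of "free_gens X"] X(1) free_gens_carrier
      generate_free_gens[of X] by (auto simp: F_def free_gens_def)
  obtain Y :: "nat set" and \<psi> where Y: "finite Y" and \<psi>: "\<psi> \<in> hom (free_group Y) ?M"
    "\<psi> ` carrier (free_group Y) = ?K"
    using free_group_onto[OF M E(1)] E(2,3) F.generate_consistent[OF E(2) K] by auto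
  have \<psi>F: "\<psi> \<in> hom (free_group Y) F" using \<psi>(1) by (auto simp: hom_def)
  obtain \<sigma> where \<sigma>: "\<sigma> \<in> hom ?M (free_group Y)" "\<forall>m\<in>?K. \<psi> (\<sigma> m) = m"
    using free_subgroup_projective[of ?K X, OF _ group_free_group \<psi>F[unfolded F_def]] K \<psi>(2)
    unfolding F_def by blast
  have \<pi>': "\<pi> \<in> hom ?M ?H" by (auto simp: hom_def)
  have \<rho>: "\<pi> \<circ> \<psi> \<in> hom (free_group Y) ?H" using \<psi>(1) \<pi>' by (rule hom_compose)
  obtain T where T: "finite T" "T \<subseteq> carrier F" "\<forall>p\<in>carrier F. \<exists>t\<in>T. p \<otimes>\<^bsub>F\<^esub> inv\<^bsub>F\<^esub> t \<in> ?K"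
    using fK F.fin_cover_def by auto
  \<comment> \<open>The normal closure is now taken in a smaller group. Every \<open>f\<close> is an
    element of \<open>?K\<close> times some \<open>t\<close> in \<open>T\<close>, so conjugating the
    relators by \<open>T\<close> beforehand makes up for the loss.\<close>
  define R' where "R' = (\<lambda>(t,r). t \<otimes>\<^bsub>F\<^esub> r \<otimes>\<^bsub>F\<^esub> inv\<^bsub>F\<^esub> t) ` (T \<times> R)"
  have Rk: "\<pi> r = \<one>\<^bsub>G\<^esub>" if "r \<in> R" for r
    using F.normal_closure_incl[of R] X(6) that by (auto simp: F_def kernel_def)
  have RF: "R \<subseteq> carrier F" using X(3) by (simp add: F_def)
  have R'K: "R' \<subseteq> kernel F G \<pi>"
    using T(2) RF Rk by (auto simp: R'_def kernel_def subset_iff)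
  have kK: "kernel F G \<pi> \<subseteq> ?K" using subgroup.one_closed[OF H] by (auto simp: kernel_def)
  have kM: "kernel ?M ?H \<pi> = kernel F G \<pi>" using kK by (auto simp: kernel_def)
  interpret M: group ?M by (rule M)
  interpret \<pi>': group_hom ?M ?H \<pi> using \<pi>' M gH by (simp add: group_hom_def group_hom_axioms_def)
  let ?B = "normal_closure ?M R'"
  have B: "?B \<lhd> ?M" by (rule M.normal_closure_normal) (use R'K kK in auto)
  have "?B \<subseteq> kernel F G \<pi>"
    using M.normal_closure_least[OF \<pi>'.normal_kernel] R'K kM by simp
  moreover have "kernel F G \<pi> \<subseteq> ?B"
  proof -
    have BF: "subgroup ?B F" using F.incl_subgroup[OF K] normal_imp_subgroup[OF B] by blast
    have "f \<otimes>\<^bsub>F\<^esub> r \<otimes>\<^bsub>F\<^esub> inv\<^bsub>F\<^esub> f \<in> ?B" if f: "f \<in> carrier F" and r: "r \<in> R" for f r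
    proof -
      obtain t where t: "t \<in> T" "f \<otimes>\<^bsub>F\<^esub> inv\<^bsub>F\<^esub> t \<in> ?K" using T(3) f by blast
      have c: "t \<in> carrier F" "r \<in> carrier F" using t T r RF by auto
      have "t \<otimes>\<^bsub>F\<^esub> r \<otimes>\<^bsub>F\<^esub> inv\<^bsub>F\<^esub> t \<in> R'" using t r by (auto simp: R'_def)
      then have "t \<otimes>\<^bsub>F\<^esub> r \<otimes>\<^bsub>F\<^esub> inv\<^bsub>F\<^esub> t \<in> ?B" using M.normal_closure_incl[of R'] by blast
      then have "(f \<otimes>\<^bsub>F\<^esub> inv\<^bsub>F\<^esub> t) \<otimes>\<^bsub>F\<^esub> (t \<otimes>\<^bsub>F\<^esub> r \<otimes>\<^bsub>F\<^esub> inv\<^bsub>F\<^esub> t) \<otimes>\<^bsub>F\<^esub> inv\<^bsub>F\<^esub> (f \<otimes>\<^bsub>F\<^esub> inv\<^bsub>F\<^esub> t) \<in> ?B"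
        using M.normal_conjD(1)[OF B, of "f \<otimes>\<^bsub>F\<^esub> inv\<^bsub>F\<^esub> t"] t F.m_inv_consistent[OF K] by simp
      then show ?thesis using f c by (simp add: F.word_simps)
    qed
    then have "conj_span F (carrier F) {} R \<subseteq> ?B" by (intro F.conj_span_least BF) auto
    then show ?thesis using F.normal_closure_eq_conj_span[OF RF] X(6) by (simp add: F_def)
  qed
  ultimately have ker: "kernel ?M ?H \<pi> = normal_closure ?M R'" using kM by blast
  have "\<exists>R''. finite R'' \<and> R'' \<subseteq> carrier (free_group Y) \<and>
      kernel (free_group Y) ?H (\<pi> \<circ> \<psi>) = normal_closure (free_group Y) R''"
    by (rule kernel_transfer[OF group_free_group M gH \<psi>(1) \<sigma>(1) \<rho> \<pi>' _ _ _ free_gens_carrier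
          generate_free_gens _ _ ker])
      (use \<sigma>(2) Y T(1) X(2) R'K kK in \<open>auto simp: free_gens_def R'_def\<close>)
  then obtain R'' where R'': "finite R''" "R'' \<subseteq> carrier (free_group Y)"
    "kernel (free_group Y) ?H (\<pi> \<circ> \<psi>) = normal_closure (free_group Y) R''" by blast
  have "x \<in> \<pi> ` ?K" if x: "x \<in> H" for x
  proof -
    have "x \<in> \<pi> ` carrier F" using subgroup.mem_carrier[OF H x] X(5) by (simp add: F_def)
    then show ?thesis using x by blast
  qed
  then have "\<pi> ` ?K = H" by blast
  then have "(\<pi> \<circ> \<psi>) ` carrier (free_group Y) = carrier ?H"
    by (simp only: image_comp[symmetric] \<psi>(2)) simp
  then show ?thesis
    unfolding finitely_presented_iff using gH Y \<rho> R'' by (intro conjI exI[of _ Y] exI[of _ R''] exI[of _ "\<pi> \<circ> \<psi>"])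
qed

section \<open>Polycyclic chains\<close>

text \<open>A subnormal chain from \<open>N\<close> up to \<open>P\<close> with cyclic factors,
  finite or infinite. If \<open>N\<close> is normal in \<open>P\<close>, it says that
  \<open>P/N\<close> is polycyclic. Conjugation is required in both directions because
  \<open>t\<close> could otherwise map \<open>P\<close> into a proper subgroup.\<close>

inductive pc_chain :: "('a, 'b) monoid_scheme \<Rightarrow> 'a set \<Rightarrow> 'a set \<Rightarrow> bool"
  for G (structure) and N where
  base: "subgroup N G \<Longrightarrow> pc_chain G N N"
| step: "pc_chain G N P \<Longrightarrow> t \<in> carrier G \<Longrightarrow> (\<And>p. p \<in> P \<Longrightarrow> t \<otimes> p \<otimes> inv t \<in> P) \<Longrightarrow>
    (\<And>p. p \<in> P \<Longrightarrow> inv t \<otimes> p \<otimes> t \<in> P) \<Longrightarrow> pc_chain G N (generate G (insert t P))"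

lemma pc_chain_trans:
  assumes "pc_chain G P Q" "pc_chain G N P"
  shows "pc_chain G N Q"
  using assms by (induction rule: pc_chain.induct) (auto intro: pc_chain.step)

lemma (in group) pc_chain_subgroup:
  assumes "pc_chain G N P"
  shows "subgroup N G \<and> subgroup P G \<and> N \<subseteq> P"
  using assms
proof (induction rule: pc_chain.induct)
  case (step P t)
  have "insert t P \<subseteq> carrier G" using step subgroup.subset by blast
  then have "subgroup (generate G (insert t P)) G" by (rule generate_is_subgroup)
  moreover have "P \<subseteq> generate G (insert t P)" by (blast intro: generate.incl)
  ultimately show ?case using step by blast
qed simp

lemma (in group) generate_subgroup_eq:
  assumes "subgroup P G"
  shows "generate G P = P"
  using generate_subgroup_incl[OF order_refl assms] by (auto intro: generate.incl)

locale cyclic_extension = group +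
  fixes P t
  assumes P: "subgroup P G" and t: "t \<in> carrier G"
    and conj_t: "\<And>p. p \<in> P \<Longrightarrow> t \<otimes> p \<otimes> inv t \<in> P" "\<And>p. p \<in> P \<Longrightarrow> inv t \<otimes> p \<otimes> t \<in> P"
begin

lemma conj_pow:
  assumes "p \<in> P"
  shows "t [^] (k::int) \<otimes> p \<otimes> t [^] (-k) \<in> P"
proof -
  have "t [^] k \<in> generate G {t}" using generate_pow[OF t] by blast
  moreover note generate_subgroup_eq[OF P]
  ultimately show ?thesis
    using conj_generate_closed[of "{t}" P "t [^] k" p] t P conj_t subgroup.subset[OF P] assms
    by (auto simp: int_pow_neg generate.incl)
qed

text \<open>\<open>level k x\<close> means \<open>x \<in> t\<^sup>k P\<close>; the exponent \<open>k\<close> need not be unique.\<close>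

definition level :: "int \<Rightarrow> 'a \<Rightarrow> bool"
  where "level k x \<longleftrightarrow> x \<in> carrier G \<and> t [^] (-k) \<otimes> x \<in> P"

lemma level_0: "level 0 x \<longleftrightarrow> x \<in> P"
  using subgroup.mem_carrier[OF P] by (auto simp: level_def)

lemma pow_minus_cancel [simp]:
  assumes "x \<in> carrier G"
  shows "t [^] (k::int) \<otimes> (t [^] (-k) \<otimes> x) = x" "t [^] (-k) \<otimes> (t [^] (k::int) \<otimes> x) = x"
  using assms t by (simp_all add: int_pow_neg)

lemma level_mult:
  assumes "level k x" "level l y"
  shows "level (k + l) (x \<otimes> y)"
proof -
  have c: "x \<in> carrier G" "y \<in> carrier G" using assms by (auto simp: level_def)
  have "t [^] (-l) \<otimes> (t [^] (-k) \<otimes> x) \<otimes> t [^] l \<in> P"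
    using conj_pow[of "t [^] (-k) \<otimes> x" "-l"] assms by (simp add: level_def)
  then have "(t [^] (-l) \<otimes> (t [^] (-k) \<otimes> x) \<otimes> t [^] l) \<otimes> (t [^] (-l) \<otimes> y) \<in> P"
    using assms subgroup.m_closed[OF P] by (simp add: level_def)
  moreover have "t [^] (-l) \<otimes> (t [^] (-k) \<otimes> x) = t [^] (-(k + l)) \<otimes> x"
    using c t by (simp add: m_assoc[symmetric] int_pow_mult[symmetric] add.commute)
  ultimately show ?thesis using c t by (simp add: level_def m_assoc)
qed

lemma level_inv:
  assumes "level k x"
  shows "level (-k) (inv x)"
proof -
  have c: "x \<in> carrier G" using assms by (auto simp: level_def)
  have "t [^] k \<otimes> inv (t [^] (-k) \<otimes> x) \<otimes> t [^] (-k) \<in> P"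
    using conj_pow[of "inv (t [^] (-k) \<otimes> x)" k] assms subgroup.m_inv_closed[OF P] by (simp add: level_def)
  moreover have "t [^] k \<otimes> inv (t [^] (-k) \<otimes> x) \<otimes> t [^] (-k) = t [^] k \<otimes> inv x"
    using c t by (simp add: word_simps int_pow_neg)
  ultimately show ?thesis using c by (simp add: level_def)
qed

lemma level_one: "level 0 \<one>"
  using subgroup.one_closed[OF P] by (simp add: level_0)

lemma level_int_pow:
  assumes "level k x"
  shows "level (k * n) (x [^] (n::int))"
proof -
  have c: "x \<in> carrier G" using assms by (auto simp: level_def)
  have 1: "level (k * int m) (x [^] m)" for m :: nat
  proof (induction m)
    case (Suc m)
    then show ?case using level_mult[OF Suc assms] by (simp add: algebra_simps)
  qed (simp add: level_one)
  show ?thesis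
  proof (cases "n \<ge> 0")
    case True
    then show ?thesis using 1[of "nat n"] c by (simp add: pow_nat)
  next
    case False
    then obtain m :: nat where m: "n = - int m" by (cases n rule: int_cases2) auto
    show ?thesis using level_inv[OF 1[of m]] int_pow_neg_int[OF c, of m] by (simp add: m)
  qed
qed

lemma level_pow: "level k (t [^] k)"
  using t subgroup.one_closed[OF P] by (simp add: level_def int_pow_neg)

lemma level_iff: "level k x \<longleftrightarrow> (\<exists>p\<in>P. x = t [^] k \<otimes> p)"
proof
  assume "level k x"
  then show "\<exists>p\<in>P. x = t [^] k \<otimes> p" unfolding level_def by (intro bexI[of _ "t [^] (-k) \<otimes> x"]) simp_all
next
  assume "\<exists>p\<in>P. x = t [^] k \<otimes> p"
  then show "level k x" using subgroup.mem_carrier[OF P] t by (auto simp: level_def)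
qed

lemma generate_level: "generate G (insert t P) = {x. \<exists>k. level k x}"
proof
  have "subgroup {x. \<exists>k. level k x} G"
  proof (rule subgroupI)
    show "{x. \<exists>k. level k x} \<noteq> {}" using level_one by blast
    show "{x. \<exists>k. level k x} \<subseteq> carrier G" by (auto simp: level_def)
    show "inv a \<in> {x. \<exists>k. level k x}" if "a \<in> {x. \<exists>k. level k x}" for a
      using that level_inv by blast
    show "a \<otimes> b \<in> {x. \<exists>k. level k x}" if "a \<in> {x. \<exists>k. level k x}" "b \<in> {x. \<exists>k. level k x}" for a b
      using that level_mult by blast
  qed
  moreover have "level 1 t" using level_pow[of 1] t by simp
  ultimately show "generate G (insert t P) \<subseteq> {x. \<exists>k. level k x}"
    using level_0 by (intro generate_subgroup_incl) blast+
next
  have s: "subgroup (generate G (insert t P)) G"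
    using generate_is_subgroup[of "insert t P"] t subgroup.subset[OF P] by simp
  have "t [^] (k::int) \<in> generate G (insert t P)" for k
    using subgroup_int_pow_closed[OF s] generate.incl[of t "insert t P"] by blast
  then show "{x. \<exists>k. level k x} \<subseteq> generate G (insert t P)"
    unfolding level_iff by (auto intro!: generate.eng intro: generate.incl)
qed

lemma subgroup_generate: "subgroup (generate G (insert t P)) G"
  using generate_is_subgroup[of "insert t P"] t subgroup.subset[OF P] by simp

end

section \<open>The maximal condition, and chains obtained from commutators\<close>

lemma (in group) cyclic_extensionI:
  assumes "subgroup P G" "t \<in> carrier G" "\<And>p. p \<in> P \<Longrightarrow> t \<otimes> p \<otimes> inv t \<in> P"
    "\<And>p. p \<in> P \<Longrightarrow> inv t \<otimes> p \<otimes> t \<in> P"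
  shows "cyclic_extension G P t"
  using assms group_axioms by (simp add: cyclic_extension_def cyclic_extension_axioms_def)

text \<open>The maximal condition of polycyclic groups relative to \<open>N\<close>. At each cyclic
  step, generators of \<open>J \<inter> P\<close> and one element of \<open>J\<close> with least
  positive exponent generate \<open>J\<close>, by division with remainder.\<close>

lemma (in group) pc_chain_max:
  assumes "pc_chain G N P" "subgroup J G" "N \<subseteq> J" "J \<subseteq> P"
  shows "\<exists>E. finite E \<and> E \<subseteq> J \<and> generate G (N \<union> E) = J"
  using assms
proof (induction arbitrary: J rule: pc_chain.induct)
  case base
  then have "J = N" by blast
  then have "generate G (N \<union> {}) = J" using generate_subgroup_eq[OF base.hyps] by simp
  then show ?case by blast
next
  case (step P t)
  note PP = pc_chain_subgroup[OF step.hyps(1)]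
  interpret cyclic_extension G P t by (rule cyclic_extensionI) (use step PP in auto)
  have "subgroup (J \<inter> P) G" by (rule subgroups_Inter_pair[OF step.prems(1) P])
  then obtain E where E: "finite E" "E \<subseteq> J \<inter> P" "generate G (N \<union> E) = J \<inter> P"
    using step.IH[of "J \<inter> P"] step.prems PP by auto
  show ?case
  proof (cases "\<exists>k>0. \<exists>x\<in>J. level k x")
    case False
    have "J \<subseteq> P"
    proof
      fix x assume x: "x \<in> J"
      then obtain k where k: "level k x" using step.prems(3) generate_level by blast
      moreover have "inv x \<in> J" using subgroup.m_inv_closed[OF step.prems(1) x] .
      ultimately have "k = 0" using False x level_inv[OF k] by (metis linorder_neqE neg_0_less_iff_less)
      then show "x \<in> P" using k level_0 by simp
    qed
    then show ?thesis using E by (intro exI[of _ E]) auto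
  next
    case True
    \<comment> \<open>Exponents may be ambiguous, so \<open>d\<close> is minimal over all exponents
      of all elements of \<open>J\<close>. A remainder modulo \<open>d\<close> is again an exponent
      of an element of \<open>J\<close> and therefore vanishes.\<close>
    define d where "d = (LEAST d::nat. d > 0 \<and> (\<exists>x\<in>J. level (int d) x))"
    have ex: "\<exists>d::nat. d > 0 \<and> (\<exists>x\<in>J. level (int d) x)"
      using True by (metis pos_int_cases of_nat_0_less_iff)
    have "d > 0 \<and> (\<exists>x\<in>J. level (int d) x)" unfolding d_def by (rule LeastI_ex[OF ex])
    then obtain j where j: "d > 0" "j \<in> J" "level (int d) j" by blast
    have min: "False" if "0 < k" "k < int d" "x \<in> J" "level k x" for k x
    proof -
      have "\<not> (nat k > 0 \<and> (\<exists>x\<in>J. level (int (nat k)) x))"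
        by (rule not_less_Least) (use that in \<open>simp add: d_def[symmetric]\<close>)
      then show False using that by auto
    qed
    have "x \<in> generate G (N \<union> insert j E)" if x: "x \<in> J" for x
    proof -
      obtain k where k: "level k x" using step.prems(3) x generate_level by blast
      define y where "y = inv (j [^] (k div int d)) \<otimes> x"
      have c: "j \<in> carrier G" "x \<in> carrier G" using j x subgroup.mem_carrier[OF step.prems(1)] by auto
      have jp: "j [^] (k div int d) \<in> J" using subgroup_int_pow_closed[OF step.prems(1) j(2)] .
      have yJ: "y \<in> J" unfolding y_def
        using x jp step.prems(1) by (simp add: subgroup.m_closed subgroup.m_inv_closed)
      have "level (- (int d * (k div int d)) + k) y"
        unfolding y_def by (intro level_mult level_inv level_int_pow j k)
      moreover have "- (int d * (k div int d)) + k = k mod int d"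
        using div_mult_mod_eq[of k "int d"] by (simp add: algebra_simps)
      ultimately have "level (k mod int d) y" by simp
      then have "k mod int d = 0" using min[of "k mod int d" y] yJ j(1)
        by (metis of_nat_0_less_iff pos_mod_bound pos_mod_sign order_le_less)
      then have "y \<in> P" using \<open>level (k mod int d) y\<close> level_0 by simp
      then have "y \<in> generate G (N \<union> E)" using yJ E by blast
      then have y: "y \<in> generate G (N \<union> insert j E)" using mono_generate[of "N \<union> E" "N \<union> insert j E"] by blast
      have sub: "subgroup (generate G (N \<union> insert j E)) G"
        using generate_is_subgroup[of "N \<union> insert j E"] c E step.prems(2) subgroup.subset[OF step.prems(1)] by blast
      have "j [^] (k div int d) \<in> generate G (N \<union> insert j E)"
        by (rule subgroup_int_pow_closed[OF sub]) (blast intro: generate.incl)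
      moreover have "x = j [^] (k div int d) \<otimes> y" using c by (simp add: y_def)
      ultimately show ?thesis using y by (simp add: generate.eng)
    qed
    moreover have "generate G (N \<union> insert j E) \<subseteq> J"
      by (rule generate_subgroup_incl) (use step.prems E j in auto)
    ultimately show ?thesis using E j by (intro exI[of _ "insert j E"]) auto
  qed
qed

text \<open>An element that is central in \<open>C\<close> modulo \<open>K\<close> normalises every
  subgroup between \<open>K\<close> and \<open>C\<close>, so the elements of \<open>E\<close> can be
  adjoined one at a time.\<close>

lemma (in group) pc_chain_central:
  assumes K: "subgroup K G" and C: "subgroup C G" "K \<subseteq> C" and E: "finite E" "E \<subseteq> C"
    and comm: "\<And>e x. e \<in> E \<Longrightarrow> x \<in> C \<Longrightarrow> e \<otimes> x \<otimes> inv e \<otimes> inv x \<in> K"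
  shows "pc_chain G K (generate G (K \<union> E))"
  using E comm
proof (induction rule: finite_induct)
  case empty
  show ?case using pc_chain.base[OF K] generate_subgroup_eq[OF K] by simp
next
  case (insert e E)
  let ?A = "generate G (K \<union> E)"
  have pc: "pc_chain G K ?A" by (rule insert.IH) (use insert.prems in auto)
  have c: "e \<in> carrier G" "E \<subseteq> carrier G" "C \<subseteq> carrier G" "K \<subseteq> carrier G"
    using insert.prems subgroup.subset[OF C(1)] subgroup.subset[OF K] by auto
  have A: "subgroup ?A G" "K \<subseteq> ?A" "?A \<subseteq> C"
    using pc_chain_subgroup[OF pc] generate_subgroup_incl[OF _ C(1), of "K \<union> E"] C(2) insert.prems by auto
  have conj: "e \<otimes> x \<otimes> inv e \<in> ?A" "inv e \<otimes> x \<otimes> e \<in> ?A" if x: "x \<in> ?A" for x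
  proof -
    have xc: "x \<in> C" "x \<in> carrier G" using x A c by auto
    have "e \<otimes> x \<otimes> inv e \<otimes> inv x \<in> ?A" using insert.prems xc A by blast
    then have "e \<otimes> x \<otimes> inv e \<otimes> inv x \<otimes> x \<in> ?A" using x subgroup.m_closed[OF A(1)] by blast
    then show "e \<otimes> x \<otimes> inv e \<in> ?A" using xc c by (simp add: m_assoc)
    let ?y = "inv e \<otimes> x \<otimes> e"
    have y: "?y \<in> C" using insert.prems(1) xc C(1) by (simp add: subgroup.m_closed subgroup.m_inv_closed)
    have "e \<otimes> ?y \<otimes> inv e \<otimes> inv ?y \<in> K" using insert.prems y by blast
    moreover have "e \<otimes> ?y \<otimes> inv e \<otimes> inv ?y = x \<otimes> inv ?y" using xc c by (simp add: word_simps)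
    ultimately have "x \<otimes> inv ?y \<in> ?A" using A by auto
    then have "inv (x \<otimes> inv ?y) \<otimes> x \<in> ?A" using x A(1) by (simp add: subgroup.m_closed subgroup.m_inv_closed)
    then show "?y \<in> ?A" using xc c by (simp add: word_simps)
  qed
  have "pc_chain G K (generate G (insert e ?A))"
    by (rule pc_chain.step[OF pc c(1)]) (use conj in auto)
  moreover have "generate G (insert e ?A) = generate G (K \<union> insert e E)"
  proof
    have s: "subgroup (generate G (K \<union> insert e E)) G" using generate_is_subgroup c by simp
    have "?A \<subseteq> generate G (K \<union> insert e E)" by (rule mono_generate) auto
    then show "generate G (insert e ?A) \<subseteq> generate G (K \<union> insert e E)"
      using generate_subgroup_incl[OF _ s, of "insert e ?A"] generate.incl[of e "K \<union> insert e E"] by blast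
    show "generate G (K \<union> insert e E) \<subseteq> generate G (insert e ?A)"
      by (rule generate_subgroup_incl)
        (use generate_is_subgroup[of "insert e ?A"] c A subgroup.subset[OF A(1)] in \<open>auto intro: generate.incl\<close>)
  qed
  ultimately show ?case by simp
qed

text \<open>The identity [e, ab] = [e, a] a [e, b] inv(a) keeps the error term in \<open>L\<close>.
  Only elements of \<open>M\<close> conjugate \<open>L\<close> here, so \<open>e\<close> may be an
  arbitrary element of the group.\<close>

lemma (in group) subgroup_centralizer_mod:
  assumes L: "subgroup L G" and M: "subgroup M G"
    and n: "\<And>m x. m \<in> M \<Longrightarrow> x \<in> L \<Longrightarrow> m \<otimes> x \<otimes> inv m \<in> L" and e: "e \<in> carrier G"
  shows "subgroup {m \<in> M. e \<otimes> m \<otimes> inv e \<otimes> inv m \<in> L} G"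
proof (rule subgroupI)
  note Mc = subgroup.mem_carrier[OF M]
  show "{m \<in> M. e \<otimes> m \<otimes> inv e \<otimes> inv m \<in> L} \<subseteq> carrier G" using Mc by blast
  show "{m \<in> M. e \<otimes> m \<otimes> inv e \<otimes> inv m \<in> L} \<noteq> {}"
    using subgroup.one_closed[OF M] subgroup.one_closed[OF L] e by (auto intro!: exI[of _ \<one>])
  fix a assume a: "a \<in> {m \<in> M. e \<otimes> m \<otimes> inv e \<otimes> inv m \<in> L}"
  have ai: "inv a \<in> M" using a subgroup.m_inv_closed[OF M] by blast
  have "inv a \<otimes> inv (e \<otimes> a \<otimes> inv e \<otimes> inv a) \<otimes> inv (inv a) \<in> L"
    using n[OF ai] a subgroup.m_inv_closed[OF L] by blast
  moreover have "inv a \<otimes> inv (e \<otimes> a \<otimes> inv e \<otimes> inv a) \<otimes> inv (inv a) = e \<otimes> inv a \<otimes> inv e \<otimes> inv (inv a)"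
    using a Mc e by (simp add: word_simps)
  ultimately show "inv a \<in> {m \<in> M. e \<otimes> m \<otimes> inv e \<otimes> inv m \<in> L}" using ai by simp
  fix b assume b: "b \<in> {m \<in> M. e \<otimes> m \<otimes> inv e \<otimes> inv m \<in> L}"
  have "(e \<otimes> a \<otimes> inv e \<otimes> inv a) \<otimes> (a \<otimes> (e \<otimes> b \<otimes> inv e \<otimes> inv b) \<otimes> inv a) \<in> L"
    using a b n subgroup.m_closed[OF L] by blast
  moreover have "(e \<otimes> a \<otimes> inv e \<otimes> inv a) \<otimes> (a \<otimes> (e \<otimes> b \<otimes> inv e \<otimes> inv b) \<otimes> inv a)
      = e \<otimes> (a \<otimes> b) \<otimes> inv e \<otimes> inv (a \<otimes> b)"
    using a b Mc e by (simp add: word_simps)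
  ultimately show "a \<otimes> b \<in> {m \<in> M. e \<otimes> m \<otimes> inv e \<otimes> inv m \<in> L}"
    using a b subgroup.m_closed[OF M] by simp
qed

text \<open>One step of the lower central series: commutators with the generators suffice.\<close>

lemma (in group) pc_chain_commutators:
  assumes Y: "finite Y" "Y \<subseteq> carrier G" and M: "M = generate G Y"
    and E: "finite E" "E \<subseteq> M"
    and E': "E' = (\<lambda>(e, y). e \<otimes> y \<otimes> inv e \<otimes> inv y) ` (E \<times> Y)"
  shows "pc_chain G (conj_span G M {} E') (conj_span G M {} E)"
proof -
  have sM: "subgroup M G" using generate_is_subgroup Y M by blast
  have YM: "Y \<subseteq> M" unfolding M by (blast intro: generate.incl)
  have E'M: "E' \<subseteq> M"
    using E YM sM unfolding E' by (auto simp: subset_iff intro!: subgroup.m_closed subgroup.m_inv_closed)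
  have c: "M \<subseteq> carrier G" "E \<subseteq> carrier G" "E' \<subseteq> carrier G" using subgroup.subset[OF sM] E E'M by auto
  let ?L = "conj_span G M {} E'"
  have L: "subgroup ?L G" using conj_span_subgroup c by simp
  have LM: "conj_span G M {} A \<subseteq> M" if "A \<subseteq> M" for A
    by (rule conj_span_least[OF sM]) (use that sM in \<open>auto simp: subset_iff intro!: subgroup.m_closed subgroup.m_inv_closed\<close>)
  have Ln: "m \<otimes> x \<otimes> inv m \<in> ?L" if "m \<in> M" "x \<in> ?L" for m x
    using conj_span_conj[OF sM _ c(3) _ that] by simp
  have comm: "e \<otimes> m \<otimes> inv e \<otimes> inv m \<in> ?L" if e: "e \<in> E" and m: "m \<in> M" for e m
  proof -
    have "Y \<subseteq> {m \<in> M. e \<otimes> m \<otimes> inv e \<otimes> inv m \<in> ?L}"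
      using YM e conj_span_incl(2)[OF sM c(3), of "{}"] unfolding E' by blast
    then have "generate G Y \<subseteq> {m \<in> M. e \<otimes> m \<otimes> inv e \<otimes> inv m \<in> ?L}"
      using e c by (intro generate_subgroup_incl subgroup_centralizer_mod L sM Ln) auto
    then show ?thesis using m M by blast
  qed
  have pc: "pc_chain G ?L (generate G (?L \<union> E))"
    by (rule pc_chain_central[OF L sM LM[OF E'M] E comm])
  have "generate G (?L \<union> E) = conj_span G M {} E"
  proof
    have s: "subgroup (conj_span G M {} E) G" using conj_span_subgroup c by simp
    have n: "m \<otimes> x \<otimes> inv m \<in> conj_span G M {} E" if "m \<in> M" "x \<in> conj_span G M {} E" for m x
      using conj_span_conj[OF sM _ c(2) _ that] by simp
    have EE: "E \<subseteq> conj_span G M {} E" using conj_span_incl(2)[OF sM c(2)] .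
    have "e \<otimes> y \<otimes> inv e \<otimes> inv y \<in> conj_span G M {} E" if e: "e \<in> E" and y: "y \<in> Y" for e y
    proof -
      have "y \<otimes> inv e \<otimes> inv y \<in> conj_span G M {} E"
        using n y e YM EE subgroup.m_inv_closed[OF s] by blast
      then have "e \<otimes> (y \<otimes> inv e \<otimes> inv y) \<in> conj_span G M {} E" using e EE subgroup.m_closed[OF s] by blast
      then show ?thesis using e y c Y by (simp add: m_assoc subset_iff)
    qed
    then have "E' \<subseteq> conj_span G M {} E" unfolding E' by auto
    then have "?L \<subseteq> conj_span G M {} E" by (intro conj_span_least[OF s] n) auto
    then show "generate G (?L \<union> E) \<subseteq> conj_span G M {} E"
      by (intro generate_subgroup_incl[OF _ s]) (use EE in auto)
  next
    have s: "subgroup (generate G (?L \<union> E)) G" using pc_chain_subgroup[OF pc] by blast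
    have "m \<otimes> e \<otimes> inv m \<in> generate G (?L \<union> E)" if m: "m \<in> M" and e: "e \<in> E" for m e
    proof -
      \<comment> \<open>The inverse commutator times \<open>e\<close> is the conjugate of
        \<open>e\<close> by \<open>m\<close>, so the commutators and \<open>E\<close> together
        already contain all conjugates.\<close>
      have "inv (e \<otimes> m \<otimes> inv e \<otimes> inv m) \<in> generate G (?L \<union> E)"
        using comm[OF e m] by (blast intro: generate.inv)
      then have "inv (e \<otimes> m \<otimes> inv e \<otimes> inv m) \<otimes> e \<in> generate G (?L \<union> E)"
        using e by (blast intro: generate.eng generate.incl)
      then show ?thesis using e m c by (simp add: word_simps subset_iff)
    qed
    then show "conj_span G M {} E \<subseteq> generate G (?L \<union> E)" by (intro conj_span_least[OF s]) auto
  qed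
  then show ?thesis using pc by simp
qed

section \<open>Chains under homomorphisms\<close>

lemma (in group_hom) pc_chain_image:
  assumes "pc_chain G N P"
  shows "pc_chain H (h ` N) (h ` P)"
  using assms
proof (induction rule: pc_chain.induct)
  case base
  then show ?case by (intro pc_chain.base subgroup_img_is_subgroup)
next
  case (step P t)
  have P: "P \<subseteq> carrier G" using G.pc_chain_subgroup[OF step.hyps(1)] subgroup.subset by blast
  have "h t \<otimes>\<^bsub>H\<^esub> h p \<otimes>\<^bsub>H\<^esub> inv\<^bsub>H\<^esub> (h t) = h (t \<otimes> p \<otimes> inv t)"
    "inv\<^bsub>H\<^esub> (h t) \<otimes>\<^bsub>H\<^esub> h p \<otimes>\<^bsub>H\<^esub> h t = h (inv t \<otimes> p \<otimes> t)" if "p \<in> P" for p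
    using that P step.hyps(2) by (auto simp: subset_iff)
  then have "pc_chain H (h ` N) (generate H (insert (h t) (h ` P)))"
    using step by (intro pc_chain.step) auto
  moreover have "h ` generate G (insert t P) = generate H (h ` insert t P)"
    using G.hom_image_generate[OF H.is_group homh] P step.hyps(2) by simp
  ultimately show ?case by simp
qed

text \<open>Each \<open>t\<close> of the chain has a lift in \<open>S\<close> because
  \<open>S\<close> covers the top group, and membership in \<open>t\<close> to the power
  \<open>k\<close> times \<open>P\<close> is tested after applying \<open>h\<close>. The kernel of
  \<open>h\<close> on \<open>S\<close> is absorbed in the bottom group.\<close>

lemma (in group_hom) pc_chain_preimage:
  assumes "pc_chain H N P" and S: "subgroup S G" and "P \<subseteq> h ` S"
  shows "pc_chain G {x \<in> S. h x \<in> N} {x \<in> S. h x \<in> P}"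
  using assms(1,3)
proof (induction rule: pc_chain.induct)
  case base
  have "{x \<in> S. h x \<in> N} = {x \<in> carrier G. h x \<in> N} \<inter> S" using subgroup.subset[OF S] by auto
  then show ?case using subgroup_preimage[OF base(1)] S by (auto intro!: pc_chain.base G.subgroups_Inter_pair)
next
  case (step P t)
  have PP: "subgroup P H" using H.pc_chain_subgroup[OF step.hyps(1)] by blast
  interpret H1: cyclic_extension H P t by (rule H.cyclic_extensionI) (use step PP in auto)
  have "t \<in> generate H (insert t P)" by (blast intro: generate.incl)
  then obtain s where s: "s \<in> S" "t = h s" using step.prems by blast
  have sc: "s \<in> carrier G" using s subgroup.subset[OF S] by blast
  let ?P = "{x \<in> S. h x \<in> P}"
  have "P \<subseteq> h ` S" using step.prems generate.incl[of _ "insert t P" H] by blast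
  then have IH: "pc_chain G {x \<in> S. h x \<in> N} ?P" by (rule step.IH)
  have Sc: "x \<in> carrier G" if "x \<in> S" for x using that subgroup.subset[OF S] by blast
  have cj: "s \<otimes> p \<otimes> inv s \<in> ?P" "inv s \<otimes> p \<otimes> s \<in> ?P" if p: "p \<in> ?P" for p
    using p s step.hyps(3,4)[of "h p"] Sc sc
    by (auto intro!: subgroup.m_closed[OF S] subgroup.m_inv_closed[OF S])
  have "subgroup ?P G" using G.pc_chain_subgroup[OF IH] by blast
  interpret G1: cyclic_extension G ?P s by (rule G.cyclic_extensionI) (use \<open>subgroup ?P G\<close> sc cj in auto)
  have "pc_chain G {x \<in> S. h x \<in> N} (generate G (insert s ?P))"
    by (rule pc_chain.step[OF IH sc]) (use cj in auto)
  moreover have "generate G (insert s ?P) = {x \<in> S. h x \<in> generate H (insert t P)}"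
  proof -
    have hp: "h (s [^] k) = t [^]\<^bsub>H\<^esub> k" for k :: int using hom_int_pow[OF sc] s by simp
    have sS: "s [^] k \<in> S" for k :: int using G.subgroup_int_pow_closed[OF S] s by blast
    have "G1.level k x \<longleftrightarrow> x \<in> S \<and> H1.level k (h x)" for k x
    proof
      assume "G1.level k x"
      then obtain p where "p \<in> ?P" "x = s [^] k \<otimes> p" using G1.level_iff by blast
      then show "x \<in> S \<and> H1.level k (h x)"
        using sS hp Sc sc by (auto simp: H1.level_iff intro!: subgroup.m_closed[OF S])
    next
      assume x: "x \<in> S \<and> H1.level k (h x)"
      then have "s [^] (-k) \<otimes> x \<in> S" using sS subgroup.m_closed[OF S] by blast
      moreover have "h (s [^] (-k) \<otimes> x) \<in> P" using x hp[of "-k"] Sc sc by (simp add: H1.level_def)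
      ultimately show "G1.level k x" using x Sc by (simp add: G1.level_def)
    qed
    then show ?thesis unfolding G1.generate_level H1.generate_level by auto
  qed
  ultimately show ?case by simp
qed

subsection \<open>Separability of subgroups\<close>

lemma (in group) fin_cover_power:
  assumes K: "subgroup K G" and P: "subgroup P G" and "fin_cover P K"
  shows "\<exists>e::nat. e > 0 \<and> (\<forall>x\<in>P. x [^] e \<in> K)"
proof -
  obtain T where T: "finite T" "T \<subseteq> P" "\<forall>p\<in>P. \<exists>t\<in>T. p \<otimes> inv t \<in> K" using assms by (auto simp: fin_cover_def)
  \<comment> \<open>Among the powers of \<open>x\<close> with exponents 0 to \<open>card T\<close>,
    two share a representative. Their exponent difference is at most \<open>card T\<close> and
    divides the factorial, which gives an exponent independent of \<open>x\<close> without normality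
    of \<open>K\<close>.\<close>
  have "x [^] (fact (card T) :: nat) \<in> K" if x: "x \<in> P" for x
  proof -
    have xc: "x \<in> carrier G" using subgroup.mem_carrier[OF P x] .
    have Kpow: "y [^] (n::nat) \<in> K" if "y \<in> K" for y n
      using subgroup_int_pow_closed[OF K that, of "int n"] by (simp add: int_pow_int)
    have "x [^] (i::nat) \<in> P" for i
      using subgroup_int_pow_closed[OF P x, of "int i"] by (simp add: int_pow_int)
    then have "\<forall>i::nat. \<exists>t\<in>T. x [^] i \<otimes> inv t \<in> K" using T by blast
    then obtain r where r: "\<And>i::nat. r i \<in> T \<and> x [^] i \<otimes> inv (r i) \<in> K" by metis
    have "\<not> inj_on r {0..card T}"
    proof
      assume "inj_on r {0..card T}"
      then have "card {0..card T} \<le> card T" using T(1) r by (intro card_inj_on_le[of r]) auto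
      then show False by simp
    qed
    then obtain i j where ij: "i < j" "j \<le> card T" "r i = r j"
      unfolding inj_on_def by (metis atLeastAtMost_iff linorder_neqE_nat)
    have rc: "r j \<in> carrier G" using r[of j] T(2) subgroup.subset[OF P] by blast
    have "(x [^] j \<otimes> inv (r j)) \<otimes> inv (x [^] i \<otimes> inv (r i)) \<in> K"
      using r subgroup.m_closed[OF K] subgroup.m_inv_closed[OF K] by blast
    moreover have "(x [^] j \<otimes> inv (r j)) \<otimes> inv (x [^] i \<otimes> inv (r i)) = x [^] j \<otimes> inv (x [^] i)"
      using ij(3) xc rc by (simp add: word_simps)
    moreover have "x [^] j = x [^] (j - i) \<otimes> x [^] i" using ij(1) xc by (simp add: nat_pow_mult)
    ultimately have "x [^] (j - i) \<in> K" using xc by (simp add: m_assoc)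
    moreover have "j - i dvd fact (card T)" using ij by (intro dvd_fact) auto
    ultimately show ?thesis using Kpow xc by (auto simp: dvd_def nat_pow_pow[symmetric])
  qed
  then show ?thesis by (intro exI[of _ "fact (card T)"]) simp
qed

lemma set_multI: "j \<in> J \<Longrightarrow> c \<in> C \<Longrightarrow> j \<otimes>\<^bsub>G\<^esub> c \<in> J <#>\<^bsub>G\<^esub> C"
  by (auto simp: set_mult_def)

lemma (in group) subgroup_product:
  assumes J: "subgroup J G" and C: "subgroup C G"
    and n: "\<And>j c. j \<in> J \<Longrightarrow> c \<in> C \<Longrightarrow> j \<otimes> c \<otimes> inv j \<in> C"
  shows "subgroup (J <#> C) G" "J \<subseteq> J <#> C" "C \<subseteq> J <#> C"
proof -
  note cJ = subgroup.mem_carrier[OF J] and cC = subgroup.mem_carrier[OF C]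
  have n': "inv j \<otimes> c \<otimes> j \<in> C" if "j \<in> J" "c \<in> C" for j c
    using n[of "inv j" c] subgroup.m_inv_closed[OF J that(1)] that cJ by simp
  show "J \<subseteq> J <#> C"
  proof
    fix j assume j: "j \<in> J"
    then have "j = j \<otimes> \<one>" using cJ by simp
    then show "j \<in> J <#> C" unfolding set_mult_def using j subgroup.one_closed[OF C] by blast
  qed
  show "C \<subseteq> J <#> C"
  proof
    fix c assume c: "c \<in> C"
    then have "c = \<one> \<otimes> c" using cC by simp
    then show "c \<in> J <#> C" unfolding set_mult_def using c subgroup.one_closed[OF J] by blast
  qed
  show "subgroup (J <#> C) G"
  proof (rule subgroupI)
    show "J <#> C \<subseteq> carrier G" using cJ cC by (auto simp: set_mult_def)
    show "J <#> C \<noteq> {}" using \<open>J \<subseteq> J <#> C\<close> subgroup.one_closed[OF J] by blast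
    fix a assume "a \<in> J <#> C"
    then obtain j c where a: "j \<in> J" "c \<in> C" "a = j \<otimes> c" by (auto simp: set_mult_def)
    have "inv a = inv j \<otimes> (j \<otimes> inv c \<otimes> inv j)" using a cJ cC by (simp add: word_simps)
    then show "inv a \<in> J <#> C"
      using set_multI[OF subgroup.m_inv_closed[OF J a(1)] n[OF a(1) subgroup.m_inv_closed[OF C a(2)]]] by simp
    fix b assume "b \<in> J <#> C"
    then obtain i d where b: "i \<in> J" "d \<in> C" "b = i \<otimes> d" by (auto simp: set_mult_def)
    have "a \<otimes> b = (j \<otimes> i) \<otimes> ((inv i \<otimes> c \<otimes> i) \<otimes> d)" using a b cJ cC by (simp add: word_simps)
    then show "a \<otimes> b \<in> J <#> C"
      using set_multI[OF subgroup.m_closed[OF J a(1) b(1)] subgroup.m_closed[OF C n'[OF b(1) a(2)] b(2)]] by simp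
  qed
qed

lemma (in cyclic_extension) level_conj:
  assumes "level k x" "p \<in> P"
  shows "x \<otimes> p \<otimes> inv x \<in> P"
  using level_mult[OF level_mult[OF assms(1) iffD2[OF level_0 assms(2)]] level_inv[OF assms(1)]] level_0
  by simp

text \<open>Dividing an exponent by \<open>m\<close>, a power of \<open>z\<close> absorbs the
  quotient. What remains is an exponent below \<open>m\<close> and a coset of \<open>B\<close> in
  \<open>P\<close>, so the products \<open>s \<otimes> t [^] a\<close> are representatives.\<close>

lemma (in cyclic_extension) fin_cover_extension:
  assumes "fin_cover P B" "B \<subseteq> K" and K: "subgroup K G" and z: "z \<in> K" "level m z" and "m > 0"
  shows "fin_cover (generate G (insert t P)) K"
proof -
  obtain S where S: "finite S" "S \<subseteq> P" "\<forall>p\<in>P. \<exists>s\<in>S. p \<otimes> inv s \<in> B" using assms by (auto simp: fin_cover_def)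
  let ?T = "(\<lambda>(s, a). s \<otimes> t [^] (a::int)) ` (S \<times> {0..<m})"
  have zc: "z \<in> carrier G" using z(2) by (simp add: level_def)
  have "?T \<subseteq> generate G (insert t P)"
    using S(2) subgroup.m_closed[OF subgroup_generate] level_mult[OF iffD2[OF level_0] level_pow]
    unfolding generate_level by fastforce
  moreover have "\<exists>u\<in>?T. x \<otimes> inv u \<in> K" if x: "x \<in> generate G (insert t P)" for x
  proof -
    obtain k where k: "level k x" using x generate_level by blast
    have xc: "x \<in> carrier G" using k by (simp add: level_def)
    let ?q = "k div m" and ?a = "k mod m"
    let ?y = "inv (z [^] ?q) \<otimes> x"
    have "level (- (m * ?q) + k) ?y" by (intro level_mult level_inv level_int_pow k z(2))
    moreover have "- (m * ?q) + k = ?a" using div_mult_mod_eq[of k m] by (simp add: algebra_simps)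
    ultimately have y: "level ?a ?y" by simp
    have "level (?a + - ?a) (?y \<otimes> t [^] (- ?a))" by (intro level_mult y level_pow)
    then have p: "?y \<otimes> t [^] (- ?a) \<in> P" using level_0 by simp
    then obtain s where s: "s \<in> S" "?y \<otimes> t [^] (- ?a) \<otimes> inv s \<in> B" using S by blast
    have sc: "s \<in> carrier G" using s(1) S(2) subgroup.subset[OF P] by blast
    have zq: "z [^] ?q \<in> K" by (rule subgroup_int_pow_closed[OF K z(1)])
    have "x \<otimes> inv (s \<otimes> t [^] ?a) = z [^] ?q \<otimes> (?y \<otimes> t [^] (- ?a) \<otimes> inv s)"
      using xc sc zc t by (simp add: word_simps int_pow_neg)
    also have "\<dots> \<in> K" using zq s(2) assms(2) subgroup.m_closed[OF K] by blast
    finally show ?thesis using s(1) \<open>m > 0\<close> by (intro bexI[of _ "s \<otimes> t [^] ?a"]) auto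
  qed
  ultimately show ?thesis unfolding fin_cover_def using S(1) by (intro exI[of _ ?T]) simp
qed

text \<open>A relative form of the fact that a polycyclic torsion group is finite: at each cyclic
  step, the power \<open>t [^] e\<close> is an element of \<open>C\<close> with positive
  exponent.\<close>

lemma (in group) pc_chain_power_cover:
  assumes "pc_chain G N Q" and C: "subgroup C G" "N \<subseteq> C" and "(e::nat) > 0"
    and "\<And>x. x \<in> Q \<Longrightarrow> x [^] e \<in> C"
  shows "fin_cover Q C"
  using assms(1,5)
proof (induction rule: pc_chain.induct)
  case base
  then show ?case using C fin_cover_mono[OF fin_cover_refl] by blast
next
  case (step P t)
  have PP: "subgroup P G" using pc_chain_subgroup[OF step.hyps(1)] by blast
  interpret cyclic_extension G P t by (rule cyclic_extensionI) (use step PP in auto)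
  have "fin_cover P C" by (rule step.IH) (use step.prems in \<open>auto intro: generate.incl\<close>)
  moreover have "t [^] e \<in> C" using step.prems[of t] by (auto intro: generate.incl)
  ultimately show ?case
    using fin_cover_extension[of C C "t [^] int e" "int e"] C(1) level_pow[of "int e"] \<open>e > 0\<close>
    by (simp add: int_pow_int)
qed

lemma (in group) conj_nat_pow:
  assumes "g \<in> carrier G" "x \<in> carrier G"
  shows "g \<otimes> x [^] (e::nat) \<otimes> inv g = (g \<otimes> x \<otimes> inv g) [^] e"
proof (induction e)
  case (Suc e)
  have "g \<otimes> x [^] Suc e \<otimes> inv g = (g \<otimes> x [^] e \<otimes> inv g) \<otimes> (g \<otimes> x \<otimes> inv g)"
    using assms by (simp add: word_simps)
  then show ?case unfolding Suc by simp
qed (use assms in simp)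

text \<open>Replacing a subgroup of finite index by the subgroup generated by sufficiently high powers
  makes it invariant under automorphisms.\<close>

lemma (in group) fin_cover_invariant:
  assumes pc: "pc_chain G N P" and K: "subgroup K G" "N \<subseteq> K" "fin_cover P K"
  shows "\<exists>C. subgroup C G \<and> N \<subseteq> C \<and> C \<subseteq> K \<and> C \<subseteq> P \<and> fin_cover P C \<and>
    (\<forall>g\<in>carrier G. (\<forall>x\<in>N. g \<otimes> x \<otimes> inv g \<in> N) \<longrightarrow> (\<forall>x\<in>P. g \<otimes> x \<otimes> inv g \<in> P) \<longrightarrow>
       (\<forall>c\<in>C. g \<otimes> c \<otimes> inv g \<in> C))"
proof -
  have P: "subgroup P G" and NP: "N \<subseteq> P" using pc_chain_subgroup[OF pc] by auto
  obtain e :: nat where e: "e > 0" "\<forall>x\<in>P. x [^] e \<in> K" using fin_cover_power[OF K(1) P K(3)] by blast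
  let ?E = "N \<union> (\<lambda>x. x [^] e) ` P"
  have Pe: "x [^] e \<in> P" if "x \<in> P" for x
    using subgroup_int_pow_closed[OF P that, of "int e"] by (simp add: int_pow_int)
  have EP: "?E \<subseteq> P" using Pe NP by auto
  have Ec: "?E \<subseteq> carrier G" using EP subgroup.subset[OF P] by blast
  define C where "C = generate G ?E"
  have C: "subgroup C G" unfolding C_def by (rule generate_is_subgroup[OF Ec])
  have E: "?E \<subseteq> C" unfolding C_def by (blast intro: generate.incl)
  have "C \<subseteq> K" unfolding C_def by (rule generate_subgroup_incl[OF _ K(1)]) (use e K in auto)
  moreover have "C \<subseteq> P" unfolding C_def by (rule generate_subgroup_incl[OF EP P])
  moreover have "fin_cover P C" by (rule pc_chain_power_cover[OF pc C _ e(1)]) (use E in auto)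
  moreover have "g \<otimes> c \<otimes> inv g \<in> C"
    if g: "g \<in> carrier G" "\<forall>x\<in>N. g \<otimes> x \<otimes> inv g \<in> N" "\<forall>x\<in>P. g \<otimes> x \<otimes> inv g \<in> P" and c: "c \<in> C" for g c
  proof -
    have "?E \<subseteq> {x \<in> carrier G. g \<otimes> x \<otimes> inv g \<in> C}"
    proof
      fix y assume y: "y \<in> ?E"
      have "g \<otimes> y \<otimes> inv g \<in> C"
      proof (cases "y \<in> N")
        case True then show ?thesis using g E by blast
      next
        case False
        then obtain x where x: "x \<in> P" "y = x [^] e" using y by blast
        then have "g \<otimes> y \<otimes> inv g = (g \<otimes> x \<otimes> inv g) [^] e"
          using conj_nat_pow[OF g(1) subgroup.mem_carrier[OF P x(1)]] by simp
        then show ?thesis using g(3) x(1) E by auto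
      qed
      then show "y \<in> {x \<in> carrier G. g \<otimes> x \<otimes> inv g \<in> C}" using y Ec by blast
    qed
    then have "C \<subseteq> {x \<in> carrier G. g \<otimes> x \<otimes> inv g \<in> C}"
      unfolding C_def by (intro generate_subgroup_incl subgroup_conj_set g(1)) (use C C_def in auto)
    then show ?thesis using c by blast
  qed
  moreover have "N \<subseteq> C" using E by blast
  ultimately show ?thesis using C by blast
qed

text \<open>The powers of \<open>t\<close> permute the finitely many cosets of \<open>C\<close> in
  \<open>P\<close>. Two of them induce the same permutation, so their quotient acts trivially;
  \<open>f i\<close> records the permutation on representatives.\<close>

lemma (in cyclic_extension) power_acts_trivially:
  assumes C: "subgroup C G" "C \<subseteq> P" "fin_cover P C"
    and n: "\<And>g c. g \<in> generate G (insert t P) \<Longrightarrow> c \<in> C \<Longrightarrow> g \<otimes> c \<otimes> inv g \<in> C"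
  shows "\<exists>m::nat. m > 0 \<and> (\<forall>p\<in>P. t [^] m \<otimes> p \<otimes> inv (t [^] m) \<otimes> inv p \<in> C)"
proof -
  obtain T where T: "finite T" "T \<subseteq> P" "\<forall>p\<in>P. \<exists>s\<in>T. p \<otimes> inv s \<in> C" using C by (auto simp: fin_cover_def)
  have tn: "t [^] (i::nat) \<otimes> p \<otimes> inv (t [^] i) \<in> P" if "p \<in> P" for i p
    using conj_pow[OF that, of "int i"] t by (simp add: int_pow_neg int_pow_int)
  then have "\<forall>i::nat. \<forall>s\<in>T. \<exists>s'\<in>T. t [^] i \<otimes> s \<otimes> inv (t [^] i) \<otimes> inv s' \<in> C"
    using T by blast
  then obtain f where f: "\<And>(i::nat) s. s \<in> T \<Longrightarrow> f i s \<in> T \<and> t [^] i \<otimes> s \<otimes> inv (t [^] i) \<otimes> inv (f i s) \<in> C"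
    by metis
  have "(\<lambda>i. restrict (f i) T) ` UNIV \<subseteq> (\<Pi>\<^sub>E s\<in>T. T)" using f by auto
  then have "finite ((\<lambda>i. restrict (f i) T) ` UNIV)" using T(1) by (meson finite_PiE finite_subset)
  then have "\<not> inj (\<lambda>i. restrict (f i) T)" using finite_imageD infinite_UNIV_nat by blast
  then obtain i j where ij: "i < j" "restrict (f i) T = restrict (f j) T"
    unfolding inj_def by (metis linorder_neqE_nat)
  define m where "m = j - i"
  have tj: "t [^] j = t [^] i \<otimes> t [^] m" using ij(1) t by (simp add: m_def nat_pow_mult)
  define a where "a = t [^] i"
  define b where "b = t [^] m"
  have ab: "a \<in> carrier G" "b \<in> carrier G" using t by (auto simp: a_def b_def)
  have gen: "t [^] (k::int) \<in> generate G (insert t P)" for k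
    using level_pow unfolding generate_level by blast
  have ga: "inv a \<in> generate G (insert t P)" using gen[of "- int i"] t by (simp add: a_def int_pow_neg int_pow_int)
  have gb: "b \<in> generate G (insert t P)" using gen[of "int m"] by (simp add: b_def int_pow_int)
  have s: "b \<otimes> s \<otimes> inv b \<otimes> inv s \<in> C" if s: "s \<in> T" for s
  proof -
    have sc: "s \<in> carrier G" "f i s \<in> carrier G" using s f T(2) subgroup.subset[OF P] by blast+
    have fij: "f j s = f i s" using ij(2) s by (metis restrict_apply')
    have "(a \<otimes> b \<otimes> s \<otimes> inv (a \<otimes> b) \<otimes> inv (f i s)) \<otimes> inv (a \<otimes> s \<otimes> inv a \<otimes> inv (f i s)) \<in> C"
      using f[OF s, of i] f[OF s, of j] fij tj subgroup.m_closed[OF C(1)] subgroup.m_inv_closed[OF C(1)]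
      by (simp add: a_def b_def)
    from n[OF ga this] show ?thesis using sc ab by (simp add: word_simps)
  qed
  have "b \<otimes> p \<otimes> inv b \<otimes> inv p \<in> C" if p: "p \<in> P" for p
  proof -
    obtain u where u: "u \<in> T" "p \<otimes> inv u \<in> C" using T p by blast
    have c: "p \<in> carrier G" "u \<in> carrier G" using p u T(2) subgroup.subset[OF P] by blast+
    have "(b \<otimes> (p \<otimes> inv u) \<otimes> inv b) \<otimes> (b \<otimes> u \<otimes> inv b \<otimes> inv u) \<otimes> inv (p \<otimes> inv u) \<in> C"
      using n[OF gb u(2)] s[OF u(1)] u(2) subgroup.m_closed[OF C(1)] subgroup.m_inv_closed[OF C(1)] by blast
    then show ?thesis using c ab by (simp add: word_simps)
  qed
  moreover have "m > 0" using ij(1) by (simp add: m_def)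
  ultimately show ?thesis by (auto simp: b_def)
qed

text \<open>A relative form of Mal'cev's theorem that polycyclic groups are subgroup separable.\<close>

lemma (in group) pc_chain_separable:
  assumes "pc_chain G N P" and "\<And>p x. p \<in> P \<Longrightarrow> x \<in> N \<Longrightarrow> p \<otimes> x \<otimes> inv p \<in> N"
    and "subgroup J G" "N \<subseteq> J" "J \<subseteq> P" "g \<in> P" "g \<notin> J"
  shows "\<exists>K. subgroup K G \<and> J \<subseteq> K \<and> K \<subseteq> P \<and> fin_cover P K \<and> g \<notin> K"
  using assms
proof (induction arbitrary: J g rule: pc_chain.induct)
  case base
  then show ?case by blast
next
  case (step P t)
  let ?Q = "generate G (insert t P)"
  have PP: "subgroup P G" "N \<subseteq> P" "subgroup N G" using pc_chain_subgroup[OF step.hyps(1)] by auto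
  interpret cyclic_extension G P t by (rule cyclic_extensionI) (use step PP in auto)
  have PQ: "P \<subseteq> ?Q" by (blast intro: generate.incl)
  have Qc: "?Q \<subseteq> carrier G" using subgroup.subset[OF subgroup_generate] .
  have IH: "\<exists>K. subgroup K G \<and> J \<subseteq> K \<and> K \<subseteq> P \<and> fin_cover P K \<and> g \<notin> K"
    if "subgroup J G" "N \<subseteq> J" "J \<subseteq> P" "g \<in> P" "g \<notin> J" for J g
    using step.IH[of J g] step.prems(1) PQ that by blast
  have Pn: "x \<otimes> p \<otimes> inv x \<in> P" if "x \<in> ?Q" "p \<in> P" for x p
    using that level_conj unfolding generate_level by blast
  have inv: "\<exists>C. subgroup C G \<and> N \<subseteq> C \<and> C \<subseteq> K \<and> C \<subseteq> P \<and> fin_cover P C \<and>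
      (\<forall>x\<in>?Q. \<forall>c\<in>C. x \<otimes> c \<otimes> inv x \<in> C)"
    if K: "subgroup K G" "N \<subseteq> K" "fin_cover P K" for K
  proof -
    obtain C where "subgroup C G" "N \<subseteq> C" "C \<subseteq> K" "C \<subseteq> P" "fin_cover P C"
      and C: "\<forall>g\<in>carrier G. (\<forall>x\<in>N. g \<otimes> x \<otimes> inv g \<in> N) \<longrightarrow> (\<forall>x\<in>P. g \<otimes> x \<otimes> inv g \<in> P) \<longrightarrow>
       (\<forall>c\<in>C. g \<otimes> c \<otimes> inv g \<in> C)"
      using fin_cover_invariant[OF step.hyps(1) K] by blast
    moreover have "x \<otimes> c \<otimes> inv x \<in> C" if "x \<in> ?Q" "c \<in> C" for x c
      using C that Pn[OF that(1)] step.prems(1)[OF that(1)] Qc by blast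
    ultimately show ?thesis by blast
  qed
  note J = step.prems(2) and NJ = step.prems(3) and JQ = step.prems(4)
  have JP: "subgroup (J \<inter> P) G" by (rule subgroups_Inter_pair[OF J PP(1)])
  note Jc = subgroup.mem_carrier[OF J]
  show ?case
  proof (cases "\<exists>m>0. \<exists>j\<in>J. level m j")
    \<comment> \<open>Here \<open>J <#> P\<close> has finite index in \<open>?Q\<close>, and it is
      enough to separate inside \<open>P\<close>. The case includes a finite quotient of
      \<open>?Q\<close> by \<open>P\<close>, when the identity itself has a positive
      exponent.\<close>
    case True
    then obtain m j0 where j0: "m > 0" "j0 \<in> J" "level m j0" by blast
    have "\<exists>C. subgroup C G \<and> N \<subseteq> C \<and> C \<subseteq> P \<and> fin_cover P C \<and>
        (\<forall>x\<in>?Q. \<forall>c\<in>C. x \<otimes> c \<otimes> inv x \<in> C) \<and> g \<notin> J <#> C"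
    proof (cases "g \<in> J <#> P")
      case False
      then show ?thesis using PP fin_cover_refl[OF PP(1)] Pn by blast
    next
      case True
      then obtain j p where jp: "j \<in> J" "p \<in> P" "g = j \<otimes> p" by (auto simp: set_mult_def)
      have "p \<notin> J" using jp step.prems(6) subgroup.m_closed[OF J] by blast
      then obtain K where K: "subgroup K G" "J \<inter> P \<subseteq> K" "K \<subseteq> P" "fin_cover P K" "p \<notin> K"
        using IH[OF JP, of p] NJ PP(2) jp by blast
      obtain C where C: "subgroup C G" "N \<subseteq> C" "C \<subseteq> K" "C \<subseteq> P" "fin_cover P C"
        "\<forall>x\<in>?Q. \<forall>c\<in>C. x \<otimes> c \<otimes> inv x \<in> C"
        using inv[OF K(1) _ K(4)] K(2) NJ PP(2) by blast
      \<comment> \<open>If \<open>i \<otimes> c = j \<otimes> p\<close>, then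
        \<open>inv j \<otimes> i = p \<otimes> inv c\<close> lies in \<open>J \<inter> P\<close> and
        hence in \<open>K\<close>. As \<open>C \<subseteq> K\<close>, this would put
        \<open>p\<close> into \<open>K\<close>.\<close>
      have "g \<notin> J <#> C"
      proof
        assume "g \<in> J <#> C"
        then obtain i c where ic: "i \<in> J" "c \<in> C" "g = i \<otimes> c" by (auto simp: set_mult_def)
        have cc: "j \<in> carrier G" "p \<in> carrier G" "i \<in> carrier G" "c \<in> carrier G"
          using jp ic Jc subgroup.mem_carrier[OF PP(1)] C(4) by auto
        have e: "j \<otimes> p = i \<otimes> c" using jp(3) ic(3) by simp
        have "inv j \<otimes> i = inv j \<otimes> (i \<otimes> c) \<otimes> inv c" using cc by (simp add: m_assoc)
        also have "\<dots> = p \<otimes> inv c" unfolding e[symmetric] using cc by simp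
        finally have "inv j \<otimes> i = p \<otimes> inv c" .
        moreover have "inv j \<otimes> i \<in> J" using jp ic subgroup.m_closed[OF J] subgroup.m_inv_closed[OF J] by blast
        moreover have "p \<otimes> inv c \<in> P"
          using jp ic C(4) subgroup.m_closed[OF PP(1)] subgroup.m_inv_closed[OF PP(1)] by blast
        ultimately have "p \<otimes> inv c \<in> K" using K(2) by auto
        then have "p \<otimes> inv c \<otimes> c \<in> K" using ic C(3) subgroup.m_closed[OF K(1)] by blast
        then show False using K(5) cc by (simp add: m_assoc)
      qed
      then show ?thesis using C by blast
    qed
    then obtain C where C: "subgroup C G" "N \<subseteq> C" "C \<subseteq> P" "fin_cover P C"
        "\<forall>x\<in>?Q. \<forall>c\<in>C. x \<otimes> c \<otimes> inv x \<in> C" "g \<notin> J <#> C" by blast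
    have nJ: "j \<otimes> c \<otimes> inv j \<in> C" if "j \<in> J" "c \<in> C" for j c using that C(5) JQ by blast
    note JC = subgroup_product[OF J C(1) nJ]
    have "fin_cover ?Q (J <#> C)"
      by (rule fin_cover_extension[OF C(4) JC(3) JC(1) subsetD[OF JC(2) j0(2)] j0(3,1)])
    moreover have "J <#> C \<subseteq> ?Q"
      using JQ C(3) PQ subgroup.m_closed[OF subgroup_generate] unfolding set_mult_def by blast
    ultimately show ?thesis using JC C(6) by blast
  next
    case False
    have one: "k = 0" if "level k x" "x \<in> J" for k x
      using False that level_inv[OF that(1)] subgroup.m_inv_closed[OF J that(2)]
      by (metis linorder_neqE neg_0_less_iff_less)
    have JP': "J \<subseteq> P"
    proof
      fix x assume "x \<in> J"
      then obtain k where "level k x" using JQ generate_level by blast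
      then show "x \<in> P" using one[of k x] \<open>x \<in> J\<close> level_0 by simp
    qed
    \<comment> \<open>Two exponents of one element give the identity a nonzero exponent, which is
      excluded because \<open>\<one>\<close> lies in \<open>J\<close>. Thus \<open>?Q\<close> over
      \<open>P\<close> is infinite cyclic.\<close>
    have uniq: "k = l" if "level k x" "level l x" for k l x
    proof -
      have "level (k + - l) (x \<otimes> inv x)" by (intro level_mult level_inv that)
      moreover have "x \<in> carrier G" using that by (simp add: level_def)
      ultimately show ?thesis using one[of "k - l" \<one>] subgroup.one_closed[OF J] by simp
    qed
    \<comment> \<open>The wanted subgroup is generated by \<open>B\<close> and
      \<open>t [^] m\<close>. Since \<open>t [^] m\<close> normalises \<open>B\<close>, exponents in
      that subgroup are multiples of \<open>m\<close>, and the last clause keeps \<open>g\<close>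
      out of it.\<close>
    have "\<exists>B (m::nat). subgroup B G \<and> J \<subseteq> B \<and> B \<subseteq> P \<and> fin_cover P B \<and> m > 0 \<and>
       (\<forall>b\<in>B. t [^] m \<otimes> b \<otimes> inv (t [^] m) \<in> B) \<and> (\<forall>b\<in>B. inv (t [^] m) \<otimes> b \<otimes> t [^] m \<in> B) \<and>
       (\<forall>l. level (int m * l) g \<longrightarrow> l = 0 \<and> g \<notin> B)"
    proof (cases "g \<in> P")
      case False
      obtain k where k: "level k g" using step.prems(5) generate_level by blast
      have k0: "k \<noteq> 0" using False k level_0 by auto
      \<comment> \<open>As \<open>g\<close> lies outside \<open>P\<close>, its exponent
        \<open>k\<close> is nonzero; a modulus larger than its absolute value cannot divide
        it.\<close>
      let ?m = "nat \<bar>k\<bar> + 1"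
      have "\<not> level (int ?m * l) g" for l
      proof
        assume "level (int ?m * l) g"
        then have e: "k = int ?m * l" by (rule uniq[OF k])
        then have "l \<noteq> 0" using k0 by (metis mult_zero_right)
        then have "int ?m * 1 \<le> int ?m * \<bar>l\<bar>" by (intro mult_left_mono) auto
        also have "\<dots> = \<bar>k\<bar>" using arg_cong[OF e, of abs] by (simp only: abs_mult abs_of_nat)
        finally show False by simp
      qed
      moreover have "t [^] ?m \<otimes> b \<otimes> inv (t [^] ?m) \<in> P" "inv (t [^] ?m) \<otimes> b \<otimes> t [^] ?m \<in> P" if "b \<in> P" for b
        using conj_pow[OF that, of "int ?m"] conj_pow[OF that, of "- int ?m"] t
        by (simp_all only: int_pow_neg[OF t] int_pow_int minus_minus)
      ultimately show ?thesis using PP(1) JP' fin_cover_refl[OF PP(1)]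
        by (intro exI[of _ P] exI[of _ ?m]) auto
    next
      case True
      obtain K where K: "subgroup K G" "J \<subseteq> K" "K \<subseteq> P" "fin_cover P K" "g \<notin> K"
        using IH[OF J NJ JP' True step.prems(6)] by blast
      obtain C where C: "subgroup C G" "N \<subseteq> C" "C \<subseteq> K" "C \<subseteq> P" "fin_cover P C"
        "\<forall>x\<in>?Q. \<forall>c\<in>C. x \<otimes> c \<otimes> inv x \<in> C"
        using inv[OF K(1) _ K(4)] K(2) NJ by blast
      have nJ: "j \<otimes> c \<otimes> inv j \<in> C" if "j \<in> J" "c \<in> C" for j c using that C(6) JQ by blast
      note JC = subgroup_product[OF J C(1) nJ]
      \<comment> \<open>A power of \<open>t\<close> that moves elements of \<open>P\<close> only
        within cosets of \<open>C\<close> normalises \<open>J <#> C\<close>, although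
        \<open>t\<close> itself need not normalise \<open>J\<close>.\<close>
      obtain m :: nat where m: "m > 0" "\<forall>p\<in>P. t [^] m \<otimes> p \<otimes> inv (t [^] m) \<otimes> inv p \<in> C"
        using power_acts_trivially[OF C(1,4,5)] C(6) by blast
      let ?u = "t [^] m"
      have u: "?u \<in> carrier G" using t by simp
      have uQ: "?u \<in> ?Q" "inv ?u \<in> ?Q"
        using level_pow[of "int m"] level_pow[of "- int m"] t
        unfolding generate_level by (auto simp: int_pow_neg int_pow_int)
      have in_JC: "v \<otimes> b \<otimes> inv v \<in> J <#> C"
        if v: "v \<in> ?Q" "\<forall>p\<in>P. v \<otimes> p \<otimes> inv v \<otimes> inv p \<in> C" and b: "b \<in> J <#> C" for v b
      proof -
        obtain j c where jc: "j \<in> J" "c \<in> C" "b = j \<otimes> c" using b by (auto simp: set_mult_def)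
        have cc: "j \<in> carrier G" "c \<in> carrier G" "v \<in> carrier G"
          using jc Jc subgroup.mem_carrier[OF C(1)] v(1) Qc by auto
        have "v \<otimes> j \<otimes> inv v \<otimes> inv j \<in> J <#> C" using v(2) jc(1) JP' JC(3) by blast
        moreover have "j \<in> J <#> C" using jc JC(2) by blast
        moreover have "v \<otimes> c \<otimes> inv v \<in> J <#> C" using v(1) jc(2) C(6) JC(3) by blast
        ultimately have "(v \<otimes> j \<otimes> inv v \<otimes> inv j) \<otimes> j \<otimes> (v \<otimes> c \<otimes> inv v) \<in> J <#> C"
          using subgroup.m_closed[OF JC(1)] by blast
        then show ?thesis using cc jc(3) by (simp add: word_simps)
      qed
      have "inv ?u \<otimes> p \<otimes> inv (inv ?u) \<otimes> inv p \<in> C" if p: "p \<in> P" for p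
      proof -
        have "inv ?u \<otimes> inv (?u \<otimes> p \<otimes> inv ?u \<otimes> inv p) \<otimes> inv (inv ?u) \<in> C"
          using m(2) p C(6) uQ(2) subgroup.m_inv_closed[OF C(1)] by blast
        then show ?thesis using p u subgroup.mem_carrier[OF PP(1) p] by (simp add: word_simps)
      qed
      then have "inv ?u \<otimes> b \<otimes> ?u \<in> J <#> C" if "b \<in> J <#> C" for b
        using in_JC[OF uQ(2) _ that] u by simp
      moreover have "?u \<otimes> b \<otimes> inv ?u \<in> J <#> C" if "b \<in> J <#> C" for b
        using in_JC[OF uQ(1) m(2) that] .
      moreover have JCK: "J <#> C \<subseteq> K"
        using K(2) C(3) subgroup.m_closed[OF K(1)] unfolding set_mult_def by blast
      moreover have "l = 0 \<and> g \<notin> J <#> C" if "level (int m * l) g" for l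
        using uniq[OF that iffD2[OF level_0 True]] m(1) JCK K(5) by auto
      ultimately show ?thesis
        using JC K(3) m(1) fin_cover_mono[OF C(5) JC(3)] by (intro exI[of _ "J <#> C"] exI[of _ m]) blast
    qed
    then obtain B and m :: nat where B: "subgroup B G" "J \<subseteq> B" "B \<subseteq> P" "fin_cover P B" "m > 0"
       "\<forall>b\<in>B. t [^] m \<otimes> b \<otimes> inv (t [^] m) \<in> B" "\<forall>b\<in>B. inv (t [^] m) \<otimes> b \<otimes> t [^] m \<in> B"
       "\<forall>l. level (int m * l) g \<longrightarrow> l = 0 \<and> g \<notin> B" by blast
    interpret E: cyclic_extension G B "t [^] m"
      by (rule cyclic_extensionI) (use B t in auto)
    let ?K = "generate G (insert (t [^] m) B)"
    have tmK: "t [^] m \<in> ?K" by (blast intro: generate.incl)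
    have BK: "B \<subseteq> ?K" by (blast intro: generate.incl)
    have lm: "level (int m) (t [^] m)" using level_pow[of "int m"] by (simp add: int_pow_int)
    have "fin_cover ?Q ?K"
      by (rule fin_cover_extension[OF B(4) BK E.subgroup_generate tmK lm]) (use B(5) in simp)
    moreover have "?K \<subseteq> ?Q"
    proof (rule generate_subgroup_incl[OF _ subgroup_generate])
      show "insert (t [^] m) B \<subseteq> ?Q" using lm B(3) PQ unfolding generate_level by blast
    qed
    moreover have "g \<notin> ?K"
    proof
      assume "g \<in> ?K"
      then obtain l where l: "E.level l g" using E.generate_level by blast
      then obtain b where b: "b \<in> B" "g = (t [^] m) [^] l \<otimes> b" using E.level_iff by blast
      have "level (int m * l + 0) g"
        unfolding b(2) by (intro level_mult level_int_pow lm iffD2[OF level_0]) (use b(1) B(3) in blast)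
      then have "l = 0" "g \<notin> B" using B(8) by auto
      then show False using l E.level_0 by simp
    qed
    ultimately show ?thesis using E.subgroup_generate B(2) BK by blast
  qed
qed

subsection \<open>The Noetherian property of modules\<close>

definition conj_closed :: "('a, 'b) monoid_scheme \<Rightarrow> 'a set \<Rightarrow> 'a set \<Rightarrow> bool"
  where "conj_closed G P X \<longleftrightarrow> (\<forall>p\<in>P. \<forall>x\<in>X. p \<otimes>\<^bsub>G\<^esub> x \<otimes>\<^bsub>G\<^esub> inv\<^bsub>G\<^esub> p \<in> X)"

lemma conj_closedD: "conj_closed G P X \<Longrightarrow> p \<in> P \<Longrightarrow> x \<in> X \<Longrightarrow> p \<otimes>\<^bsub>G\<^esub> x \<otimes>\<^bsub>G\<^esub> inv\<^bsub>G\<^esub> p \<in> X"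
  by (simp add: conj_closed_def)

lemma conj_closed_mono: "conj_closed G Q X \<Longrightarrow> P \<subseteq> Q \<Longrightarrow> conj_closed G P X"
  by (auto simp: conj_closed_def)

lemma (in group) conj_closed_generate:
  assumes P: "subgroup P G" and E: "E \<subseteq> carrier G"
    and c: "\<And>p e. p \<in> P \<Longrightarrow> e \<in> E \<Longrightarrow> p \<otimes> e \<otimes> inv p \<in> generate G E"
  shows "conj_closed G P (generate G E)"
  unfolding conj_closed_def
proof (intro ballI)
  fix p x assume "p \<in> P" "x \<in> generate G E"
  have "inv y \<otimes> e \<otimes> y \<in> generate G E" if "y \<in> P" "e \<in> E" for y e
    using c[OF subgroup.m_inv_closed[OF P that(1)] that(2)] subgroup.mem_carrier[OF P that(1)] by simp
  then show "p \<otimes> x \<otimes> inv p \<in> generate G E"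
    using conj_generate_closed[OF subgroup.subset[OF P] E c _ _ \<open>x \<in> generate G E\<close>]
      \<open>p \<in> P\<close> generate.incl[of p P G] by blast
qed

lemma (in group) conj_closed_conj_span:
  assumes "subgroup P G" "K \<subseteq> carrier G" "E \<subseteq> carrier G" "conj_closed G P K"
  shows "conj_closed G P (conj_span G P K E)"
  unfolding conj_closed_def using conj_span_conj[OF assms(1-3)] conj_closedD[OF assms(4)] by blast

lemma (in group) conj_closed_product:
  assumes "P \<subseteq> carrier G" "A \<subseteq> carrier G" "B \<subseteq> carrier G" "conj_closed G P A" "conj_closed G P B"
  shows "conj_closed G P (A <#> B)"
  unfolding conj_closed_def
proof (intro ballI)
  fix p x assume p: "p \<in> P" and "x \<in> A <#> B"
  then obtain a b where ab: "a \<in> A" "b \<in> B" "x = a \<otimes> b" by (auto simp: set_mult_def)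
  have "p \<otimes> x \<otimes> inv p = (p \<otimes> a \<otimes> inv p) \<otimes> (p \<otimes> b \<otimes> inv p)"
    using p ab assms(1-3) by (auto simp: word_simps subset_iff)
  then show "p \<otimes> x \<otimes> inv p \<in> A <#> B"
    using set_multI[OF conj_closedD[OF assms(4) p ab(1)] conj_closedD[OF assms(5) p ab(2)]] by simp
qed

text \<open>An abelian section \<open>C/K\<close> on which subgroups act by conjugation; submodules are represented by
  their preimages in \<open>C\<close>.\<close>

locale abelian_section = group +
  fixes K C
  assumes K: "subgroup K G" and C: "subgroup C G" and KC: "K \<subseteq> C"
    and comm: "\<And>c d. c \<in> C \<Longrightarrow> d \<in> C \<Longrightarrow> c \<otimes> d \<otimes> inv c \<otimes> inv d \<in> K"
begin

definition submod :: "'a set \<Rightarrow> 'a set \<Rightarrow> bool"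
  where "submod P A \<longleftrightarrow> subgroup A G \<and> K \<subseteq> A \<and> A \<subseteq> C \<and> conj_closed G P A"

lemma submodD:
  assumes "submod P A"
  shows "subgroup A G" "K \<subseteq> A" "A \<subseteq> C" "conj_closed G P A" "A \<subseteq> carrier G"
  using assms subgroup.subset unfolding submod_def by blast+

definition noetherian :: "'a set \<Rightarrow> 'a set \<Rightarrow> bool"
  where "noetherian P D \<longleftrightarrow>
    (\<forall>I. submod P I \<longrightarrow> I \<subseteq> D \<longrightarrow> (\<exists>E. finite E \<and> E \<subseteq> I \<and> I = conj_span G P K E))"

lemma conj_C:
  assumes "subgroup A G" "K \<subseteq> A" "A \<subseteq> C" "c \<in> C" "a \<in> A"
  shows "c \<otimes> a \<otimes> inv c \<in> A"
proof -
  have "c \<otimes> a \<otimes> inv c \<otimes> inv a \<in> A" using comm[of c a] assms by blast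
  then have "c \<otimes> a \<otimes> inv c \<otimes> inv a \<otimes> a \<in> A" using assms(5) subgroup.m_closed[OF assms(1)] by blast
  then show ?thesis using assms subgroup.mem_carrier[OF C] by (simp add: m_assoc subset_iff)
qed

lemma submod_product:
  assumes "submod P A" "submod P B" "P \<subseteq> carrier G"
  shows "submod P (A <#> B)" "A \<subseteq> A <#> B" "B \<subseteq> A <#> B"
proof -
  note A = submodD[OF assms(1)] and B = submodD[OF assms(2)]
  note pr = subgroup_product[OF A(1) B(1) conj_C[OF B(1-3) subsetD[OF A(3)]]]
  show "A \<subseteq> A <#> B" "B \<subseteq> A <#> B" using pr by blast+
  have "A <#> B \<subseteq> C" using A(3) B(3) subgroup.m_closed[OF C] unfolding set_mult_def by blast
  then show "submod P (A <#> B)"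
    unfolding submod_def using pr A(2) conj_closed_product[OF assms(3) A(5) B(5) A(4) B(4)] by blast
qed

lemma submod_conj_span:
  assumes "subgroup P G" "conj_closed G P K" "conj_closed G P C" "E \<subseteq> C"
  shows "submod P (conj_span G P K E)"
proof -
  have c: "K \<subseteq> carrier G" "E \<subseteq> carrier G" using subgroup.subset[OF C] KC assms(4) by auto
  have "conj_span G P K E \<subseteq> C"
    by (rule conj_span_least[OF C KC]) (use conj_closedD[OF assms(3)] assms(4) in blast)
  then show ?thesis
    unfolding submod_def
    using conj_span_subgroup[OF subgroup.subset[OF assms(1)] c] conj_span_incl(1)[OF assms(1) c(2)]
      conj_closed_conj_span[OF assms(1) c assms(2)] by blast
qed

lemma conj_span_le_submod:
  assumes "submod P A" "E \<subseteq> A"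
  shows "conj_span G P K E \<subseteq> A"
  by (rule conj_span_least)
    (use submodD[OF assms(1)] conj_closedD[OF submodD(4)[OF assms(1)]] assms(2) in auto)

end

text \<open>The situation of a skew Laurent extension: the group ring of \<open>Q\<close> arises
  from that of \<open>P\<close> by adjoining an invertible \<open>t\<close> that acts on
  \<open>P\<close> by an automorphism.\<close>

locale section_extension = abelian_section G K C + cyclic_extension G P t
  for G (structure) and K C P t +
  assumes PC: "conj_closed G P C" and PK: "conj_closed G P K"
    and tC: "\<And>x. x \<in> C \<Longrightarrow> t \<otimes> x \<otimes> inv t \<in> C" "\<And>x. x \<in> C \<Longrightarrow> inv t \<otimes> x \<otimes> t \<in> C"
    and tK: "\<And>x. x \<in> K \<Longrightarrow> t \<otimes> x \<otimes> inv t \<in> K" "\<And>x. x \<in> K \<Longrightarrow> inv t \<otimes> x \<otimes> t \<in> K"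
begin

abbreviation Q where "Q \<equiv> generate G (insert t P)"

lemma PQ: "P \<subseteq> Q" by (blast intro: generate.incl)

lemma C_carrier: "x \<in> C \<Longrightarrow> x \<in> carrier G" using subgroup.mem_carrier[OF C] .

lemma conj_closed_Q:
  assumes "A \<subseteq> carrier G" "conj_closed G P A" "\<And>x. x \<in> A \<Longrightarrow> t \<otimes> x \<otimes> inv t \<in> A"
    "\<And>x. x \<in> A \<Longrightarrow> inv t \<otimes> x \<otimes> t \<in> A" and A: "subgroup A G"
  shows "conj_closed G Q A"
proof -
  have "g \<otimes> x \<otimes> inv g \<in> generate G A" if "g \<in> Q" "x \<in> generate G A" for g x
  proof (rule conj_generate_closed[OF _ assms(1) _ _ that])
    show "insert t P \<subseteq> carrier G" using t subgroup.subset[OF P] by blast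
    fix y e assume y: "y \<in> insert t P" and e: "e \<in> A"
    show "y \<otimes> e \<otimes> inv y \<in> generate G A"
      using y e assms(3) conj_closedD[OF assms(2)] generate_subgroup_eq[OF A] by auto
    show "inv y \<otimes> e \<otimes> y \<in> generate G A"
      using y e assms(4) conj_closedD[OF assms(2) subgroup.m_inv_closed[OF P], of y e]
        subgroup.mem_carrier[OF P] generate_subgroup_eq[OF A] by auto
  qed
  then show ?thesis unfolding conj_closed_def generate_subgroup_eq[OF A] by blast
qed

lemma QC: "conj_closed G Q C" and QK: "conj_closed G Q K"
  using conj_closed_Q[OF subgroup.subset[OF C] PC tC C] conj_closed_Q[OF subgroup.subset[OF K] PK tK K] by blast+

text \<open>Multiplication by a power of \<open>t\<close> in the module. Only nonnegative powers
  occur, since a Laurent polynomial becomes a polynomial after multiplication by a further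
  power.\<close>

definition tau :: "nat \<Rightarrow> 'a \<Rightarrow> 'a"
  where "tau n x = t [^] n \<otimes> x \<otimes> inv (t [^] n)"

lemma tn [simp]: "t [^] (n::nat) \<in> carrier G" using t by simp

lemma tnQ: "t [^] (n::nat) \<in> Q" "inv (t [^] n) \<in> Q"
  using level_pow[of "int n"] level_pow[of "- int n"] t
  unfolding generate_level by (auto simp: int_pow_neg int_pow_int)

lemma tau_mult: "x \<in> C \<Longrightarrow> y \<in> C \<Longrightarrow> tau n (x \<otimes> y) = tau n x \<otimes> tau n y"
  using C_carrier by (simp add: tau_def word_simps)

lemma tau_add: "x \<in> C \<Longrightarrow> tau (m + n) x = tau m (tau n x)"
  using C_carrier t by (simp add: tau_def nat_pow_mult[symmetric] word_simps)

lemma tau_closed: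
  assumes "conj_closed G Q A" "x \<in> A"
  shows "tau n x \<in> A"
  using conj_closedD[OF assms(1) tnQ(1) assms(2)] by (simp add: tau_def)

lemma tau_cancel:
  assumes "submod Q A" "x \<in> C" "tau n x \<in> A"
  shows "x \<in> A"
proof -
  have "inv (t [^] n) \<otimes> tau n x \<otimes> inv (inv (t [^] n)) \<in> A"
    using conj_closedD[OF submodD(4)[OF assms(1)] tnQ(2) assms(3)] .
  then show ?thesis using C_carrier[OF assms(2)] by (simp add: tau_def word_simps)
qed

text \<open>The map \<open>tau n\<close> is merely semilinear over \<open>P\<close>: moving
  \<open>p\<close> past it twists \<open>p\<close> by \<open>t [^] n\<close>. Both directions of the
  twist stay in \<open>P\<close>, which suffices to carry submodules to submodules.\<close>

lemma tau_conj:
  assumes "p \<in> P" "x \<in> C"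
  shows "t [^] n \<otimes> p \<otimes> inv (t [^] n) \<in> P" "inv (t [^] n) \<otimes> p \<otimes> t [^] n \<in> P"
    "tau n (p \<otimes> x \<otimes> inv p) = (t [^] n \<otimes> p \<otimes> inv (t [^] n)) \<otimes> tau n x \<otimes> inv (t [^] n \<otimes> p \<otimes> inv (t [^] n))"
    "p \<otimes> tau n x \<otimes> inv p = tau n ((inv (t [^] n) \<otimes> p \<otimes> t [^] n) \<otimes> x \<otimes> inv (inv (t [^] n) \<otimes> p \<otimes> t [^] n))"
proof -
  show "t [^] n \<otimes> p \<otimes> inv (t [^] n) \<in> P" "inv (t [^] n) \<otimes> p \<otimes> t [^] n \<in> P"
    using conj_pow[OF assms(1), of "int n"] conj_pow[OF assms(1), of "- int n"] t
    by (simp_all add: int_pow_neg int_pow_int)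
qed (use C_carrier[OF assms(2)] subgroup.mem_carrier[OF P assms(1)] in \<open>simp_all add: tau_def word_simps\<close>)

end

text \<open>Hilbert's basis theorem in the version of P. Hall: \<open>T n\<close> collects the polynomials in \<open>t\<close> of degree
  below \<open>n\<close> with coefficients in \<open>D\<close>, and \<open>L J n\<close> consists of the coefficients of \<open>t\<^sup>n\<close> in the elements of
  degree at most \<open>n\<close> of \<open>J\<close>.  Coefficients need not be unique, so no freeness is needed.\<close>

locale hilbert_step = section_extension +
  fixes D
  assumes D: "submod P D" and noeth: "noetherian P D"
begin

definition "T n = generate G (K \<union> (\<Union>i<n. tau i ` D))"

lemma DC: "D \<subseteq> C" using submodD[OF D] by blast

lemma gens_C: "K \<union> (\<Union>i<n. tau i ` D) \<subseteq> C"
  using KC DC tau_closed[OF QC] by blast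

lemma gens_T: "K \<union> (\<Union>i<n. tau i ` D) \<subseteq> T n"
  unfolding T_def by (blast intro: generate.incl)

lemma T_submod: "submod P (T n)"
proof -
  have gc: "K \<union> (\<Union>i<n. tau i ` D) \<subseteq> carrier G" using gens_C C_carrier by blast
  have "subgroup (T n) G" unfolding T_def by (rule generate_is_subgroup[OF gc])
  moreover have "T n \<subseteq> C" unfolding T_def by (rule generate_subgroup_incl[OF gens_C C])
  moreover have "conj_closed G P (T n)"
    unfolding T_def
  proof (rule conj_closed_generate[OF P gc])
    fix p e assume p: "p \<in> P" and e: "e \<in> K \<union> (\<Union>i<n. tau i ` D)"
    show "p \<otimes> e \<otimes> inv p \<in> generate G (K \<union> (\<Union>i<n. tau i ` D))"
    proof (cases "e \<in> K")
      case True
      then show ?thesis using conj_closedD[OF PK p] by (blast intro: generate.incl)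
    next
      case False
      then obtain i d where i: "i < n" "d \<in> D" "e = tau i d" using e by blast
      have "p \<otimes> e \<otimes> inv p = tau i ((inv (t [^] i) \<otimes> p \<otimes> t [^] i) \<otimes> d \<otimes> inv (inv (t [^] i) \<otimes> p \<otimes> t [^] i))"
        unfolding i(3) by (rule tau_conj(4)[OF p]) (use i DC in blast)
      moreover have "(inv (t [^] i) \<otimes> p \<otimes> t [^] i) \<otimes> d \<otimes> inv (inv (t [^] i) \<otimes> p \<otimes> t [^] i) \<in> D"
        using conj_closedD[OF submodD(4)[OF D] tau_conj(2)[OF p] i(2)] i(2) DC by blast
      ultimately show ?thesis using i(1) by (blast intro: generate.incl)
    qed
  qed
  ultimately show ?thesis using gens_T unfolding submod_def by blast
qed

lemma T_mono: "m \<le> n \<Longrightarrow> T m \<subseteq> T n"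
  unfolding T_def by (rule mono_generate) force

lemma T_0: "T 0 = K"
  unfolding T_def using generate_subgroup_eq[OF K] by simp

lemma T_shift:
  assumes "x \<in> T n"
  shows "tau m x \<in> T (m + n)"
proof -
  have "K \<union> (\<Union>i<n. tau i ` D) \<subseteq> {x \<in> carrier G. t [^] m \<otimes> x \<otimes> inv (t [^] m) \<in> T (m + n)}"
  proof
    fix y assume y: "y \<in> K \<union> (\<Union>i<n. tau i ` D)"
    have "tau m y \<in> T (m + n)"
    proof (cases "y \<in> K")
      case True
      then show ?thesis using tau_closed[OF QK] gens_T by blast
    next
      case False
      then obtain i d where i: "i < n" "d \<in> D" "y = tau i d" using y by blast
      have "tau m y = tau (m + i) d" using i tau_add DC by (simp add: subset_iff)
      moreover have "m + i \<in> {..<m + n}" using i(1) by simp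
      ultimately show ?thesis using i(2) gens_T[of "m + n"] by blast
    qed
    moreover have "y \<in> carrier G" using y gens_C C_carrier by blast
    ultimately show "y \<in> {x \<in> carrier G. t [^] m \<otimes> x \<otimes> inv (t [^] m) \<in> T (m + n)}"
      by (simp add: tau_def)
  qed
  then have "T n \<subseteq> {x \<in> carrier G. t [^] m \<otimes> x \<otimes> inv (t [^] m) \<in> T (m + n)}"
    unfolding T_def[of n]
    by (intro generate_subgroup_incl subgroup_conj_set submodD(1)[OF T_submod]) simp_all
  then show ?thesis using assms by (auto simp: tau_def)
qed

lemma tau_submod_D: "submod P (tau n ` D)"
proof -
  have "tau n \<in> hom (G\<lparr>carrier := C\<rparr>) G"
    using tau_mult C_carrier by (auto simp: hom_def tau_def)
  then interpret h: group_hom "G\<lparr>carrier := C\<rparr>" G "tau n"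
    using subgroup_imp_group[OF C] group_axioms by (simp add: group_hom_def group_hom_axioms_def)
  have s: "subgroup (tau n ` D) G"
    by (rule h.subgroup_img_is_subgroup) (use subgroup_incl[OF submodD(1)[OF D] C DC] in simp)
  have "conj_closed G P (tau n ` D)"
    unfolding conj_closed_def
  proof (intro ballI)
    fix p x assume p: "p \<in> P" and "x \<in> tau n ` D"
    then obtain d where d: "d \<in> D" "x = tau n d" by blast
    have dC: "d \<in> C" using d DC by blast
    show "p \<otimes> x \<otimes> inv p \<in> tau n ` D"
      unfolding d(2) tau_conj(4)[OF p dC]
      using conj_closedD[OF submodD(4)[OF D] tau_conj(2)[OF p dC] d(1)] by blast
  qed
  moreover have "K \<subseteq> tau n ` D"
  proof
    fix k assume k: "k \<in> K"
    have "inv (t [^] n) \<otimes> k \<otimes> inv (inv (t [^] n)) \<in> K" using conj_closedD[OF QK tnQ(2) k] .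
    moreover have "k = tau n (inv (t [^] n) \<otimes> k \<otimes> inv (inv (t [^] n)))"
      using subgroup.mem_carrier[OF K k] by (simp add: tau_def word_simps)
    ultimately show "k \<in> tau n ` D" using submodD(2)[OF D] by blast
  qed
  moreover have "tau n ` D \<subseteq> C" using tau_closed[OF QC] DC by blast
  ultimately show ?thesis using s unfolding submod_def by blast
qed

lemma P_carrier: "P \<subseteq> carrier G" using subgroup.subset[OF P] .

lemma T_Suc:
  assumes "x \<in> T (Suc n)"
  shows "\<exists>a\<in>D. \<exists>u\<in>T n. x = tau n a \<otimes> u"
proof -
  note pr = submod_product[OF tau_submod_D T_submod P_carrier, of n n]
  have "K \<union> (\<Union>i<Suc n. tau i ` D) \<subseteq> tau n ` D <#> T n"
    unfolding lessThan_Suc UN_insert using pr(2,3) gens_T[of n] by blast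
  then have "T (Suc n) \<subseteq> tau n ` D <#> T n"
    unfolding T_def[of "Suc n"] by (rule generate_subgroup_incl[OF _ submodD(1)[OF pr(1)]])
  then have "x \<in> tau n ` D <#> T n" using assms by blast
  then show ?thesis by (auto simp: set_mult_def)
qed

definition "L J n = {a \<in> D. tau n a \<in> J <#> T n}"

lemma L_submod:
  assumes J: "submod Q J"
  shows "submod P (L J n)"
proof -
  have JP: "submod P J"
    using submodD[OF J] conj_closed_mono[OF submodD(4)[OF J] PQ] unfolding submod_def by blast
  note pr = submod_product[OF JP T_submod P_carrier, of n]
  have "L J n = D \<inter> {a \<in> carrier G. t [^] n \<otimes> a \<otimes> inv (t [^] n) \<in> J <#> T n}"
    using submodD(5)[OF D] by (auto simp: L_def tau_def)
  then have "subgroup (L J n) G"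
    using subgroups_Inter_pair[OF submodD(1)[OF D] subgroup_conj_set[OF submodD(1)[OF pr(1)] tn]] by simp
  moreover have "K \<subseteq> L J n"
    using tau_closed[OF QK] submodD(2)[OF D] submodD(2)[OF pr(1)] unfolding L_def by blast
  moreover have "conj_closed G P (L J n)"
    unfolding conj_closed_def
  proof (intro ballI)
    fix p a assume p: "p \<in> P" and a: "a \<in> L J n"
    have aD: "a \<in> D" "tau n a \<in> J <#> T n" using a by (auto simp: L_def)
    then have aC: "a \<in> C" using DC by blast
    have "tau n (p \<otimes> a \<otimes> inv p) \<in> J <#> T n"
      unfolding tau_conj(3)[OF p aC] by (rule conj_closedD[OF submodD(4)[OF pr(1)] tau_conj(1)[OF p aC] aD(2)])
    then show "p \<otimes> a \<otimes> inv p \<in> L J n"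
      using conj_closedD[OF submodD(4)[OF D] p aD(1)] by (simp add: L_def)
  qed
  moreover have "L J n \<subseteq> C" using DC by (auto simp: L_def)
  ultimately show ?thesis unfolding submod_def by blast
qed

text \<open>Multiplication by \<open>t\<close> turns \<open>tau n a\<close> into
  \<open>tau (Suc n) a\<close> with the same \<open>a\<close>. Placing coefficients inside the power
  of \<open>t\<close> thus leaves them untwisted, and the coefficient modules increase.\<close>

lemma L_Suc:
  assumes J: "submod Q J"
  shows "L J n \<subseteq> L J (Suc n)"
proof
  fix a assume "a \<in> L J n"
  then obtain x u where a: "a \<in> D" "x \<in> J" "u \<in> T n" "tau n a = x \<otimes> u" by (auto simp: L_def set_mult_def)
  have "x \<in> C" "u \<in> C" "a \<in> C" using a submodD(3)[OF J] submodD(3)[OF T_submod] DC by blast+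
  then have "tau (Suc n) a = tau 1 x \<otimes> tau 1 u" using tau_add[of a 1 n] tau_mult a(4) by simp
  moreover have "tau 1 x \<in> J" using tau_closed[OF submodD(4)[OF J] a(2)] .
  moreover have "tau 1 u \<in> T (Suc n)" using T_shift[OF a(3), of 1] by simp
  ultimately show "a \<in> L J (Suc n)" using a(1) by (simp add: L_def set_multI)
qed

lemma L_mono: "submod Q J \<Longrightarrow> m \<le> n \<Longrightarrow> L J m \<subseteq> L J n"
  by (rule lift_Suc_mono_le[of "L J"]) (use L_Suc in auto)

text \<open>Induction on the degree: subtract from an element of \<open>I\<close> an element of
  \<open>I'\<close> with the same leading coefficient. The difference lies in \<open>I\<close> again
  because \<open>I' \<subseteq> I\<close>.\<close>

lemma Inter_T_subset:
  assumes I: "submod Q I" and I': "submod Q I'" and L: "\<And>n. L I n \<subseteq> L I' n" and "I' \<subseteq> I"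
  shows "I \<inter> T n \<subseteq> I'"
proof (induction n)
  case 0
  then show ?case using T_0 submodD(2)[OF I'] by blast
next
  case (Suc n)
  show ?case
  proof
    fix y assume y: "y \<in> I \<inter> T (Suc n)"
    then obtain a u where a: "a \<in> D" "u \<in> T n" "y = tau n a \<otimes> u" using T_Suc by blast
    have c: "u \<in> carrier G" "tau n a \<in> carrier G" "y \<in> carrier G"
      using a y submodD(5)[OF T_submod] submodD(5)[OF I] tau_closed[OF QC] DC C_carrier by blast+
    have "inv u \<in> T n" using a(2) subgroup.m_inv_closed[OF submodD(1)[OF T_submod]] by blast
    moreover have "tau n a = y \<otimes> inv u" using a(3) c by (simp add: m_assoc)
    ultimately have "a \<in> L I n" using a(1) y by (simp add: L_def set_multI)
    then have "a \<in> L I' n" using L by blast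
    then obtain x v where x: "x \<in> I'" "v \<in> T n" "tau n a = x \<otimes> v" by (auto simp: L_def set_mult_def)
    have xc: "x \<in> carrier G" "v \<in> carrier G" using x submodD(5)[OF T_submod] submodD(5)[OF I'] by blast+
    have "inv x \<otimes> y \<in> I"
      using x(1) y \<open>I' \<subseteq> I\<close> subgroup.m_closed[OF submodD(1)[OF I]] subgroup.m_inv_closed[OF submodD(1)[OF I]] by blast
    moreover have e: "inv x \<otimes> y = v \<otimes> u" using a(3) x(3) xc c by (simp add: m_assoc)
    moreover have "v \<otimes> u \<in> T n" using x(2) a(2) subgroup.m_closed[OF submodD(1)[OF T_submod]] by blast
    ultimately have "inv x \<otimes> y \<in> I'" using Suc by auto
    then have "x \<otimes> (inv x \<otimes> y) \<in> I'" using x(1) subgroup.m_closed[OF submodD(1)[OF I']] by blast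
    then show "y \<in> I'" using xc c by simp
  qed
qed

text \<open>The coefficient modules form an increasing sequence inside a Noetherian module and so
  become constant from some degree \<open>N\<close> on. Lifts of generators of those in degrees up
  to \<open>N\<close> generate \<open>I\<close>.\<close>

lemma finitely_generated_submod:
  assumes I: "submod Q I" and exh: "\<And>y. y \<in> I \<Longrightarrow> \<exists>m n. tau m y \<in> T n"
  shows "\<exists>E. finite E \<and> E \<subseteq> I \<and> I = conj_span G Q K E"
proof -
  note LS = L_submod[OF I]
  have "submod P (\<Union>n. L I n)" (is "submod P ?U")
  proof -
    have "subgroup (\<Union>n. L I n) G"
    proof (rule subgroupI)
      show "(\<Union>n. L I n) \<subseteq> carrier G" using submodD(5)[OF LS] by blast
      show "(\<Union>n. L I n) \<noteq> {}" using submodD(2)[OF LS] subgroup.one_closed[OF K] by blast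
      show "inv a \<in> (\<Union>n. L I n)" if "a \<in> (\<Union>n. L I n)" for a
        using that subgroup.m_inv_closed[OF submodD(1)[OF LS]] by blast
      fix a b assume "a \<in> (\<Union>n. L I n)" "b \<in> (\<Union>n. L I n)"
      then obtain m n where "a \<in> L I m" "b \<in> L I n" by blast
      then have "a \<in> L I (max m n)" "b \<in> L I (max m n)" using L_mono[OF I] by (meson max.cobounded1 max.cobounded2 subsetD)+
      then show "a \<otimes> b \<in> (\<Union>n. L I n)" using subgroup.m_closed[OF submodD(1)[OF LS]] by blast
    qed
    moreover have "conj_closed G P (\<Union>n. L I n)"
      using conj_closedD[OF submodD(4)[OF LS]] unfolding conj_closed_def by blast
    ultimately show ?thesis using submodD(2,3)[OF LS] unfolding submod_def by blast
  qed
  moreover have LD: "L I n \<subseteq> D" for n by (auto simp: L_def)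
  note ex = noeth[unfolded noetherian_def, rule_format]
  moreover have "?U \<subseteq> D" using LD by blast
  ultimately obtain E where E: "finite E" "E \<subseteq> ?U" "?U = conj_span G P K E"
    using ex[of ?U] by blast
  have "\<exists>N. E \<subseteq> L I N" using E(1,2)
  proof (induction rule: finite_induct)
    case (insert e E)
    then obtain N m where "E \<subseteq> L I N" "e \<in> L I m" by blast
    then have "insert e E \<subseteq> L I (max m N)" using L_mono[OF I, of m "max m N"] L_mono[OF I, of N "max m N"] by auto
    then show ?case by blast
  qed simp
  then obtain N where N: "E \<subseteq> L I N" by blast
  have stable: "L I n \<subseteq> L I N" for n
    using conj_span_le_submod[OF LS N] E(3) by blast
  have "\<forall>n. \<exists>F. finite F \<and> F \<subseteq> L I n \<and> L I n = conj_span G P K F"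
    using ex[OF LS LD] by blast
  then obtain F where F: "\<And>n. finite (F n) \<and> F n \<subseteq> L I n \<and> L I n = conj_span G P K (F n)" by metis
  have "\<forall>n. \<forall>c\<in>F n. \<exists>x\<in>I. \<exists>u\<in>T n. tau n c = x \<otimes> u"
  proof (intro allI ballI)
    fix n c assume "c \<in> F n"
    then have "tau n c \<in> I <#> T n" using F by (auto simp: L_def)
    then show "\<exists>x\<in>I. \<exists>u\<in>T n. tau n c = x \<otimes> u" by (auto simp: set_mult_def)
  qed
  then obtain x where x: "\<And>n c. c \<in> F n \<Longrightarrow> x n c \<in> I \<and> (\<exists>u\<in>T n. tau n c = x n c \<otimes> u)" by metis
  define E' where "E' = (\<Union>n\<le>N. x n ` F n)"
  have E': "finite E'" "E' \<subseteq> I" using F x by (auto simp: E'_def)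
  define I' where "I' = conj_span G Q K E'"
  have I': "submod Q I'"
    unfolding I'_def by (rule submod_conj_span[OF subgroup_generate QK QC]) (use E' submodD(3)[OF I] in blast)
  have I'I: "I' \<subseteq> I" unfolding I'_def by (rule conj_span_le_submod[OF I E'(2)])
  have E'I': "E' \<subseteq> I'"
    unfolding I'_def by (rule conj_span_incl(2)[OF subgroup_generate]) (use E'(2) submodD(5)[OF I] in blast)
  have small: "L I n \<subseteq> L I' n" if "n \<le> N" for n
  proof -
    have "c \<in> L I' n" if c: "c \<in> F n" for c
    proof -
      have "x n c \<in> I'" using c \<open>n \<le> N\<close> E'I' by (auto simp: E'_def)
      moreover have "c \<in> D" using F c by (auto simp: L_def)
      ultimately show ?thesis using x[OF c] by (auto simp: L_def intro!: set_multI)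
    qed
    then have "conj_span G P K (F n) \<subseteq> L I' n" by (intro conj_span_le_submod[OF L_submod[OF I']]) blast
    then show ?thesis using F by blast
  qed
  have "L I n \<subseteq> L I' n" for n
  proof (cases "n \<le> N")
    case False
    then show ?thesis using stable[of n] small[of N] L_mono[OF I', of N n] by auto
  qed (rule small)
  then have T: "I \<inter> T n \<subseteq> I'" for n by (rule Inter_T_subset[OF I I' _ I'I])
  have "I \<subseteq> I'"
  proof
    fix y assume y: "y \<in> I"
    then obtain m n where "tau m y \<in> T n" using exh by blast
    \<comment> \<open>An element of \<open>I\<close> is first made polynomial, then placed in
      \<open>I'\<close>, and the power of \<open>t\<close> is removed again, since \<open>I'\<close>
      is closed under the inverse of \<open>t\<close>.\<close>
    moreover have "tau m y \<in> I" using tau_closed[OF submodD(4)[OF I] y] .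
    ultimately have "tau m y \<in> I'" using T by blast
    then show "y \<in> I'" using tau_cancel[OF I'] y submodD(3)[OF I] by blast
  qed
  then show ?thesis using E' I'I by (intro exI[of _ E']) (auto simp: I'_def)
qed

end

text \<open>It remains to see that every element of the larger span becomes polynomial after
  multiplication by a power of \<open>t\<close>. Such elements form a subgroup, so translates of
  \<open>E\<close> by elements of \<open>Q\<close> decide the matter.\<close>

lemma (in section_extension) noetherian_extension:
  assumes E: "E \<subseteq> C" and noeth: "noetherian P (conj_span G P K E)"
  shows "noetherian Q (conj_span G Q K E)"
proof -
  let ?D = "conj_span G P K E"
  have D: "submod P ?D" by (rule submod_conj_span[OF P PK PC E])
  interpret hilbert_step G K C P t ?D by unfold_locales (fact D, fact noeth)
  have Ec: "E \<subseteq> carrier G" using E C_carrier by blast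
  have S: "subgroup {y \<in> C. \<exists>m n. tau m y \<in> T n} G"
  proof (rule subgroupI)
    show "{y \<in> C. \<exists>m n. tau m y \<in> T n} \<subseteq> carrier G" using C_carrier by blast
    have "tau 0 \<one> \<in> T 0" using subgroup.one_closed[OF K] by (simp add: T_0 tau_def)
    then show "{y \<in> C. \<exists>m n. tau m y \<in> T n} \<noteq> {}" using subgroup.one_closed[OF C] by blast
    fix a assume a: "a \<in> {y \<in> C. \<exists>m n. tau m y \<in> T n}"
    then obtain m n where mn: "a \<in> C" "tau m a \<in> T n" by blast
    have "tau m (inv a) = inv (tau m a)" using C_carrier[OF mn(1)] by (simp add: tau_def word_simps)
    then have "tau m (inv a) \<in> T n" using mn(2) subgroup.m_inv_closed[OF submodD(1)[OF T_submod]] by simp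
    then show "inv a \<in> {y \<in> C. \<exists>m n. tau m y \<in> T n}" using mn(1) subgroup.m_inv_closed[OF C] by blast
    fix b assume b: "b \<in> {y \<in> C. \<exists>m n. tau m y \<in> T n}"
    then obtain k l where kl: "b \<in> C" "tau k b \<in> T l" by blast
    \<comment> \<open>Multiplying both elements by the common power \<open>k + m\<close> raises the
      degree bounds to \<open>k + n\<close> and \<open>m + l\<close>.\<close>
    let ?M = "max (k + n) (m + l)"
    have "tau (k + m) a \<in> T ?M"
      using T_shift[OF mn(2), of k] tau_add[OF mn(1)] T_mono[of "k + n" ?M] by auto
    moreover have "tau (k + m) b \<in> T ?M"
      using T_shift[OF kl(2), of m] tau_add[OF kl(1), of m k] T_mono[of "m + l" ?M] by (auto simp: add.commute)
    ultimately have "tau (k + m) (a \<otimes> b) \<in> T ?M"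
      using tau_mult[OF mn(1) kl(1)] subgroup.m_closed[OF submodD(1)[OF T_submod]] by simp
    then show "a \<otimes> b \<in> {y \<in> C. \<exists>m n. tau m y \<in> T n}"
      using subgroup.m_closed[OF C mn(1) kl(1)] by blast
  qed
  have exh: "conj_span G Q K E \<subseteq> {y \<in> C. \<exists>m n. tau m y \<in> T n}"
  proof (rule conj_span_least[OF S])
    show "K \<subseteq> {y \<in> C. \<exists>m n. tau m y \<in> T n}"
    proof
      fix k assume k: "k \<in> K"
      then have "tau 0 k \<in> T 0" using subgroup.mem_carrier[OF K k] by (simp add: T_0 tau_def)
      then show "k \<in> {y \<in> C. \<exists>m n. tau m y \<in> T n}" using k KC by blast
    qed
    fix g e assume g: "g \<in> Q" and e: "e \<in> E"
    obtain k where "level k g" using g generate_level by blast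
    then obtain p where p: "p \<in> P" "g = t [^] k \<otimes> p" using level_iff by blast
    have c: "e \<in> carrier G" "p \<in> carrier G" using e Ec p P_carrier by blast+
    have gC: "g \<otimes> e \<otimes> inv g \<in> C" using conj_closedD[OF QC g] e E by blast
    define d where "d = p \<otimes> e \<otimes> inv p"
    have d: "d \<in> ?D" unfolding d_def
      using conj_closedD[OF submodD(4)[OF D] p(1)] conj_span_incl(2)[OF P Ec] e by blast
    \<comment> \<open>The least power that clears a negative exponent \<open>k\<close>; the exponent
      that is left is \<open>i\<close>.\<close>
    define m where "m = nat (- k)"
    define i where "i = nat (int m + k)"
    have "t [^] m \<otimes> t [^] k = t [^] (int m + k)" using t by (simp add: int_pow_mult int_pow_int[symmetric])
    also have "int m + k = int i" by (simp add: i_def m_def)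
    finally have ti: "t [^] m \<otimes> t [^] k = t [^] i" by (simp add: int_pow_int)
    have "tau m (g \<otimes> e \<otimes> inv g) = (t [^] m \<otimes> t [^] k) \<otimes> d \<otimes> inv (t [^] m \<otimes> t [^] k)"
      using c t by (simp add: tau_def p(2) d_def word_simps)
    then have "tau m (g \<otimes> e \<otimes> inv g) = tau i d" unfolding ti by (simp add: tau_def)
    moreover have "tau i d \<in> T (Suc i)" using d gens_T[of "Suc i"] by blast
    ultimately have "tau m (g \<otimes> e \<otimes> inv g) \<in> T (Suc i)" by simp
    then show "g \<otimes> e \<otimes> inv g \<in> {y \<in> C. \<exists>m n. tau m y \<in> T n}" using gC by blast
  qed
  show ?thesis
    unfolding noetherian_def
  proof (intro allI impI)
    fix I assume "submod Q I" "I \<subseteq> conj_span G Q K E"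
    then show "\<exists>E'. finite E' \<and> E' \<subseteq> I \<and> I = conj_span G Q K E'"
      using exh by (intro finitely_generated_submod) auto
  qed
qed

text \<open>The coefficients at the start of the chain act trivially on \<open>C/K\<close>, so the
  base case concerns a finitely generated abelian group. Each cyclic step is an instance of the
  basis theorem.\<close>

theorem (in abelian_section) noetherian_pc_chain:
  assumes "pc_chain G N P" and E: "finite E" "E \<subseteq> C"
    and "conj_closed G P C" "conj_closed G P K"
    and N: "\<And>n c. n \<in> N \<Longrightarrow> c \<in> C \<Longrightarrow> n \<otimes> c \<otimes> inv n \<otimes> inv c \<in> K"
  shows "noetherian P (conj_span G P K E)"
  using assms(1,4,5)
proof (induction rule: pc_chain.induct)
  case base
  have KC': "K \<subseteq> carrier G" "E \<subseteq> carrier G" using subgroup.subset[OF C] KC E by auto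
  show ?case
    unfolding noetherian_def
  proof (intro allI impI)
    fix I assume I: "submod N I" "I \<subseteq> conj_span G N K E"
    have pc: "pc_chain G K (generate G (K \<union> E))"
      by (rule pc_chain_central[OF K C KC E]) (use comm E in blast)
    have s: "subgroup (generate G (K \<union> E)) G" "K \<subseteq> generate G (K \<union> E)" using pc_chain_subgroup[OF pc] by auto
    have "conj_span G N K E \<subseteq> generate G (K \<union> E)"
    proof (rule conj_span_least[OF s])
      fix p e assume p: "p \<in> N" and e: "e \<in> E"
      have pc: "p \<in> carrier G" using subgroup.mem_carrier[OF base.hyps p] .
      have "p \<otimes> e \<otimes> inv p \<otimes> inv e \<in> generate G (K \<union> E)" using N[OF p] e E s by blast
      then have "p \<otimes> e \<otimes> inv p \<otimes> inv e \<otimes> e \<in> generate G (K \<union> E)"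
        using e by (blast intro: generate.incl generate.eng)
      then show "p \<otimes> e \<otimes> inv p \<in> generate G (K \<union> E)" using pc e KC' by (simp add: m_assoc subset_iff)
    qed
    then obtain F where F: "finite F" "F \<subseteq> I" "generate G (K \<union> F) = I"
      using pc_chain_max[OF pc submodD(1,2)[OF I(1)]] I(2) by blast
    have Fc: "F \<subseteq> carrier G" using F(2) submodD(5)[OF I(1)] by blast
    have "I \<subseteq> conj_span G N K F"
      unfolding F(3)[symmetric]
      using conj_span_incl[OF base.hyps Fc, of K] conj_span_subgroup[OF subgroup.subset[OF base.hyps] KC'(1) Fc]
      by (intro generate_subgroup_incl) auto
    then have "I = conj_span G N K F" using conj_span_le_submod[OF I(1) F(2)] by blast
    then show "\<exists>F. finite F \<and> F \<subseteq> I \<and> I = conj_span G N K F" using F by blast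
  qed
next
  case (step P t)
  have PP: "subgroup P G" using pc_chain_subgroup[OF step.hyps(1)] by blast
  have PQ: "P \<subseteq> generate G (insert t P)" by (blast intro: generate.incl)
  have tQ: "t \<in> generate G (insert t P)" "inv t \<in> generate G (insert t P)"
    by (blast intro: generate.incl generate.inv)+
  interpret cyclic_extension G P t by (rule cyclic_extensionI) (use step PP in auto)
  have PK': "conj_closed G P K" "conj_closed G P C"
    using step.prems conj_closed_mono[OF _ PQ] by blast+
  interpret section_extension G K C P t
  proof unfold_locales
    show "inv t \<otimes> x \<otimes> t \<in> C" if "x \<in> C" for x
      using conj_closedD[OF step.prems(1) tQ(2) that] step.hyps(2) by simp
    show "inv t \<otimes> x \<otimes> t \<in> K" if "x \<in> K" for x
      using conj_closedD[OF step.prems(2) tQ(2) that] step.hyps(2) by simp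
  qed (use PK' conj_closedD[OF step.prems(1) tQ(1)] conj_closedD[OF step.prems(2) tQ(1)] in auto)
  show ?case by (rule noetherian_extension[OF E(2) step.IH[OF PK'(2,1)]])
qed

text \<open>Over a subgroup of finite index the module is still finitely generated, namely by the
  translates of \<open>E\<close> under coset representatives, and \<open>Q\<close>-submodules are
  \<open>P\<close>-submodules.\<close>

lemma (in abelian_section) noetherian_fin_cover:
  assumes P: "subgroup P G" and Q: "subgroup Q G" "P \<subseteq> Q" and cov: "fin_cover Q P"
    and QC: "conj_closed G Q C" and QK: "conj_closed G Q K"
    and noeth: "\<And>F. finite F \<Longrightarrow> F \<subseteq> C \<Longrightarrow> noetherian P (conj_span G P K F)"
    and E: "finite E" "E \<subseteq> C"
  shows "noetherian Q (conj_span G Q K E)"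
  unfolding noetherian_def
proof (intro allI impI)
  fix I assume I: "submod Q I" "I \<subseteq> conj_span G Q K E"
  obtain S where S: "finite S" "S \<subseteq> Q" "\<forall>p\<in>Q. \<exists>s\<in>S. p \<otimes> inv s \<in> P" using cov by (auto simp: fin_cover_def)
  let ?F = "\<Union>s\<in>S. (\<lambda>e. s \<otimes> e \<otimes> inv s) ` E"
  have F: "finite ?F" "?F \<subseteq> C"
    using S(1,2) E conj_closedD[OF QC] by (auto simp: subset_iff)
  have PK: "conj_closed G P K" "conj_closed G P C" using conj_closed_mono QK QC Q(2) by blast+
  note FS = submod_conj_span[OF P PK F(2)]
  have Qc: "Q \<subseteq> carrier G" using subgroup.subset[OF Q(1)] .
  have Fc: "?F \<subseteq> carrier G" "E \<subseteq> carrier G" using F(2) E(2) subgroup.subset[OF C] by blast+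
  have "conj_span G Q K E \<subseteq> conj_span G P K ?F"
  proof (rule conj_span_least[OF submodD(1,2)[OF FS]])
    fix q e assume q: "q \<in> Q" and e: "e \<in> E"
    obtain s where s: "s \<in> S" "q \<otimes> inv s \<in> P" using S(3) q by blast
    have c: "q \<in> carrier G" "s \<in> carrier G" "e \<in> carrier G" using q s S(2) Qc e Fc by blast+
    have "s \<otimes> e \<otimes> inv s \<in> conj_span G P K ?F" using s e conj_span_incl(2)[OF P Fc(1)] by blast
    then have "(q \<otimes> inv s) \<otimes> (s \<otimes> e \<otimes> inv s) \<otimes> inv (q \<otimes> inv s) \<in> conj_span G P K ?F"
      by (rule conj_closedD[OF submodD(4)[OF FS] s(2)])
    then show "q \<otimes> e \<otimes> inv q \<in> conj_span G P K ?F" using c by (simp add: word_simps)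
  qed
  moreover have "submod P I"
    using submodD[OF I(1)] conj_closed_mono[OF _ Q(2)] unfolding submod_def by blast
  ultimately obtain E' where E': "finite E'" "E' \<subseteq> I" "I = conj_span G P K E'"
    using noeth[OF F, unfolded noetherian_def, rule_format, of I] I(2) by blast
  have "conj_span G P K E' \<subseteq> conj_span G Q K E'"
    unfolding conj_span_def by (rule mono_generate) (use Q(2) in blast)
  then have "I = conj_span G Q K E'" using conj_span_le_submod[OF I(1) E'(2)] E'(3) by blast
  then show "\<exists>E. finite E \<and> E \<subseteq> I \<and> I = conj_span G Q K E" using E' by blast
qed

section \<open>Intersections of finitely generated normal subgroups of a free group\<close>

lemma (in group) commutator_one:
  assumes "a \<in> carrier G" "b \<in> carrier G" "a \<otimes> b = b \<otimes> a"
  shows "a \<otimes> b \<otimes> inv a \<otimes> inv b = \<one>"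
  unfolding assms(3) using assms(1,2) by (simp add: m_assoc)

lemma (in group) normal_Int:
  assumes "U \<lhd> G" "V \<lhd> G"
  shows "U \<inter> V \<lhd> G"
  unfolding normal_inv_iff
  using subgroups_Inter_pair[OF assms[THEN normal_imp_subgroup]] normal_conjD(1)[OF assms(1)]
    normal_conjD(1)[OF assms(2)] by blast

text \<open>Since \<open>V\<close> is finitely generated modulo \<open>U \<inter> V\<close>, finitely many relators make \<open>\<langle>W\<rangle>\<close> normal and
  centralised by the normal generators of \<open>U\<close>, hence by all of \<open>U\<close>.\<close>

lemma (in group) commutator_relators:
  assumes Y: "finite Y" "Y \<subseteq> carrier G" "generate G Y = carrier G"
    and RU: "finite RU" "RU \<subseteq> carrier G" and U: "U = normal_closure G RU"
    and RV: "finite RV" "RV \<subseteq> carrier G" and V: "V = normal_closure G RV"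
    and W: "finite W" "W \<subseteq> V" and gen: "generate G (W \<union> (U \<inter> V)) = V"
  shows "\<exists>Z. finite Z \<and> Z \<subseteq> U \<inter> V \<and>
    (\<forall>u\<in>U. \<forall>v\<in>V. u \<otimes> v \<otimes> inv u \<otimes> inv v \<in> normal_closure G Z)"
proof -
  have nU: "U \<lhd> G" and nV: "V \<lhd> G" using normal_closure_normal RU RV U V by auto
  note sU = normal_imp_subgroup[OF nU] and sV = normal_imp_subgroup[OF nV]
  have nR: "U \<inter> V \<lhd> G" by (rule normal_Int[OF nU nV])
  note sR = normal_imp_subgroup[OF nR]
  note Uc = subgroup.mem_carrier[OF sU] and Vc = subgroup.mem_carrier[OF sV]
  have Wc: "W \<subseteq> carrier G" using W Vc by blast
  have sW: "subgroup (generate G W) G" by (rule generate_is_subgroup[OF Wc])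
  have "\<exists>w\<in>generate G W. inv w \<otimes> v \<in> U \<inter> V" if v: "v \<in> V" for v
  proof -
    note pr = subgroup_product[OF sW sR normal_conjD(1)[OF nR subgroup.mem_carrier[OF sW]]]
    have "generate G (W \<union> (U \<inter> V)) \<subseteq> generate G W <#> (U \<inter> V)"
      using pr(2,3) generate.incl[of _ W G] by (intro generate_subgroup_incl[OF _ pr(1)]) blast
    then obtain w r where wr: "w \<in> generate G W" "r \<in> U \<inter> V" "v = w \<otimes> r"
      using v gen by (auto simp: set_mult_def)
    then have "inv w \<otimes> v = r" using subgroup.mem_carrier[OF sW wr(1)] subgroup.mem_carrier[OF sR wr(2)] by simp
    then show ?thesis using wr by blast
  qed
  then obtain w where w: "\<And>v. v \<in> V \<Longrightarrow> w v \<in> generate G W \<and> inv (w v) \<otimes> v \<in> U \<inter> V" by metis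
  define A where "A = (\<lambda>(y, v). y \<otimes> v \<otimes> inv y) ` (Y \<times> W) \<union> (\<lambda>(y, v). inv y \<otimes> v \<otimes> y) ` (Y \<times> W) \<union> RV"
  \<comment> \<open>The first family lets the normal generators of \<open>U\<close> commute with
    \<open>W\<close>. The second equates each element of \<open>A\<close> with a word in
    \<open>W\<close>: conjugates of \<open>W\<close> give normality of \<open>?B\<close>, and the
    members \<open>RV\<close> of \<open>A\<close> put \<open>V\<close> inside it.\<close>
  define Z where "Z = (\<lambda>(u, v). u \<otimes> v \<otimes> inv u \<otimes> inv v) ` (RU \<times> W) \<union> (\<lambda>v. inv (w v) \<otimes> v) ` A"
  have RUU: "RU \<subseteq> U" and RVV: "RV \<subseteq> V" unfolding U V by (rule normal_closure_incl)+
  have AV: "A \<subseteq> V"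
    using normal_conjD[OF nV] W(2) Y(2) RVV unfolding A_def by (auto simp: subset_iff)
  have cm: "u \<otimes> v \<otimes> inv u \<otimes> inv v \<in> U \<inter> V" if u: "u \<in> U" and v: "v \<in> V" for u v
  proof
    have c: "u \<in> carrier G" "v \<in> carrier G" using u v Uc Vc by auto
    have "u \<otimes> (v \<otimes> inv u \<otimes> inv v) \<in> U"
      using u normal_conjD(1)[OF nU c(2)] subgroup.m_closed[OF sU] subgroup.m_inv_closed[OF sU] by blast
    then show "u \<otimes> v \<otimes> inv u \<otimes> inv v \<in> U" using c by (simp add: m_assoc)
    show "u \<otimes> v \<otimes> inv u \<otimes> inv v \<in> V"
      using v normal_conjD(1)[OF nV c(1) v] subgroup.m_closed[OF sV] subgroup.m_inv_closed[OF sV] by blast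
  qed
  have ZR: "Z \<subseteq> U \<inter> V"
    unfolding Z_def
  proof (intro Un_least image_subsetI)
    fix p assume "p \<in> RU \<times> W"
    then show "(case p of (u, v) \<Rightarrow> u \<otimes> v \<otimes> inv u \<otimes> inv v) \<in> U \<inter> V"
      using cm[of "fst p" "snd p"] RUU W(2) by (auto simp: case_prod_beta subset_iff)
  next
    fix v assume "v \<in> A"
    then show "inv (w v) \<otimes> v \<in> U \<inter> V" using w[OF subsetD[OF AV]] by blast
  qed
  have "finite A" unfolding A_def using Y W RV by simp
  then have fin: "finite Z" unfolding Z_def using RU W by simp
  let ?R = "normal_closure G Z"
  have Zc: "Z \<subseteq> carrier G" using ZR Uc by blast
  have nR0: "?R \<lhd> G" by (rule normal_closure_normal[OF Zc])
  note sR0 = normal_imp_subgroup[OF nR0]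
  note R0c = subgroup.mem_carrier[OF sR0]
  have ZR0: "Z \<subseteq> ?R" by (rule normal_closure_incl)
  have R0R: "?R \<subseteq> U \<inter> V" by (rule normal_closure_least[OF nR ZR])
  let ?B = "generate G (W \<union> ?R)"
  have Bc: "W \<union> ?R \<subseteq> carrier G" using Wc R0c by blast
  have sB: "subgroup ?B G" by (rule generate_is_subgroup[OF Bc])
  have WB: "generate G W \<subseteq> ?B" by (rule mono_generate) blast
  have R0B: "?R \<subseteq> ?B" by (blast intro: generate.incl)
  have AB: "a \<in> ?B" if a: "a \<in> A" for a
  proof -
    have wa: "w a \<in> generate G W" using w[OF subsetD[OF AV a]] by blast
    then have "w a \<in> ?B" using WB by blast
    moreover have "inv (w a) \<otimes> a \<in> ?B" using a ZR0 R0B unfolding Z_def by blast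
    ultimately have "w a \<otimes> (inv (w a) \<otimes> a) \<in> ?B" using subgroup.m_closed[OF sB] by blast
    moreover have "w a \<in> carrier G" "a \<in> carrier G"
      using subgroup.mem_carrier[OF sW wa] Vc[OF subsetD[OF AV a]] .
    ultimately show ?thesis by simp
  qed
  have "?B \<lhd> G"
  proof (rule normal_generateI'[OF Y(2,3) Bc])
    fix y e assume y: "y \<in> Y" and e: "e \<in> W \<union> ?R"
    have yc: "y \<in> carrier G" using y Y by blast
    show "y \<otimes> e \<otimes> inv y \<in> ?B"
    proof (cases "e \<in> ?R")
      case True
      then show ?thesis using normal_conjD(1)[OF nR0 yc] R0B by blast
    next
      case False
      then have "y \<otimes> e \<otimes> inv y \<in> A" using y e by (auto simp: A_def)
      then show ?thesis by (rule AB)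
    qed
    show "inv y \<otimes> e \<otimes> y \<in> ?B"
    proof (cases "e \<in> ?R")
      case True
      then show ?thesis using normal_conjD(2)[OF nR0 yc] R0B by blast
    next
      case False
      then have "inv y \<otimes> e \<otimes> y \<in> A" using y e by (auto simp: A_def)
      then show ?thesis by (rule AB)
    qed
  qed
  moreover have "RV \<subseteq> ?B" using AB by (auto simp: A_def)
  ultimately have VB: "V \<subseteq> ?B" unfolding V by (rule normal_closure_least)
  \<comment> \<open>The centraliser of \<open>V\<close> modulo \<open>?R\<close> is normal because
    \<open>V\<close> and \<open>?R\<close> are. It therefore contains \<open>U\<close> as soon as it
    contains \<open>RU\<close>.\<close>
  define Cent where "Cent = {g \<in> carrier G. \<forall>v\<in>V. g \<otimes> v \<otimes> inv g \<otimes> inv v \<in> ?R}"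
  have "RU \<subseteq> Cent"
  proof
    fix u assume u: "u \<in> RU"
    have uc: "u \<in> carrier G" using u RU by blast
    have "W \<union> ?R \<subseteq> {m \<in> V. u \<otimes> m \<otimes> inv u \<otimes> inv m \<in> ?R}"
    proof
      fix m assume m: "m \<in> W \<union> ?R"
      have "u \<otimes> m \<otimes> inv u \<otimes> inv m \<in> ?R"
      proof (cases "m \<in> ?R")
        case True
        then show ?thesis
          using normal_conjD(1)[OF nR0 uc True] subgroup.m_closed[OF sR0] subgroup.m_inv_closed[OF sR0] by blast
      next
        case False
        then have "u \<otimes> m \<otimes> inv u \<otimes> inv m \<in> Z" using m u by (auto simp: Z_def)
        then show ?thesis using ZR0 by blast
      qed
      then show "m \<in> {m \<in> V. u \<otimes> m \<otimes> inv u \<otimes> inv m \<in> ?R}" using m W(2) R0R by blast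
    qed
    then have "?B \<subseteq> {m \<in> V. u \<otimes> m \<otimes> inv u \<otimes> inv m \<in> ?R}"
      by (rule generate_subgroup_incl)
        (rule subgroup_centralizer_mod[OF sR0 sV normal_conjD(1)[OF nR0 Vc] uc])
    then show "u \<in> Cent" using VB uc by (auto simp: Cent_def)
  qed
  moreover have "Cent \<lhd> G"
    unfolding normal_inv_iff
  proof
    show "subgroup Cent G"
    proof (rule subgroupI)
      show "Cent \<subseteq> carrier G" by (auto simp: Cent_def)
      have "\<one> \<in> Cent" using Vc subgroup.one_closed[OF sR0] by (simp add: Cent_def)
      then show "Cent \<noteq> {}" by blast
      fix a assume a: "a \<in> Cent"
      then have ac: "a \<in> carrier G" by (simp add: Cent_def)
      have "inv a \<otimes> v \<otimes> inv (inv a) \<otimes> inv v \<in> ?R" if v: "v \<in> V" for v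
      proof -
        have v': "inv a \<otimes> v \<otimes> a \<in> V" by (rule normal_conjD(2)[OF nV ac v])
        then have "inv (a \<otimes> (inv a \<otimes> v \<otimes> a) \<otimes> inv a \<otimes> inv (inv a \<otimes> v \<otimes> a)) \<in> ?R"
          using a subgroup.m_inv_closed[OF sR0] by (auto simp: Cent_def)
        then show ?thesis using ac Vc[OF v] by (simp add: word_simps)
      qed
      then show "inv a \<in> Cent" using ac by (simp add: Cent_def)
      fix b assume b: "b \<in> Cent"
      then have bc: "b \<in> carrier G" by (simp add: Cent_def)
      have "a \<otimes> b \<otimes> v \<otimes> inv (a \<otimes> b) \<otimes> inv v \<in> ?R" if v: "v \<in> V" for v
      proof -
        have v': "b \<otimes> v \<otimes> inv b \<in> V" by (rule normal_conjD(1)[OF nV bc v])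
        have "(a \<otimes> (b \<otimes> v \<otimes> inv b) \<otimes> inv a \<otimes> inv (b \<otimes> v \<otimes> inv b)) \<otimes> (b \<otimes> v \<otimes> inv b \<otimes> inv v) \<in> ?R"
          using a b v v' subgroup.m_closed[OF sR0] by (auto simp: Cent_def)
        then show ?thesis using ac bc Vc[OF v] by (simp add: word_simps)
      qed
      then show "a \<otimes> b \<in> Cent" using ac bc by (simp add: Cent_def)
    qed
    show "\<forall>x\<in>carrier G. \<forall>h\<in>Cent. x \<otimes> h \<otimes> inv x \<in> Cent"
    proof (intro ballI)
      fix g a assume g: "g \<in> carrier G" and a: "a \<in> Cent"
      have ac: "a \<in> carrier G" using a by (simp add: Cent_def)
      have "(g \<otimes> a \<otimes> inv g) \<otimes> v \<otimes> inv (g \<otimes> a \<otimes> inv g) \<otimes> inv v \<in> ?R" if v: "v \<in> V" for v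
      proof -
        have v': "inv g \<otimes> v \<otimes> g \<in> V" by (rule normal_conjD(2)[OF nV g v])
        have "a \<otimes> (inv g \<otimes> v \<otimes> g) \<otimes> inv a \<otimes> inv (inv g \<otimes> v \<otimes> g) \<in> ?R" using a v' by (auto simp: Cent_def)
        from normal_conjD(1)[OF nR0 g this] show ?thesis using ac g Vc[OF v] by (simp add: word_simps)
      qed
      then show "g \<otimes> a \<otimes> inv g \<in> Cent" using g ac by (simp add: Cent_def)
    qed
  qed
  ultimately have "U \<subseteq> Cent" unfolding U by (intro normal_closure_least)
  then have "\<forall>u\<in>U. \<forall>v\<in>V. u \<otimes> v \<otimes> inv u \<otimes> inv v \<in> ?R" by (auto simp: Cent_def)
  then show ?thesis using fin ZR by blast
qed

section \<open>The pullback attached to two normal subgroups, as a module for the diagonal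
  action\<close>

locale normal_pair = group F for F (structure) +
  fixes U V
  assumes nU: "U \<lhd> F" and nV: "V \<lhd> F"
begin

lemmas sU = normal_imp_subgroup[OF nU] and sV = normal_imp_subgroup[OF nV]
lemmas Uc = subgroup.mem_carrier[OF sU] and Vc = subgroup.mem_carrier[OF sV]

abbreviation FF where "FF \<equiv> F \<times>\<times> F"

sublocale FF: group FF
  by (rule DirProd_group) (rule group_axioms)+

lemma inv_FF [simp]: "a \<in> carrier F \<Longrightarrow> b \<in> carrier F \<Longrightarrow> inv\<^bsub>FF\<^esub> (a, b) = (inv a, inv b)"
  by (simp add: group_axioms)

definition "C = {(u, m). u \<in> U \<and> m \<in> carrier F \<and> inv u \<otimes> m \<in> V}"

lemma C_I: "u \<in> U \<Longrightarrow> m \<in> carrier F \<Longrightarrow> inv u \<otimes> m \<in> V \<Longrightarrow> (u, m) \<in> C" by (simp add: C_def)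

lemma C_mem:
  assumes "(u, m) \<in> C"
  shows "u \<in> U" "u \<in> carrier F" "m \<in> carrier F" "inv u \<otimes> m \<in> V" "m \<in> U <#> V"
proof -
  show 1: "u \<in> U" "u \<in> carrier F" "m \<in> carrier F" "inv u \<otimes> m \<in> V" using assms Uc by (auto simp: C_def)
  have "u \<otimes> (inv u \<otimes> m) \<in> U <#> V" by (rule set_multI[OF 1(1,4)])
  then show "m \<in> U <#> V" using 1 by simp
qed

lemma C_subgroup: "subgroup C FF"
proof (rule FF.subgroupI)
  show "C \<subseteq> carrier FF" using C_mem by auto
  have "(\<one>, \<one>) \<in> C" using subgroup.one_closed[OF sU] subgroup.one_closed[OF sV] by (simp add: C_def)
  then show "C \<noteq> {}" by blast
  fix a assume "a \<in> C"
  then obtain u m where a: "a = (u, m)" "(u, m) \<in> C" by (cases a) auto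
  note c = C_mem[OF a(2)]
  have "u \<otimes> inv (inv u \<otimes> m) \<otimes> inv u \<in> V"
    using normal_conjD(1)[OF nV c(2)] c(4) subgroup.m_inv_closed[OF sV] by blast
  then have "inv (inv u) \<otimes> inv m \<in> V" using c by (simp add: word_simps)
  then have "(inv u, inv m) \<in> C" using c subgroup.m_inv_closed[OF sU] by (simp add: C_def)
  then show "inv\<^bsub>FF\<^esub> a \<in> C" using a c by simp
  fix b assume "b \<in> C"
  then obtain v n where b: "b = (v, n)" "(v, n) \<in> C" by (cases b) auto
  note d = C_mem[OF b(2)]
  have "(inv v \<otimes> (inv u \<otimes> m) \<otimes> v) \<otimes> (inv v \<otimes> n) \<in> V"
    using normal_conjD(2)[OF nV d(2)] c(4) d(4) subgroup.m_closed[OF sV] by blast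
  then have "inv (u \<otimes> v) \<otimes> (m \<otimes> n) \<in> V" using c d by (simp add: word_simps)
  then show "a \<otimes>\<^bsub>FF\<^esub> b \<in> C" using a b c d subgroup.m_closed[OF sU] by (simp add: C_def)
qed

lemma left_C: "z \<in> U \<inter> V \<Longrightarrow> (z, \<one>) \<in> C"
  using subgroup.m_inv_closed[OF sV] Uc by (auto simp: C_def)

lemma UV_subgroup: "subgroup (U <#> V) F"
  by (rule subgroup_product(1)[OF sU sV normal_conjD(1)[OF nV Uc]])

end

text \<open>\<open>C\<close> is the pullback of \<open>U/R\<^sub>0 \<rightarrow> UV/V\<close> along \<open>UV \<rightarrow> UV/V\<close>, a central extension of \<open>UV\<close> modulo \<open>R\<^sub>0\<close>.
  Its splitting \<open>\<alpha>\<close> embeds \<open>(U \<inter> V)/R\<^sub>0\<close> into the abelianisation of \<open>C\<close>, a finitely generated module.\<close>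

locale split_square = normal_pair +
  fixes R0 \<alpha>
  assumes nR0: "R0 \<lhd> F" and R0: "R0 \<subseteq> U \<inter> V"
    and UV: "\<And>u v. u \<in> U \<Longrightarrow> v \<in> V \<Longrightarrow> u \<otimes> v \<otimes> inv u \<otimes> inv v \<in> R0"
    and \<alpha>_mult: "\<And>m n. m \<in> U <#> V \<Longrightarrow> n \<in> U <#> V \<Longrightarrow> \<alpha> (m \<otimes> n) = \<alpha> m \<otimes> \<alpha> n"
    and \<alpha>U: "\<And>m. m \<in> U <#> V \<Longrightarrow> \<alpha> m \<in> U" and \<alpha>V: "\<And>m. m \<in> U <#> V \<Longrightarrow> inv (\<alpha> m) \<otimes> m \<in> V"
begin

lemmas sR0 = normal_imp_subgroup[OF nR0]
lemmas R0c = subgroup.mem_carrier[OF sR0]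

text \<open>Elements of the first copy of \<open>R0\<close> and all commutators of \<open>C\<close>,
  so that \<open>C/K\<close> is the abelianisation of \<open>C\<close> modulo
  \<open>R0\<close>.\<close>

definition "gens = (\<lambda>z. (z, \<one>)) ` R0 \<union>
  {x. \<exists>c\<in>C. \<exists>d\<in>C. x = c \<otimes>\<^bsub>FF\<^esub> d \<otimes>\<^bsub>FF\<^esub> inv\<^bsub>FF\<^esub> c \<otimes>\<^bsub>FF\<^esub> inv\<^bsub>FF\<^esub> d}"
definition "K = generate FF gens"

lemma gens_C: "gens \<subseteq> C"
proof -
  have "c \<otimes>\<^bsub>FF\<^esub> d \<otimes>\<^bsub>FF\<^esub> inv\<^bsub>FF\<^esub> c \<otimes>\<^bsub>FF\<^esub> inv\<^bsub>FF\<^esub> d \<in> C" if "c \<in> C" "d \<in> C" for c d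
    using that subgroup.m_closed[OF C_subgroup] subgroup.m_inv_closed[OF C_subgroup] by blast
  then show ?thesis using left_C R0 unfolding gens_def by blast
qed

lemma gens_carrier: "gens \<subseteq> carrier FF" using gens_C subgroup.subset[OF C_subgroup] by blast

lemma K_subgroup: "subgroup K FF" unfolding K_def by (rule FF.generate_is_subgroup[OF gens_carrier])

lemma gens_K: "gens \<subseteq> K" unfolding K_def by (blast intro: generate.incl)

sublocale sec: abelian_section FF K C
proof (intro abelian_section.intro abelian_section_axioms.intro)
  show "K \<subseteq> C" unfolding K_def by (rule FF.generate_subgroup_incl[OF gens_C C_subgroup])
  show "c \<otimes>\<^bsub>FF\<^esub> d \<otimes>\<^bsub>FF\<^esub> inv\<^bsub>FF\<^esub> c \<otimes>\<^bsub>FF\<^esub> inv\<^bsub>FF\<^esub> d \<in> K" if "c \<in> C" "d \<in> C" for c d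
    using that gens_K unfolding gens_def by blast
qed (rule FF.group_axioms K_subgroup C_subgroup)+

text \<open>Since \<open>(\<alpha> m, m)\<close> also lies in \<open>C\<close>, dividing by it
  leaves a first coordinate in \<open>U \<inter> V\<close>. On pairs \<open>(z, \<one>)\<close> this
  returns \<open>z\<close>, so \<open>\<rho>\<close> is the retraction belonging to the
  splitting.\<close>

definition "\<rho> = (\<lambda>(u, m). u \<otimes> inv (\<alpha> m))"

lemma \<rho>:
  assumes "c \<in> C"
  shows "\<rho> c \<in> U" "\<rho> c \<in> V" "\<rho> c \<in> carrier F"
proof -
  obtain u m where um: "c = (u, m)" "(u, m) \<in> C" using assms by (cases c) auto
  note d = C_mem[OF um(2)]
  have a: "\<alpha> m \<in> U" "\<alpha> m \<in> carrier F" "inv (\<alpha> m) \<otimes> m \<in> V" using \<alpha>U \<alpha>V d(5) Uc by auto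
  show U: "\<rho> c \<in> U" using d(1) a(1) subgroup.m_closed[OF sU] subgroup.m_inv_closed[OF sU] by (simp add: um \<rho>_def)
  have "(u \<otimes> inv (inv u \<otimes> m) \<otimes> inv u) \<otimes> (\<alpha> m \<otimes> (inv (\<alpha> m) \<otimes> m) \<otimes> inv (\<alpha> m)) \<in> V"
    using normal_conjD(1)[OF nV d(2)] normal_conjD(1)[OF nV a(2)] a(3) d(4)
      subgroup.m_closed[OF sV] subgroup.m_inv_closed[OF sV] by blast
  then show "\<rho> c \<in> V" using d a by (simp add: um \<rho>_def word_simps)
  show "\<rho> c \<in> carrier F" using U Uc by blast
qed

lemma comm_R0:
  assumes "u \<in> U" "v \<in> V" "g \<in> carrier F"
  shows "g \<otimes> (u \<otimes> v \<otimes> inv u \<otimes> inv v) \<otimes> inv g \<in> R0"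
  by (rule normal_conjD(1)[OF nR0 assms(3) UV[OF assms(1,2)]])

text \<open>Modulo \<open>R\<^sub>0\<close>, \<open>\<rho>\<close> is a homomorphism onto the abelian group \<open>(U \<inter> V)/R\<^sub>0\<close>.\<close>

lemma \<rho>_K:
  assumes "c \<in> K"
  shows "\<rho> c \<in> R0"
proof -
  interpret R0: normal R0 F by (rule nR0)
  define h where "h c = R0 #> \<rho> c" for c
  let ?C = "FF\<lparr>carrier := C\<rparr>"
  have eq: "R0 #> a = R0 #> b" if "a \<otimes> inv b \<in> R0" "a \<in> carrier F" "b \<in> carrier F" for a b
    using that repr_independence[of a R0 b] R0.rcos_module_rev[OF group_axioms that(3,2)] sR0 by blast
  have hom: "h \<in> hom ?C (F Mod R0)"
  proof (rule homI)
    fix c assume "c \<in> carrier ?C"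
    then show "h c \<in> carrier (F Mod R0)" using \<rho>(3) by (simp add: carrier_FactGroup h_def)
  next
    fix c d assume "c \<in> carrier ?C" "d \<in> carrier ?C"
    then have cd: "c \<in> C" "d \<in> C" by auto
    obtain u m where um: "c = (u, m)" "(u, m) \<in> C" using cd by (cases c) auto
    obtain v n where vn: "d = (v, n)" "(v, n) \<in> C" using cd by (cases d) auto
    note e = C_mem[OF um(2)] C_mem[OF vn(2)]
    have a: "\<alpha> m \<in> carrier F" "\<alpha> n \<in> carrier F" "\<alpha> m \<in> U" using \<alpha>U e Uc by auto
    \<comment> \<open>The conjugation by \<open>\<alpha> m\<close> disappears modulo
      \<open>R0\<close>, because \<open>\<alpha> m\<close> lies in \<open>U\<close> and
      \<open>\<rho> d\<close> in \<open>V\<close>.\<close>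
    have r: "\<rho> (c \<otimes>\<^bsub>FF\<^esub> d) = \<rho> c \<otimes> (\<alpha> m \<otimes> \<rho> d \<otimes> inv (\<alpha> m))"
      using e a by (simp add: um vn \<rho>_def \<alpha>_mult word_simps)
    have "\<rho> c \<otimes> (\<alpha> m \<otimes> \<rho> d \<otimes> inv (\<alpha> m) \<otimes> inv (\<rho> d)) \<otimes> inv (\<rho> c) \<in> R0"
      by (rule comm_R0) (use \<rho> cd a in auto)
    then have "\<rho> (c \<otimes>\<^bsub>FF\<^esub> d) \<otimes> inv (\<rho> c \<otimes> \<rho> d) \<in> R0"
      unfolding r using \<rho>(3) cd a by (simp add: word_simps)
    then have "R0 #> \<rho> (c \<otimes>\<^bsub>FF\<^esub> d) = R0 #> (\<rho> c \<otimes> \<rho> d)"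
      using \<rho>(3) cd subgroup.m_closed[OF C_subgroup cd] by (intro eq) auto
    also have "\<dots> = (R0 #> \<rho> c) <#> (R0 #> \<rho> d)" using R0.rcos_sum \<rho>(3) cd by simp
    finally show "h (c \<otimes>\<^bsub>?C\<^esub> d) = h c \<otimes>\<^bsub>F Mod R0\<^esub> h d" by (simp add: h_def)
  qed
  interpret hh: group_hom ?C "F Mod R0" h
    using hom FF.subgroup_imp_group[OF C_subgroup] R0.factorgroup_is_group
    by (simp add: group_hom_def group_hom_axioms_def)
  have ab: "h c \<otimes>\<^bsub>F Mod R0\<^esub> h d = h d \<otimes>\<^bsub>F Mod R0\<^esub> h c" if "c \<in> C" "d \<in> C" for c d
  proof -
    \<comment> \<open>Values of \<open>\<rho>\<close> lie in both \<open>U\<close> and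
      \<open>V\<close>, so one may be regarded as an element of \<open>U\<close> and the other as
      one of \<open>V\<close>.\<close>
    have "\<rho> c \<otimes> \<rho> d \<otimes> inv (\<rho> c) \<otimes> inv (\<rho> d) \<in> R0" by (rule UV) (use \<rho> that in auto)
    then have "R0 #> (\<rho> c \<otimes> \<rho> d) = R0 #> (\<rho> d \<otimes> \<rho> c)"
      using \<rho>(3) that by (intro eq) (simp_all add: word_simps)
    then show ?thesis using R0.rcos_sum \<rho>(3) that by (simp add: h_def)
  qed
  have "gens \<subseteq> kernel ?C (F Mod R0) h"
  proof
    fix x assume x: "x \<in> gens"
    then have xC: "x \<in> C" using gens_C by blast
    have "h x = \<one>\<^bsub>F Mod R0\<^esub>"
    proof (cases "x \<in> (\<lambda>z. (z, \<one>)) ` R0")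
      case True
      then obtain z where z: "z \<in> R0" "x = (z, \<one>)" by blast
      have oUV: "\<one> \<in> U <#> V" using C_mem(5)[OF left_C] subgroup.one_closed[OF sU] subgroup.one_closed[OF sV] by blast
      have "\<alpha> \<one> \<in> carrier F" using \<alpha>U[OF oUV] Uc by blast
      moreover have "\<alpha> \<one> \<otimes> \<alpha> \<one> = \<alpha> \<one>" using \<alpha>_mult[OF oUV oUV] by simp
      ultimately have "\<alpha> \<one> = \<one>" by simp
      then have "\<rho> x = z" using z R0c by (simp add: \<rho>_def)
      then show ?thesis using z coset_join2[OF R0c[OF z(1)] sR0 z(1)] by (simp add: h_def)
    next
      case False
      then obtain c d where cd: "c \<in> C" "d \<in> C" "x = c \<otimes>\<^bsub>FF\<^esub> d \<otimes>\<^bsub>FF\<^esub> inv\<^bsub>FF\<^esub> c \<otimes>\<^bsub>FF\<^esub> inv\<^bsub>FF\<^esub> d"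
        using x unfolding gens_def by blast
      have inv: "inv\<^bsub>FF\<^esub> c = inv\<^bsub>?C\<^esub> c" "inv\<^bsub>FF\<^esub> d = inv\<^bsub>?C\<^esub> d"
        using FF.m_inv_consistent[OF C_subgroup] cd by auto
      have cc: "c \<in> carrier ?C" "d \<in> carrier ?C" using cd by auto
      have "x = c \<otimes>\<^bsub>?C\<^esub> d \<otimes>\<^bsub>?C\<^esub> inv\<^bsub>?C\<^esub> c \<otimes>\<^bsub>?C\<^esub> inv\<^bsub>?C\<^esub> d" using cd(3) inv by simp
      also have "h \<dots> = h c \<otimes>\<^bsub>F Mod R0\<^esub> h d \<otimes>\<^bsub>F Mod R0\<^esub> inv\<^bsub>F Mod R0\<^esub> h c \<otimes>\<^bsub>F Mod R0\<^esub> inv\<^bsub>F Mod R0\<^esub> h d"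
        using cc by (simp only: hh.hom_mult hh.hom_inv hh.G.inv_closed hh.G.m_closed)
      also have "\<dots> = \<one>\<^bsub>F Mod R0\<^esub>"
        by (rule hh.H.commutator_one[OF hh.hom_closed[OF cc(1)] hh.hom_closed[OF cc(2)] ab[OF cd(1,2)]])
      finally show ?thesis .
    qed
    then show "x \<in> kernel ?C (F Mod R0) h" using xC by (simp add: kernel_def)
  qed
  moreover have "subgroup (kernel ?C (F Mod R0) h) FF"
    using FF.incl_subgroup[OF C_subgroup hh.subgroup_kernel] .
  ultimately have "K \<subseteq> kernel ?C (F Mod R0) h" unfolding K_def by (intro FF.generate_subgroup_incl)
  then have c: "c \<in> C" "R0 #> \<rho> c = R0" using assms by (auto simp: kernel_def h_def)
  show ?thesis using coset_join1[OF c(2) \<rho>(3)[OF c(1)] sR0] .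
qed

text \<open>This is the injectivity of the embedding of \<open>U \<inter> V\<close> modulo
  \<open>R0\<close> into \<open>C/K\<close>: \<open>\<rho>\<close> maps \<open>K\<close> into
  \<open>R0\<close> and fixes the first coordinate here because
  \<open>\<alpha> \<one> = \<one>\<close>.\<close>

lemma K_left:
  assumes "(z, \<one>) \<in> K"
  shows "z \<in> R0"
proof -
  have zC: "(z, \<one>) \<in> C" using assms sec.KC by blast
  note c = C_mem[OF zC]
  have "\<alpha> \<one> \<in> carrier F" using \<alpha>U[OF c(5)] Uc by blast
  moreover have "\<alpha> \<one> \<otimes> \<alpha> \<one> = \<alpha> \<one>" using \<alpha>_mult[OF c(5,5)] by simp
  ultimately have "\<alpha> \<one> = \<one>" by simp
  then show ?thesis using \<rho>_K[OF assms] c by (simp add: \<rho>_def)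
qed

text \<open>The free group acts on \<open>C\<close> by conjugating both coordinates, that is,
  through its diagonal copy.\<close>

definition "\<delta> f = (f, f)"

lemma \<delta>_hom: "group_hom F FF \<delta>"
  using FF.group_axioms group_axioms by (simp add: group_hom_def group_hom_axioms_def hom_def \<delta>_def)

abbreviation "\<Delta> \<equiv> \<delta> ` carrier F"

lemma \<Delta>_subgroup: "subgroup \<Delta> FF" using group_hom.img_is_subgroup[OF \<delta>_hom] .

lemma \<Delta>_C: "conj_closed FF \<Delta> C"
  unfolding conj_closed_def
proof (intro ballI)
  fix p c assume "p \<in> \<Delta>" "c \<in> C"
  then obtain f u m where f: "f \<in> carrier F" "p = (f, f)" "c = (u, m)" "(u, m) \<in> C" by (cases c) (auto simp: \<delta>_def)
  note c = C_mem[OF f(4)]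
  have "f \<otimes> (inv u \<otimes> m) \<otimes> inv f \<in> V" by (rule normal_conjD(1)[OF nV f(1) c(4)])
  then have "inv (f \<otimes> u \<otimes> inv f) \<otimes> (f \<otimes> m \<otimes> inv f) \<in> V" using f c by (simp add: word_simps)
  then show "p \<otimes>\<^bsub>FF\<^esub> c \<otimes>\<^bsub>FF\<^esub> inv\<^bsub>FF\<^esub> p \<in> C"
    using f c normal_conjD(1)[OF nU f(1) c(1)] by (simp add: C_def)
qed

lemma \<Delta>_left:
  assumes "B \<lhd> F"
  shows "conj_closed FF \<Delta> ((\<lambda>z. (z, \<one>)) ` B)"
proof -
  have "f \<otimes> z \<otimes> inv f \<in> B" if "f \<in> carrier F" "z \<in> B" for f z using normal_conjD(1)[OF assms that] .
  then show ?thesis by (auto simp: conj_closed_def \<delta>_def)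
qed

lemma \<Delta>_K: "conj_closed FF \<Delta> K"
  unfolding K_def
proof (rule FF.conj_closed_generate[OF \<Delta>_subgroup gens_carrier])
  fix p e assume p: "p \<in> \<Delta>" and e: "e \<in> gens"
  have pc: "p \<in> carrier FF" using p subgroup.subset[OF \<Delta>_subgroup] by blast
  have "p \<otimes>\<^bsub>FF\<^esub> e \<otimes>\<^bsub>FF\<^esub> inv\<^bsub>FF\<^esub> p \<in> gens"
  proof (cases "e \<in> (\<lambda>z. (z, \<one>)) ` R0")
    case True
    then show ?thesis using conj_closedD[OF \<Delta>_left[OF nR0] p] unfolding gens_def by blast
  next
    case False
    then obtain c d where cd: "c \<in> C" "d \<in> C" "e = c \<otimes>\<^bsub>FF\<^esub> d \<otimes>\<^bsub>FF\<^esub> inv\<^bsub>FF\<^esub> c \<otimes>\<^bsub>FF\<^esub> inv\<^bsub>FF\<^esub> d"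
      using e unfolding gens_def by blast
    let ?j = "\<lambda>x. p \<otimes>\<^bsub>FF\<^esub> x \<otimes>\<^bsub>FF\<^esub> inv\<^bsub>FF\<^esub> p"
    have "?j e = ?j c \<otimes>\<^bsub>FF\<^esub> ?j d \<otimes>\<^bsub>FF\<^esub> inv\<^bsub>FF\<^esub> (?j c) \<otimes>\<^bsub>FF\<^esub> inv\<^bsub>FF\<^esub> (?j d)"
      unfolding cd(3) using pc subgroup.mem_carrier[OF C_subgroup cd(1)] subgroup.mem_carrier[OF C_subgroup cd(2)]
      by (simp only: FF.word_simps FF.m_closed FF.inv_closed FF.cancel_simps FF.inv_inv)
    moreover have "?j c \<in> C" "?j d \<in> C" using conj_closedD[OF \<Delta>_C p] cd by blast+
    ultimately show ?thesis unfolding gens_def by blast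
  qed
  then show "p \<otimes>\<^bsub>FF\<^esub> e \<otimes>\<^bsub>FF\<^esub> inv\<^bsub>FF\<^esub> p \<in> generate FF gens" by (rule generate.incl)
qed

text \<open>Write \<open>f = u \<otimes> v\<close>. The pair \<open>(u, f)\<close> lies in
  \<open>C\<close> and so acts trivially on the abelian section. It differs from the diagonal
  element only by \<open>v\<close> in the first coordinate, and \<open>v\<close> commutes with
  \<open>U\<close> modulo \<open>R0\<close>.\<close>

lemma UV_acts_trivially:
  assumes f: "f \<in> U <#> V" and c: "c \<in> C"
  shows "\<delta> f \<otimes>\<^bsub>FF\<^esub> c \<otimes>\<^bsub>FF\<^esub> inv\<^bsub>FF\<^esub> \<delta> f \<otimes>\<^bsub>FF\<^esub> inv\<^bsub>FF\<^esub> c \<in> K"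
proof -
  obtain u v where uv: "u \<in> U" "v \<in> V" "f = u \<otimes> v" using f by (auto simp: set_mult_def)
  have cc: "u \<in> carrier F" "v \<in> carrier F" "f \<in> carrier F" using uv Uc Vc by auto
  obtain w m where wm: "c = (w, m)" "(w, m) \<in> C" using c by (cases c) auto
  note d = C_mem[OF wm(2)]
  define z where "z = f \<otimes> w \<otimes> inv f \<otimes> inv (u \<otimes> w \<otimes> inv u)"
  have "u \<otimes> inv (w \<otimes> v \<otimes> inv w \<otimes> inv v) \<otimes> inv u \<in> R0"
    using normal_conjD(1)[OF nR0 cc(1)] UV[OF d(1) uv(2)] subgroup.m_inv_closed[OF sR0] by blast
  then have "z \<in> R0" unfolding z_def uv(3) using cc d by (simp add: word_simps)
  then have zK: "(z, \<one>) \<in> K" using gens_K unfolding gens_def by blast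
  have "(u, f) \<in> C" using uv cc by (intro C_I) (auto simp: uv(3))
  then have "(u, f) \<otimes>\<^bsub>FF\<^esub> c \<otimes>\<^bsub>FF\<^esub> inv\<^bsub>FF\<^esub> (u, f) \<otimes>\<^bsub>FF\<^esub> inv\<^bsub>FF\<^esub> c \<in> K" by (rule sec.comm[OF _ c])
  then have "(z, \<one>) \<otimes>\<^bsub>FF\<^esub> ((u, f) \<otimes>\<^bsub>FF\<^esub> c \<otimes>\<^bsub>FF\<^esub> inv\<^bsub>FF\<^esub> (u, f) \<otimes>\<^bsub>FF\<^esub> inv\<^bsub>FF\<^esub> c) \<in> K"
    by (rule subgroup.m_closed[OF K_subgroup zK])
  moreover have "(z, \<one>) \<otimes>\<^bsub>FF\<^esub> ((u, f) \<otimes>\<^bsub>FF\<^esub> c \<otimes>\<^bsub>FF\<^esub> inv\<^bsub>FF\<^esub> (u, f) \<otimes>\<^bsub>FF\<^esub> inv\<^bsub>FF\<^esub> c)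
      = \<delta> f \<otimes>\<^bsub>FF\<^esub> c \<otimes>\<^bsub>FF\<^esub> inv\<^bsub>FF\<^esub> \<delta> f \<otimes>\<^bsub>FF\<^esub> inv\<^bsub>FF\<^esub> c"
    using cc d by (simp add: wm \<delta>_def z_def word_simps)
  ultimately show ?thesis by simp
qed

text \<open>From \<open>(u, m) = (u, u)(\<one>, inv u \<otimes> m)\<close> it follows that the
  diagonal copy of \<open>U\<close> and the second copy of \<open>V\<close> fill \<open>C\<close>.
  Normal generators of \<open>U\<close> and \<open>V\<close> thereby become module
  generators.\<close>

lemma C_generated:
  assumes RU: "RU \<subseteq> carrier F" "U = normal_closure F RU" and RV: "RV \<subseteq> carrier F" "V = normal_closure F RV"
  defines "E \<equiv> \<delta> ` RU \<union> (\<lambda>r. (\<one>, r)) ` RV"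
  shows "E \<subseteq> C" "C \<subseteq> conj_span FF \<Delta> K E"
proof -
  have RUU: "RU \<subseteq> U" and RVV: "RV \<subseteq> V" unfolding RU(2) RV(2) by (rule normal_closure_incl)+
  show EC: "E \<subseteq> C"
    unfolding E_def using RUU RVV Uc Vc subgroup.one_closed[OF sU] subgroup.one_closed[OF sV]
    by (auto simp: C_def \<delta>_def)
  let ?D = "conj_span FF \<Delta> K E"
  have D: "sec.submod \<Delta> ?D" by (rule sec.submod_conj_span[OF \<Delta>_subgroup \<Delta>_K \<Delta>_C EC])
  note sD = sec.submodD(1)[OF D] and cD = conj_closedD[OF sec.submodD(4)[OF D]]
  have ED: "E \<subseteq> ?D"
    by (rule FF.conj_span_incl(2)[OF \<Delta>_subgroup]) (use EC subgroup.subset[OF C_subgroup] in blast)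
  interpret \<delta>: group_hom F FF \<delta> by (rule \<delta>_hom)
  have "{x \<in> carrier F. \<delta> x \<in> ?D} \<lhd> F"
    unfolding normal_inv_iff
  proof (intro conjI ballI)
    show "subgroup {x \<in> carrier F. \<delta> x \<in> ?D} F" by (rule \<delta>.subgroup_preimage[OF sD])
    fix x h assume x: "x \<in> carrier F" and h: "h \<in> {x \<in> carrier F. \<delta> x \<in> ?D}"
    have "\<delta> x \<otimes>\<^bsub>FF\<^esub> \<delta> h \<otimes>\<^bsub>FF\<^esub> inv\<^bsub>FF\<^esub> \<delta> x \<in> ?D" using cD x h by blast
    then show "x \<otimes> h \<otimes> inv x \<in> {x \<in> carrier F. \<delta> x \<in> ?D}" using x h by (simp add: \<delta>_def)
  qed
  moreover have "RU \<subseteq> {x \<in> carrier F. \<delta> x \<in> ?D}" using ED RU(1) by (auto simp: E_def)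
  ultimately have 1: "U \<subseteq> {x \<in> carrier F. \<delta> x \<in> ?D}"
    by (rule ord_eq_le_trans[OF RU(2) normal_closure_least])
  interpret \<iota>: group_hom F FF "\<lambda>v. (\<one>, v)"
    using FF.group_axioms group_axioms by (simp add: group_hom_def group_hom_axioms_def hom_def)
  note \<iota>.hom_mult [simp del] \<iota>.hom_inv [simp del] \<iota>.hom_one [simp del]
  have "{x \<in> carrier F. (\<one>, x) \<in> ?D} \<lhd> F"
    unfolding normal_inv_iff
  proof (intro conjI ballI)
    show "subgroup {x \<in> carrier F. (\<one>, x) \<in> ?D} F" by (rule \<iota>.subgroup_preimage[OF sD])
    fix x h assume x: "x \<in> carrier F" and h: "h \<in> {x \<in> carrier F. (\<one>, x) \<in> ?D}"
    have "\<delta> x \<otimes>\<^bsub>FF\<^esub> (\<one>, h) \<otimes>\<^bsub>FF\<^esub> inv\<^bsub>FF\<^esub> \<delta> x \<in> ?D" using cD x h by blast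
    then show "x \<otimes> h \<otimes> inv x \<in> {x \<in> carrier F. (\<one>, x) \<in> ?D}" using x h by (simp add: \<delta>_def)
  qed
  moreover have "RV \<subseteq> {x \<in> carrier F. (\<one>, x) \<in> ?D}" using ED RV(1) by (auto simp: E_def)
  ultimately have 2: "V \<subseteq> {x \<in> carrier F. (\<one>, x) \<in> ?D}"
    by (rule ord_eq_le_trans[OF RV(2) normal_closure_least])
  show "C \<subseteq> ?D"
  proof
    fix c assume "c \<in> C"
    then obtain u m where um: "c = (u, m)" "(u, m) \<in> C" by (cases c) auto
    note d = C_mem[OF um(2)]
    have "\<delta> u \<otimes>\<^bsub>FF\<^esub> (\<one>, inv u \<otimes> m) \<in> ?D" using 1 2 d subgroup.m_closed[OF sD] by blast
    then show "c \<in> ?D" using d by (simp add: um \<delta>_def)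
  qed
qed

lemma left_submod:
  assumes B: "B \<lhd> F" "B \<subseteq> U \<inter> V"
  shows "sec.submod \<Delta> ((\<lambda>z. (z, \<one>)) ` B <#>\<^bsub>FF\<^esub> K)" "(\<lambda>z. (z, \<one>)) ` B \<subseteq> (\<lambda>z. (z, \<one>)) ` B <#>\<^bsub>FF\<^esub> K"
proof -
  let ?J = "(\<lambda>z. (z, \<one>)) ` B"
  interpret \<iota>: group_hom F FF "\<lambda>v. (v, \<one>)"
    using FF.group_axioms group_axioms by (simp add: group_hom_def group_hom_axioms_def hom_def)
  have J: "subgroup ?J FF" by (rule \<iota>.subgroup_img_is_subgroup[OF normal_imp_subgroup[OF B(1)]])
  have JC: "?J \<subseteq> C" using left_C B(2) by blast
  note pr = FF.subgroup_product[OF J K_subgroup sec.conj_C[OF K_subgroup order_refl sec.KC subsetD[OF JC]]]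
  show "?J \<subseteq> ?J <#>\<^bsub>FF\<^esub> K" by (rule pr(2))
  have "?J <#>\<^bsub>FF\<^esub> K \<subseteq> C"
    using JC sec.KC subgroup.m_closed[OF C_subgroup] unfolding set_mult_def by blast
  moreover have "conj_closed FF \<Delta> (?J <#>\<^bsub>FF\<^esub> K)"
    using FF.conj_closed_product[OF subgroup.subset[OF \<Delta>_subgroup] subgroup.subset[OF J]
        subgroup.subset[OF K_subgroup] \<Delta>_left[OF B(1)] \<Delta>_K] .
  ultimately show "sec.submod \<Delta> (?J <#>\<^bsub>FF\<^esub> K)" unfolding sec.submod_def using pr by blast
qed

text \<open>The image of \<open>U \<inter> V\<close> is a submodule of a Noetherian module. Its
  generators are lifted to \<open>U \<inter> V\<close>, and \<open>K_left\<close> shows that nothing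
  beyond \<open>R0\<close> is lost when returning from \<open>C/K\<close>.\<close>

lemma Int_finitely_normally_generated:
  assumes RU: "finite RU" "RU \<subseteq> carrier F" "U = normal_closure F RU"
    and RV: "finite RV" "RV \<subseteq> carrier F" "V = normal_closure F RV"
    and Z: "finite Z" "Z \<subseteq> carrier F" "R0 = normal_closure F Z"
    and pc: "pc_chain F N P" and N: "N \<subseteq> U <#> V" and cov: "fin_cover (carrier F) P"
  shows "\<exists>R. finite R \<and> R \<subseteq> carrier F \<and> U \<inter> V = normal_closure F R"
proof -
  interpret \<delta>: group_hom F FF \<delta> by (rule \<delta>_hom)
  have P: "subgroup P F" using pc_chain_subgroup[OF pc] by blast
  let ?P = "\<delta> ` P"
  have pc': "pc_chain FF (\<delta> ` N) ?P" by (rule \<delta>.pc_chain_image[OF pc])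
  have P\<Delta>: "?P \<subseteq> \<Delta>" using subgroup.subset[OF P] by blast
  have sP: "subgroup ?P FF" by (rule \<delta>.subgroup_img_is_subgroup[OF P])
  have cov': "FF.fin_cover \<Delta> ?P"
  proof -
    obtain T where T: "finite T" "T \<subseteq> carrier F" "\<forall>p\<in>carrier F. \<exists>t\<in>T. p \<otimes> inv t \<in> P"
      using cov by (auto simp: fin_cover_def)
    have "\<exists>t\<in>\<delta> ` T. p \<otimes>\<^bsub>FF\<^esub> inv\<^bsub>FF\<^esub> t \<in> ?P" if p: "p \<in> \<Delta>" for p
    proof -
      obtain f where f: "f \<in> carrier F" "p = \<delta> f" using p by blast
      obtain t where t: "t \<in> T" "f \<otimes> inv t \<in> P" using T f by blast
      have "p \<otimes>\<^bsub>FF\<^esub> inv\<^bsub>FF\<^esub> \<delta> t = \<delta> (f \<otimes> inv t)" using f t T(2) by (auto simp: \<delta>_def subset_iff)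
      then show ?thesis using t by (intro bexI[of _ "\<delta> t"]) auto
    qed
    then show ?thesis unfolding FF.fin_cover_def using T by (intro exI[of _ "\<delta> ` T"]) auto
  qed
  let ?E = "\<delta> ` RU \<union> (\<lambda>r. (\<one>, r)) ` RV"
  note E = C_generated[OF RU(2,3) RV(2,3)]
  have noeth: "sec.noetherian \<Delta> (conj_span FF \<Delta> K ?E)"
  proof (rule sec.noetherian_fin_cover[OF sP \<Delta>_subgroup P\<Delta> cov' \<Delta>_C \<Delta>_K _ _ E(1)])
    show "finite ?E" using RU RV by simp
    fix A assume "finite A" "A \<subseteq> C"
    then show "sec.noetherian ?P (conj_span FF ?P K A)"
    proof (rule sec.noetherian_pc_chain[OF pc'])
      show "conj_closed FF ?P C" "conj_closed FF ?P K" using conj_closed_mono \<Delta>_C \<Delta>_K P\<Delta> by blast+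
      show "n \<otimes>\<^bsub>FF\<^esub> c \<otimes>\<^bsub>FF\<^esub> inv\<^bsub>FF\<^esub> n \<otimes>\<^bsub>FF\<^esub> inv\<^bsub>FF\<^esub> c \<in> K" if "n \<in> \<delta> ` N" "c \<in> C" for n c
        using UV_acts_trivially that N by blast
    qed
  qed
  have nR: "U \<inter> V \<lhd> F" by (rule normal_Int[OF nU nV])
  let ?I = "\<lambda>B. (\<lambda>z. (z, \<one>)) ` B <#>\<^bsub>FF\<^esub> K"
  note I = left_submod[OF nR order_refl]
  have "?I (U \<inter> V) \<subseteq> conj_span FF \<Delta> K ?E" using sec.submodD(3)[OF I(1)] E(2) by blast
  then obtain A where A: "finite A" "A \<subseteq> ?I (U \<inter> V)" "?I (U \<inter> V) = conj_span FF \<Delta> K A"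
    using noeth[unfolded sec.noetherian_def, rule_format, OF I(1)] by blast
  have "\<forall>a\<in>A. \<exists>z. z \<in> U \<inter> V \<and> (\<exists>k\<in>K. a = (z, \<one>) \<otimes>\<^bsub>FF\<^esub> k)"
    using A(2) unfolding set_mult_def by blast
  then obtain z where z: "\<And>a. a \<in> A \<Longrightarrow> z a \<in> U \<inter> V \<and> (\<exists>k\<in>K. a = (z a, \<one>) \<otimes>\<^bsub>FF\<^esub> k)" by metis
  define R where "R = Z \<union> z ` A"
  have ZR0: "Z \<subseteq> R0" unfolding Z(3) by (rule normal_closure_incl)
  have R: "finite R" "R \<subseteq> U \<inter> V" using Z(1) ZR0 R0 A(1) z by (auto simp: R_def)
  have Rc: "R \<subseteq> carrier F" using R(2) Uc by blast
  let ?B = "normal_closure F R"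
  have nB: "?B \<lhd> F" by (rule normal_closure_normal[OF Rc])
  have BR: "?B \<subseteq> U \<inter> V" by (rule normal_closure_least[OF nR R(2)])
  have RB: "R \<subseteq> ?B" by (rule normal_closure_incl)
  have R0B: "R0 \<subseteq> ?B" unfolding Z(3) by (rule normal_closure_least[OF nB]) (use RB in \<open>auto simp: R_def\<close>)
  note IB = left_submod[OF nB BR]
  have "A \<subseteq> ?I ?B"
  proof
    fix a assume a: "a \<in> A"
    then obtain k where k: "k \<in> K" "a = (z a, \<one>) \<otimes>\<^bsub>FF\<^esub> k" using z by blast
    have "z a \<in> ?B" using a RB by (auto simp: R_def)
    then have "(z a, \<one>) \<otimes>\<^bsub>FF\<^esub> k \<in> ?I ?B" using k(1) by (intro set_multI) auto
    then show "a \<in> ?I ?B" using k(2) by simp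
  qed
  then have IIB: "?I (U \<inter> V) \<subseteq> ?I ?B" using A(3) sec.conj_span_le_submod[OF IB(1)] by simp
  have "x \<in> ?B" if x: "x \<in> U \<inter> V" for x
  proof -
    have "(x, \<one>) \<in> ?I ?B" using x I(2) IIB by blast
    then obtain b k where bk: "b \<in> ?B" "k \<in> K" "(x, \<one>) = (b, \<one>) \<otimes>\<^bsub>FF\<^esub> k" by (auto simp: set_mult_def)
    have c: "b \<in> carrier F" "k \<in> carrier FF" "x \<in> carrier F"
      using bk BR x Uc subgroup.mem_carrier[OF K_subgroup] by blast+
    obtain k1 k2 where k12: "k = (k1, k2)" by (cases k)
    have "x = b \<otimes> k1" "k2 = \<one>" using bk(3) c by (auto simp: k12)
    then have "(k1, \<one>) \<in> K" using bk(2) k12 by simp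
    then have "k1 \<in> ?B" using K_left R0B by blast
    then show ?thesis using \<open>x = b \<otimes> k1\<close> bk(1) subgroup.m_closed[OF normal_imp_subgroup[OF nB]] by simp
  qed
  then have "U \<inter> V = ?B" using BR by blast
  then show ?thesis using R(1) Rc by blast
qed

end

text \<open>The second projection maps \<open>C\<close> onto \<open>U <#> V\<close> with kernel a
  copy of \<open>U \<inter> V\<close>. It splits because subgroups of the free group are projective,
  and the splitting supplies the retraction on which the embedding rests.\<close>

theorem free_group_Int_normal_closure:
  fixes X :: "'x set"
  defines "F \<equiv> free_group X"
  assumes X: "finite X"
    and RU: "finite RU" "RU \<subseteq> carrier F" "U = normal_closure F RU"
    and RV: "finite RV" "RV \<subseteq> carrier F" "V = normal_closure F RV"
    and W: "finite W" "W \<subseteq> V" "generate F (W \<union> (U \<inter> V)) = V"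
    and pc: "pc_chain F N P" and N: "N \<subseteq> U <#>\<^bsub>F\<^esub> V" and cov: "group.fin_cover F (carrier F) P"
  shows "\<exists>R. finite R \<and> R \<subseteq> carrier F \<and> U \<inter> V = normal_closure F R"
proof -
  interpret F: group F unfolding F_def by (rule group_free_group)
  obtain Z where Z: "finite Z" "Z \<subseteq> U \<inter> V"
    "\<forall>u\<in>U. \<forall>v\<in>V. u \<otimes>\<^bsub>F\<^esub> v \<otimes>\<^bsub>F\<^esub> inv\<^bsub>F\<^esub> u \<otimes>\<^bsub>F\<^esub> inv\<^bsub>F\<^esub> v \<in> normal_closure F Z"
    using F.commutator_relators[OF _ _ _ RU RV W, of "free_gens X"] X free_gens_carrier[of X]
      generate_free_gens[of X] by (auto simp: F_def free_gens_def)
  have nU: "U \<lhd> F" and nV: "V \<lhd> F" using F.normal_closure_normal RU RV by auto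
  have Zc: "Z \<subseteq> carrier F" using Z(2) subgroup.subset[OF normal_imp_subgroup[OF nU]] by blast
  have nR0: "normal_closure F Z \<lhd> F" by (rule F.normal_closure_normal[OF Zc])
  have R0: "normal_closure F Z \<subseteq> U \<inter> V" by (rule F.normal_closure_least[OF F.normal_Int[OF nU nV] Z(2)])
  interpret normal_pair F U V by (intro normal_pair.intro normal_pair_axioms.intro F.group_axioms nU nV)
  have gC: "group ((F \<times>\<times> F)\<lparr>carrier := C\<rparr>)" by (rule FF.subgroup_imp_group[OF C_subgroup])
  have snd: "snd \<in> hom ((F \<times>\<times> F)\<lparr>carrier := C\<rparr>) F" by (auto simp: hom_def C_def mult_DirProd')
  have onto: "U <#>\<^bsub>F\<^esub> V \<subseteq> snd ` carrier ((F \<times>\<times> F)\<lparr>carrier := C\<rparr>)"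
  proof
    fix m assume m: "m \<in> U <#>\<^bsub>F\<^esub> V"
    then obtain u v where uv: "u \<in> U" "v \<in> V" "m = u \<otimes>\<^bsub>F\<^esub> v" by (auto simp: set_mult_def)
    have "(u, m) \<in> C"
      using uv subgroup.mem_carrier[OF sU uv(1)] subgroup.mem_carrier[OF sV uv(2)] by (simp add: C_def)
    then show "m \<in> snd ` carrier ((F \<times>\<times> F)\<lparr>carrier := C\<rparr>)" by force
  qed
  obtain \<sigma> where \<sigma>: "\<sigma> \<in> hom (F\<lparr>carrier := U <#>\<^bsub>F\<^esub> V\<rparr>) ((F \<times>\<times> F)\<lparr>carrier := C\<rparr>)"
    "\<forall>m\<in>U <#>\<^bsub>F\<^esub> V. snd (\<sigma> m) = m"
    using free_subgroup_projective[OF UV_subgroup[unfolded F_def] gC[unfolded F_def] snd[unfolded F_def]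
        onto[unfolded F_def]] unfolding F_def by blast
  have \<sigma>C: "\<sigma> m \<in> C" if "m \<in> U <#>\<^bsub>F\<^esub> V" for m using \<sigma>(1) that by (auto simp: hom_def)
  interpret split_square F U V "normal_closure F Z" "\<lambda>m. fst (\<sigma> m)"
  proof (intro split_square.intro split_square_axioms.intro normal_pair_axioms)
    show "fst (\<sigma> (m \<otimes>\<^bsub>F\<^esub> n)) = fst (\<sigma> m) \<otimes>\<^bsub>F\<^esub> fst (\<sigma> n)"
      if "m \<in> U <#>\<^bsub>F\<^esub> V" "n \<in> U <#>\<^bsub>F\<^esub> V" for m n
      using \<sigma>(1) that by (simp add: hom_def mult_DirProd')
    show "fst (\<sigma> m) \<in> U" if "m \<in> U <#>\<^bsub>F\<^esub> V" for m using \<sigma>C[OF that] by (auto simp: C_def)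
    show "inv\<^bsub>F\<^esub> fst (\<sigma> m) \<otimes>\<^bsub>F\<^esub> m \<in> V" if "m \<in> U <#>\<^bsub>F\<^esub> V" for m
      using \<sigma>C[OF that] \<sigma>(2) that by (auto simp: C_def)
  qed (use nR0 R0 Z(3) in auto)
  show ?thesis by (rule Int_finitely_normally_generated[OF RU RV Z(1) Zc refl pc N cov])
qed

section \<open>Subgroups of direct products\<close>

lemma (in group_hom) fin_cover_image:
  assumes "G.fin_cover P K" "P \<subseteq> carrier G"
  shows "H.fin_cover (h ` P) (h ` K)"
proof -
  obtain T where T: "finite T" "T \<subseteq> P" "\<forall>p\<in>P. \<exists>t\<in>T. p \<otimes> inv t \<in> K" using assms by (auto simp: G.fin_cover_def)
  have "\<exists>t\<in>h ` T. q \<otimes>\<^bsub>H\<^esub> inv\<^bsub>H\<^esub> t \<in> h ` K" if q: "q \<in> h ` P" for q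
  proof -
    obtain p where p: "p \<in> P" "q = h p" using q by blast
    obtain t where t: "t \<in> T" "p \<otimes> inv t \<in> K" using T(3) p(1) by blast
    have "p \<in> carrier G" "t \<in> carrier G" using p t T(2) assms(2) by blast+
    then have "q \<otimes>\<^bsub>H\<^esub> inv\<^bsub>H\<^esub> h t = h (p \<otimes> inv t)" by (simp add: p(2))
    then show ?thesis using t by (intro bexI[of _ "h t"]) auto
  qed
  then show ?thesis unfolding H.fin_cover_def using T by (intro exI[of _ "h ` T"]) auto
qed

lemma (in group) fin_cover_Inter:
  assumes "finite A" and "\<And>a. a \<in> A \<Longrightarrow> subgroup (B a) G" "\<And>a. a \<in> A \<Longrightarrow> fin_cover (carrier G) (B a)"
  shows "subgroup (carrier G \<inter> (\<Inter>a\<in>A. B a)) G \<and> fin_cover (carrier G) (carrier G \<inter> (\<Inter>a\<in>A. B a))"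
  using assms
proof (induction rule: finite_induct)
  case empty
  then show ?case using subgroup_self fin_cover_refl[OF subgroup_self] by simp
next
  case (insert a A)
  let ?C = "carrier G \<inter> (\<Inter>a\<in>A. B a)"
  have IH: "subgroup ?C G" "fin_cover (carrier G) ?C" using insert.IH insert.prems by auto
  have Ba: "subgroup (B a) G" "fin_cover (carrier G) (B a)" using insert.prems by auto
  have "carrier G \<inter> (\<Inter>a\<in>insert a A. B a) = B a \<inter> ?C" by auto
  then show ?case
    using subgroups_Inter_pair[OF Ba(1) IH(1)]
      fin_cover_Int[OF Ba(1) IH(1) subgroup_self Ba(2) order_refl subgroup_self IH(2)] by simp
qed

text \<open>Every \<open>g\<close> is an element of \<open>K\<close> times some representative
  \<open>t\<close>, so the finitely many conjugates of \<open>K\<close> by representatives already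
  account for all of them.\<close>

lemma (in group) normal_core:
  assumes K: "subgroup K G" and cov: "fin_cover (carrier G) K"
  shows "\<exists>C. C \<lhd> G \<and> C \<subseteq> K \<and> finite_index G C"
proof -
  obtain T where T: "finite T" "T \<subseteq> carrier G" "\<forall>p\<in>carrier G. \<exists>t\<in>T. p \<otimes> inv t \<in> K"
    using cov by (auto simp: fin_cover_def)
  let ?B = "\<lambda>t. {x \<in> carrier G. t \<otimes> x \<otimes> inv t \<in> K}"
  let ?C = "carrier G \<inter> (\<Inter>t\<in>T. ?B t)"
  have B: "subgroup (?B t) G" "fin_cover (carrier G) (?B t)" if t: "t \<in> carrier G" for t
  proof -
    show "subgroup (?B t) G" by (rule subgroup_conj_set[OF K t])
    interpret c: group_hom G G "\<lambda>x. t \<otimes> x \<otimes> inv t"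
      by unfold_locales (use t in \<open>simp add: hom_def word_simps\<close>)
    have "(\<lambda>x. t \<otimes> x \<otimes> inv t) ` carrier G = carrier G"
    proof
      show "carrier G \<subseteq> (\<lambda>x. t \<otimes> x \<otimes> inv t) ` carrier G"
      proof
        fix x assume x: "x \<in> carrier G"
        then have "x = t \<otimes> (inv t \<otimes> x \<otimes> t) \<otimes> inv t" using t by (simp add: word_simps)
        then show "x \<in> (\<lambda>x. t \<otimes> x \<otimes> inv t) ` carrier G" using x t by blast
      qed
    qed (use t in auto)
    then show "fin_cover (carrier G) (?B t)" using c.fin_cover_preimage[OF K order_refl] cov by simp
  qed
  have C: "subgroup ?C G" "fin_cover (carrier G) ?C"
    using fin_cover_Inter[of T ?B] T(1,2) B by (auto simp: subset_iff)
  have Cn: "g \<otimes> x \<otimes> inv g \<in> K" if g: "g \<in> carrier G" and x: "x \<in> ?C" for g x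
  proof -
    obtain t where t: "t \<in> T" "g \<otimes> inv t \<in> K" using T g by blast
    have c: "t \<in> carrier G" "x \<in> carrier G" using t T(2) x by auto
    have "t \<otimes> x \<otimes> inv t \<in> K" using x t by blast
    then have "(g \<otimes> inv t) \<otimes> (t \<otimes> x \<otimes> inv t) \<otimes> inv (g \<otimes> inv t) \<in> K"
      using t(2) subgroup.m_closed[OF K] subgroup.m_inv_closed[OF K] by blast
    then show ?thesis using g c by (simp add: word_simps)
  qed
  have "?C \<lhd> G"
    unfolding normal_inv_iff
  proof (intro conjI ballI)
    fix g x assume g: "g \<in> carrier G" and x: "x \<in> ?C"
    have "t \<otimes> (g \<otimes> x \<otimes> inv g) \<otimes> inv t \<in> K" if t: "t \<in> T" for t
    proof -
      have tc: "t \<in> carrier G" "x \<in> carrier G" using t T(2) x by auto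
      have "(t \<otimes> g) \<otimes> x \<otimes> inv (t \<otimes> g) \<in> K" using Cn[OF _ x] tc g by simp
      then show ?thesis using tc g by (simp add: word_simps)
    qed
    then show "g \<otimes> x \<otimes> inv g \<in> ?C" using g x by auto
  qed (rule C)
  moreover have "?C \<subseteq> K"
  proof
    fix x assume x: "x \<in> ?C"
    then show "x \<in> K" using Cn[OF one_closed x] by simp
  qed
  moreover have "finite_index G ?C" using C finite_index_iff_fin_cover by blast
  ultimately show ?thesis by blast
qed

lemma PiE_upd_restrict:
  assumes "a \<in> I" "A \<subseteq> C"
  shows "{x \<in> PiE I (X(a := C)). x a \<in> A} = PiE I (X(a := A))"
  using assms by (auto simp: PiE_def Pi_def split: if_splits)

text \<open>The condition \<open>single\<close> follows from \<open>pair\<close> only if there is a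
  second factor. It is assumed separately so that the locale is inherited by all subsets of
  \<open>I\<close>, including those with one element, as the induction requires.\<close>

locale vsp =
  fixes I :: "'i set" and G :: "'i \<Rightarrow> ('a, 'b) monoid_scheme" and S :: "('i \<Rightarrow> 'a) set"
  assumes finI: "finite I" and fp: "\<And>i. i \<in> I \<Longrightarrow> finitely_presented (G i)"
    and S: "subgroup S (product_group I G)"
    and single: "\<And>i. i \<in> I \<Longrightarrow> finite_index (G i) ((\<lambda>x. x i) ` S)"
    and pair: "\<And>i j. i \<in> I \<Longrightarrow> j \<in> I \<Longrightarrow> i \<noteq> j \<Longrightarrow> finite_index (G i \<times>\<times> G j) ((\<lambda>x. (x i, x j)) ` S)"
begin

section \<open>Coordinates, embeddings of factors and product subgroups\<close>

definition "\<Gamma> = product_group I G"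

lemma grp: "i \<in> I \<Longrightarrow> group (G i)" using fp by (simp add: finitely_presented_def)

sublocale \<Gamma>: group \<Gamma> unfolding \<Gamma>_def using grp by simp

lemma \<Gamma>_carrier: "x \<in> carrier \<Gamma> \<longleftrightarrow> x \<in> (\<Pi>\<^sub>E i\<in>I. carrier (G i))" by (simp add: \<Gamma>_def)

lemma \<Gamma>_at: "x \<in> carrier \<Gamma> \<Longrightarrow> i \<in> I \<Longrightarrow> x i \<in> carrier (G i)" by (auto simp: \<Gamma>_def)

lemma \<Gamma>_mult: "i \<in> I \<Longrightarrow> (x \<otimes>\<^bsub>\<Gamma>\<^esub> y) i = x i \<otimes>\<^bsub>G i\<^esub> y i" by (simp add: \<Gamma>_def)

lemma \<Gamma>_one: "i \<in> I \<Longrightarrow> \<one>\<^bsub>\<Gamma>\<^esub> i = \<one>\<^bsub>G i\<^esub>" by (simp add: \<Gamma>_def)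

lemma \<Gamma>_inv: "x \<in> carrier \<Gamma> \<Longrightarrow> i \<in> I \<Longrightarrow> (inv\<^bsub>\<Gamma>\<^esub> x) i = inv\<^bsub>G i\<^esub> (x i)"
  using grp by (simp add: \<Gamma>_def)

lemma \<Gamma>_eqI: "x \<in> carrier \<Gamma> \<Longrightarrow> y \<in> carrier \<Gamma> \<Longrightarrow> (\<And>i. i \<in> I \<Longrightarrow> x i = y i) \<Longrightarrow> x = y"
  unfolding \<Gamma>_carrier by (rule PiE_ext)

lemma S': "subgroup S \<Gamma>" using S by (simp add: \<Gamma>_def)

lemma S_carrier: "s \<in> S \<Longrightarrow> s \<in> carrier \<Gamma>" using subgroup.mem_carrier[OF S'] .

lemma proj_hom: "i \<in> I \<Longrightarrow> group_hom \<Gamma> (G i) (\<lambda>x. x i)"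
  using grp[of i] \<Gamma>.group_axioms \<Gamma>_at \<Gamma>_mult by (simp add: group_hom_def group_hom_axioms_def hom_def)

definition "emb i x = (\<lambda>j\<in>I. if j = i then x else \<one>\<^bsub>G j\<^esub>)"

lemma emb_at: "j \<in> I \<Longrightarrow> emb i x j = (if j = i then x else \<one>\<^bsub>G j\<^esub>)" by (simp add: emb_def)

lemma G_one: "i \<in> I \<Longrightarrow> \<one>\<^bsub>G i\<^esub> \<in> carrier (G i)"
  using grp by (simp add: group.is_monoid monoid.one_closed)

lemma emb_carrier: "i \<in> I \<Longrightarrow> x \<in> carrier (G i) \<Longrightarrow> emb i x \<in> carrier \<Gamma>"
  using G_one by (auto simp: \<Gamma>_carrier emb_def)

lemma emb_hom:
  assumes i: "i \<in> I"
  shows "group_hom (G i) \<Gamma> (emb i)"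
proof -
  interpret Gi: group "G i" by (rule grp[OF i])
  have "emb i (x \<otimes>\<^bsub>G i\<^esub> y) = emb i x \<otimes>\<^bsub>\<Gamma>\<^esub> emb i y" if "x \<in> carrier (G i)" "y \<in> carrier (G i)" for x y
  proof (rule \<Gamma>_eqI)
    fix j assume j: "j \<in> I"
    interpret Gj: group "G j" by (rule grp[OF j])
    show "emb i (x \<otimes>\<^bsub>G i\<^esub> y) j = (emb i x \<otimes>\<^bsub>\<Gamma>\<^esub> emb i y) j" using j by (simp add: \<Gamma>_mult emb_at)
  qed (use emb_carrier i that in auto)
  then show ?thesis
    using emb_carrier[OF i] Gi.group_axioms \<Gamma>.group_axioms
    by (simp add: group_hom_def group_hom_axioms_def hom_def)
qed

lemma mem_of_components:
  assumes B: "subgroup B \<Gamma>" and x: "x \<in> carrier \<Gamma>" and e: "\<And>i. i \<in> I \<Longrightarrow> emb i (x i) \<in> B"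
  shows "x \<in> B"
proof -
  have "\<forall>x. x \<in> carrier \<Gamma> \<longrightarrow> (\<forall>i\<in>A. emb i (x i) \<in> B) \<longrightarrow> (\<forall>i\<in>I - A. x i = \<one>\<^bsub>G i\<^esub>) \<longrightarrow> x \<in> B"
    if "finite A" "A \<subseteq> I" for A
    using that
  proof (induction rule: finite_induct)
    case empty
    show ?case
    proof (intro allI impI)
      fix x assume "x \<in> carrier \<Gamma>" "\<forall>i\<in>I - {}. x i = \<one>\<^bsub>G i\<^esub>"
      then have "x = \<one>\<^bsub>\<Gamma>\<^esub>" by (intro \<Gamma>_eqI) (auto simp: \<Gamma>_one)
      then show "x \<in> B" using subgroup.one_closed[OF B] by simp
    qed
  next
    case (insert a A)
    show ?case
    proof (intro allI impI)
      fix x assume x: "x \<in> carrier \<Gamma>" and xB: "\<forall>i\<in>insert a A. emb i (x i) \<in> B"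
        and x1: "\<forall>i\<in>I - insert a A. x i = \<one>\<^bsub>G i\<^esub>"
      have a: "a \<in> I" using insert.prems by blast
      interpret Ga: group "G a" by (rule grp[OF a])
      let ?e = "emb a (x a)"
      have ec: "?e \<in> carrier \<Gamma>" using emb_carrier[OF a \<Gamma>_at[OF x a]] .
      define y where "y = inv\<^bsub>\<Gamma>\<^esub> ?e \<otimes>\<^bsub>\<Gamma>\<^esub> x"
      have yc: "y \<in> carrier \<Gamma>" using x ec by (simp add: y_def)
      have ya: "y i = (if i = a then \<one>\<^bsub>G a\<^esub> else x i)" if i: "i \<in> I" for i
      proof -
        interpret Gi: group "G i" by (rule grp[OF i])
        have "y i = inv\<^bsub>G i\<^esub> (?e i) \<otimes>\<^bsub>G i\<^esub> x i" using i ec by (simp add: y_def \<Gamma>_mult \<Gamma>_inv)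
        then show ?thesis using \<Gamma>_at[OF x i] by (cases "i = a") (simp_all add: emb_at[OF i] emb_at[OF a])
      qed
      have "emb i (y i) \<in> B" if "i \<in> A" for i
      proof -
        have "i \<in> I" "i \<noteq> a" using that insert.prems(1) insert.hyps(2) by auto
        then show ?thesis using ya[of i] xB that by simp
      qed
      moreover have "y i = \<one>\<^bsub>G i\<^esub>" if "i \<in> I - A" for i
        using ya[of i] x1 that by (cases "i = a") simp_all
      moreover have "A \<subseteq> I" using insert.prems(1) by blast
      ultimately have "y \<in> B" using insert.IH yc by blast
      then have "?e \<otimes>\<^bsub>\<Gamma>\<^esub> y \<in> B" using xB subgroup.m_closed[OF B] by blast
      then show "x \<in> B" using x ec by (simp add: y_def)
    qed
  qed
  from this[OF finI order_refl] show ?thesis using x e by blast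
qed

lemma PiE_eq_Inter:
  assumes "\<And>i. i \<in> I \<Longrightarrow> B i \<subseteq> carrier (G i)"
  shows "PiE I B = carrier \<Gamma> \<inter> (\<Inter>i\<in>I. {x \<in> carrier \<Gamma>. x i \<in> B i})"
proof
  show "PiE I B \<subseteq> carrier \<Gamma> \<inter> (\<Inter>i\<in>I. {x \<in> carrier \<Gamma>. x i \<in> B i})"
    using assms by (auto simp: \<Gamma>_carrier PiE_def Pi_def subset_iff)
  show "carrier \<Gamma> \<inter> (\<Inter>i\<in>I. {x \<in> carrier \<Gamma>. x i \<in> B i}) \<subseteq> PiE I B"
    by (auto simp: \<Gamma>_carrier PiE_def Pi_def)
qed

lemma fin_cover_PiE:
  assumes "\<And>i. i \<in> I \<Longrightarrow> subgroup (B i) (G i)" "\<And>i. i \<in> I \<Longrightarrow> group.fin_cover (G i) (carrier (G i)) (B i)"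
  shows "subgroup (PiE I B) \<Gamma>" "\<Gamma>.fin_cover (carrier \<Gamma>) (PiE I B)"
proof -
  have *: "subgroup {x \<in> carrier \<Gamma>. x i \<in> B i} \<Gamma> \<and> \<Gamma>.fin_cover (carrier \<Gamma>) {x \<in> carrier \<Gamma>. x i \<in> B i}"
    if i: "i \<in> I" for i
  proof -
    interpret p: group_hom \<Gamma> "G i" "\<lambda>x. x i" by (rule proj_hom[OF i])
    have "(\<lambda>x. x i) ` carrier \<Gamma> = carrier (G i)"
    proof
      show "carrier (G i) \<subseteq> (\<lambda>x. x i) ` carrier \<Gamma>"
      proof
        fix y assume "y \<in> carrier (G i)"
        then have "emb i y \<in> carrier \<Gamma>" "y = emb i y i" using emb_carrier[OF i] emb_at[OF i] by auto
        then show "y \<in> (\<lambda>x. x i) ` carrier \<Gamma>" by blast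
      qed
    qed (use \<Gamma>_at i in auto)
    then show ?thesis
      using p.subgroup_preimage[OF assms(1)[OF i]] p.fin_cover_preimage[OF assms(1)[OF i] order_refl] assms(2)[OF i]
      by simp
  qed
  have "PiE I B = carrier \<Gamma> \<inter> (\<Inter>i\<in>I. {x \<in> carrier \<Gamma>. x i \<in> B i})"
    by (rule PiE_eq_Inter) (use subgroup.subset[OF assms(1)] in blast)
  then show "subgroup (PiE I B) \<Gamma>" "\<Gamma>.fin_cover (carrier \<Gamma>) (PiE I B)"
    using \<Gamma>.fin_cover_Inter[OF finI, of "\<lambda>i. {x \<in> carrier \<Gamma>. x i \<in> B i}"] * by auto
qed

lemma PiE_subgroup: "(\<And>i. i \<in> I \<Longrightarrow> subgroup (B i) (G i)) \<Longrightarrow> subgroup (PiE I B) \<Gamma>"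
proof -
  assume B: "\<And>i. i \<in> I \<Longrightarrow> subgroup (B i) (G i)"
  have "subgroup {x \<in> carrier \<Gamma>. x i \<in> B i} \<Gamma>" if "i \<in> I" for i
    using group_hom.subgroup_preimage[OF proj_hom[OF that] B[OF that]] .
  then have "subgroup (\<Inter>(insert (carrier \<Gamma>) ((\<lambda>i. {x \<in> carrier \<Gamma>. x i \<in> B i}) ` I))) \<Gamma>"
    using \<Gamma>.subgroup_self by (intro \<Gamma>.subgroups_Inter) auto
  then show "subgroup (PiE I B) \<Gamma>"
    using PiE_eq_Inter[of B] subgroup.subset[OF B] by simp
qed

text \<open>One factor is changed at a time. Each change is the preimage of the chain in that factor
  under the coordinate map, and the pieces are concatenated.\<close>

lemma pc_chain_PiE:
  assumes pc: "\<And>i. i \<in> I \<Longrightarrow> pc_chain (G i) (A i) (B i)"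
  shows "pc_chain \<Gamma> (PiE I A) (PiE I B)"
proof -
  have sub: "subgroup (A i) (G i)" "subgroup (B i) (G i)" "A i \<subseteq> B i" if "i \<in> I" for i
    using group.pc_chain_subgroup[OF grp[OF that] pc[OF that]] by auto
  have "pc_chain \<Gamma> (PiE I A) (PiE I (\<lambda>i. if i \<in> J then B i else A i))" if "finite J" "J \<subseteq> I" for J
    using that
  proof (induction rule: finite_induct)
    case empty
    have "subgroup (PiE I A) \<Gamma>" by (rule PiE_subgroup[OF sub(1)])
    then show ?case by (simp add: pc_chain.base)
  next
    case (insert a J)
    have a: "a \<in> I" using insert.prems by blast
    let ?X = "\<lambda>i. if i \<in> J then B i else A i"
    \<comment> \<open>The coordinate \<open>a\<close> is left free while the others are fixed as
      reached so far; restricting it to \<open>A a\<close> or \<open>B a\<close> gives the two ends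
      of this piece.\<close>
    define \<Sigma> where "\<Sigma> = PiE I (?X(a := carrier (G a)))"
    have \<Sigma>: "subgroup \<Sigma> \<Gamma>"
      unfolding \<Sigma>_def by (rule PiE_subgroup) (use sub group.subgroup_self[OF grp] in auto)
    interpret p: group_hom \<Gamma> "G a" "\<lambda>x. x a" by (rule proj_hom[OF a])
    have "B a \<subseteq> (\<lambda>x. x a) ` \<Sigma>"
    proof
      fix b assume b: "b \<in> B a"
      then have "emb a b \<in> \<Sigma>"
        using subgroup.mem_carrier[OF sub(2)[OF a] b] subgroup.one_closed[OF sub(1)] subgroup.one_closed[OF sub(2)]
        by (auto simp: \<Sigma>_def emb_def)
      moreover have "b = emb a b a" using emb_at[OF a] by simp
      ultimately show "b \<in> (\<lambda>x. x a) ` \<Sigma>" by blast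
    qed
    from p.pc_chain_preimage[OF pc[OF a] \<Sigma> this]
    have "pc_chain \<Gamma> {x \<in> \<Sigma>. x a \<in> A a} {x \<in> \<Sigma>. x a \<in> B a}" .
    moreover have "{x \<in> \<Sigma>. x a \<in> A a} = PiE I ?X"
    proof -
      have "?X(a := A a) = ?X" by (rule fun_upd_idem) (use insert.hyps in simp)
      then show ?thesis
        unfolding \<Sigma>_def using PiE_upd_restrict[OF a subgroup.subset[OF sub(1)[OF a]], of ?X] by simp
    qed
    moreover have "{x \<in> \<Sigma>. x a \<in> B a} = PiE I (\<lambda>i. if i \<in> insert a J then B i else A i)"
    proof -
      have "?X(a := B a) = (\<lambda>i. if i \<in> insert a J then B i else A i)" by (rule ext) simp
      then show ?thesis
        unfolding \<Sigma>_def using PiE_upd_restrict[OF a subgroup.subset[OF sub(2)[OF a]], of ?X] by simp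
    qed
    ultimately have "pc_chain \<Gamma> (PiE I ?X) (PiE I (\<lambda>i. if i \<in> insert a J then B i else A i))" by simp
    then show ?case by (rule pc_chain_trans) (use insert.IH insert.prems in blast)
  qed
  from this[OF finI order_refl] have "pc_chain \<Gamma> (PiE I A) (PiE I (\<lambda>i. if i \<in> I then B i else A i))" .
  moreover have "PiE I (\<lambda>i. if i \<in> I then B i else A i) = PiE I B" by (rule PiE_cong) simp
  ultimately show ?thesis by simp
qed

text \<open>\<open>N i J\<close> consists of the \<open>i\<close>-th coordinates of the elements of \<open>S\<close> whose coordinates in \<open>J\<close> are
  trivial.  A commutator of elements of \<open>N i J\<close> and \<open>N i J'\<close> lies in \<open>N i (J \<union> J')\<close>; this is what makes
  \<open>S\<close> virtually contain a term of the lower central series of each factor.\<close>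

definition "N i J = (\<lambda>x. x i) ` {s \<in> S. \<forall>j\<in>J. s j = \<one>\<^bsub>G j\<^esub>}"

lemma kernel_subgroup:
  assumes "J \<subseteq> I"
  shows "subgroup {s \<in> S. \<forall>j\<in>J. s j = \<one>\<^bsub>G j\<^esub>} \<Gamma>"
proof (rule \<Gamma>.subgroupI)
  have J: "j \<in> I" "group (G j)" if "j \<in> J" for j using that assms grp by auto
  show "{s \<in> S. \<forall>j\<in>J. s j = \<one>\<^bsub>G j\<^esub>} \<subseteq> carrier \<Gamma>" using S_carrier by blast
  have "\<one>\<^bsub>\<Gamma>\<^esub> \<in> {s \<in> S. \<forall>j\<in>J. s j = \<one>\<^bsub>G j\<^esub>}" using subgroup.one_closed[OF S'] J \<Gamma>_one by simp
  then show "{s \<in> S. \<forall>j\<in>J. s j = \<one>\<^bsub>G j\<^esub>} \<noteq> {}" by blast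
  fix a assume a: "a \<in> {s \<in> S. \<forall>j\<in>J. s j = \<one>\<^bsub>G j\<^esub>}"
  then show "inv\<^bsub>\<Gamma>\<^esub> a \<in> {s \<in> S. \<forall>j\<in>J. s j = \<one>\<^bsub>G j\<^esub>}"
    using subgroup.m_inv_closed[OF S'] J \<Gamma>_inv[OF S_carrier] by (auto simp: group.is_monoid monoid.inv_one)
  fix b assume b: "b \<in> {s \<in> S. \<forall>j\<in>J. s j = \<one>\<^bsub>G j\<^esub>}"
  show "a \<otimes>\<^bsub>\<Gamma>\<^esub> b \<in> {s \<in> S. \<forall>j\<in>J. s j = \<one>\<^bsub>G j\<^esub>}"
    using a b subgroup.m_closed[OF S'] J \<Gamma>_mult group.is_monoid monoid.l_one[of "G _"] monoid.one_closed by fastforce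
qed

lemma N_subgroup:
  assumes "i \<in> I" "J \<subseteq> I"
  shows "subgroup (N i J) (G i)"
  unfolding N_def by (rule group_hom.subgroup_img_is_subgroup[OF proj_hom[OF assms(1)] kernel_subgroup[OF assms(2)]])

lemma N_conj:
  assumes i: "i \<in> I" and J: "J \<subseteq> I" and h: "h \<in> N i {}" and x: "x \<in> N i J"
  shows "h \<otimes>\<^bsub>G i\<^esub> x \<otimes>\<^bsub>G i\<^esub> inv\<^bsub>G i\<^esub> h \<in> N i J"
proof -
  obtain s where s: "s \<in> S" "h = s i" using h by (auto simp: N_def)
  obtain r where r: "r \<in> S" "\<forall>j\<in>J. r j = \<one>\<^bsub>G j\<^esub>" "x = r i" using x by (auto simp: N_def)
  let ?q = "s \<otimes>\<^bsub>\<Gamma>\<^esub> r \<otimes>\<^bsub>\<Gamma>\<^esub> inv\<^bsub>\<Gamma>\<^esub> s"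
  have q: "?q \<in> S" by (intro subgroup.m_closed[OF S'] subgroup.m_inv_closed[OF S'] s(1) r(1))
  have qj: "?q j = s j \<otimes>\<^bsub>G j\<^esub> r j \<otimes>\<^bsub>G j\<^esub> inv\<^bsub>G j\<^esub> (s j)" if "j \<in> I" for j
    using that \<Gamma>_inv[OF S_carrier[OF s(1)]] by (simp add: \<Gamma>_mult)
  have "?q j = \<one>\<^bsub>G j\<^esub>" if j: "j \<in> J" for j
  proof -
    interpret Gj: group "G j" using grp j J by blast
    show ?thesis using qj[of j] j J r(2) \<Gamma>_at[OF S_carrier[OF s(1)], of j] by auto
  qed
  then have "?q i \<in> N i J" unfolding N_def using q by blast
  then show ?thesis using qj[OF i] s r by simp
qed

lemma N_commutator:
  assumes i: "i \<in> I" and J: "J \<subseteq> I" "J' \<subseteq> I" and x: "x \<in> N i J" and y: "y \<in> N i J'"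
  shows "x \<otimes>\<^bsub>G i\<^esub> y \<otimes>\<^bsub>G i\<^esub> inv\<^bsub>G i\<^esub> x \<otimes>\<^bsub>G i\<^esub> inv\<^bsub>G i\<^esub> y \<in> N i (J \<union> J')"
proof -
  obtain s where s: "s \<in> S" "\<forall>j\<in>J. s j = \<one>\<^bsub>G j\<^esub>" "x = s i" using x by (auto simp: N_def)
  obtain r where r: "r \<in> S" "\<forall>j\<in>J'. r j = \<one>\<^bsub>G j\<^esub>" "y = r i" using y by (auto simp: N_def)
  let ?q = "s \<otimes>\<^bsub>\<Gamma>\<^esub> r \<otimes>\<^bsub>\<Gamma>\<^esub> inv\<^bsub>\<Gamma>\<^esub> s \<otimes>\<^bsub>\<Gamma>\<^esub> inv\<^bsub>\<Gamma>\<^esub> r"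
  have q: "?q \<in> S" by (intro subgroup.m_closed[OF S'] subgroup.m_inv_closed[OF S'] s(1) r(1))
  have qj: "?q j = s j \<otimes>\<^bsub>G j\<^esub> r j \<otimes>\<^bsub>G j\<^esub> inv\<^bsub>G j\<^esub> (s j) \<otimes>\<^bsub>G j\<^esub> inv\<^bsub>G j\<^esub> (r j)" if "j \<in> I" for j
    using that \<Gamma>_inv[OF S_carrier[OF s(1)]] \<Gamma>_inv[OF S_carrier[OF r(1)]] by (simp add: \<Gamma>_mult)
  have "?q j = \<one>\<^bsub>G j\<^esub>" if j: "j \<in> J \<union> J'" for j
  proof -
    have jI: "j \<in> I" using j J by blast
    interpret Gj: group "G j" by (rule grp[OF jI])
    have "s j \<in> carrier (G j)" "r j \<in> carrier (G j)" using \<Gamma>_at[OF S_carrier jI] s r by auto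
    then show ?thesis using qj[OF jI] j s(2) r(2) by auto
  qed
  then have "?q i \<in> N i (J \<union> J')" unfolding N_def using q by blast
  then show ?thesis using qj[OF i] s r by simp
qed

lemma N_emb:
  assumes i: "i \<in> I" and x: "x \<in> N i (I - {i})"
  shows "emb i x \<in> S"
proof -
  obtain s where s: "s \<in> S" "\<forall>j\<in>I - {i}. s j = \<one>\<^bsub>G j\<^esub>" "x = s i" using x by (auto simp: N_def)
  have "emb i x = s"
    by (rule \<Gamma>_eqI)
      (use s i S_carrier[OF s(1)] \<Gamma>_at[OF S_carrier[OF s(1)] i] emb_carrier[OF i] in \<open>auto simp: emb_at\<close>)
  then show ?thesis using s by simp
qed

text \<open>The image of \<open>S\<close> in the product of two factors has finite index, hence so
  has its intersection with the first factor. That intersection consists of coordinates of elements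
  trivial at \<open>j\<close>.\<close>

lemma N_fin_cover:
  assumes i: "i \<in> I" and j: "j \<in> I" "i \<noteq> j"
  shows "group.fin_cover (G i) (carrier (G i)) (N i {j})"
proof -
  interpret Gi: group "G i" by (rule grp[OF i])
  interpret Gj: group "G j" by (rule grp[OF j(1)])
  interpret D: group "G i \<times>\<times> G j" by (rule DirProd_group[OF Gi.group_axioms Gj.group_axioms])
  let ?B = "(\<lambda>x. (x i, x j)) ` S"
  have "group_hom \<Gamma> (G i \<times>\<times> G j) (\<lambda>x. (x i, x j))"
    using \<Gamma>.group_axioms D.group_axioms \<Gamma>_at \<Gamma>_mult i j
    by (simp add: group_hom_def group_hom_axioms_def hom_def)
  then have B: "subgroup ?B (G i \<times>\<times> G j)" by (rule group_hom.subgroup_img_is_subgroup[OF _ S'])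
  then have cov: "D.fin_cover (carrier (G i \<times>\<times> G j)) ?B"
    using pair[OF i j] D.finite_index_iff_fin_cover by blast
  interpret e: group_hom "G i" "G i \<times>\<times> G j" "\<lambda>x. (x, \<one>\<^bsub>G j\<^esub>)"
    using Gi.group_axioms D.group_axioms by (simp add: group_hom_def group_hom_axioms_def hom_def)
  let ?E = "(\<lambda>x. (x, \<one>\<^bsub>G j\<^esub>)) ` carrier (G i)"
  have E: "subgroup ?E (G i \<times>\<times> G j)" by (rule e.img_is_subgroup)
  have "D.fin_cover ?E ?B"
    using D.fin_cover_mono[OF D.fin_cover_subset[OF B D.subgroup_self E cov subgroup.subset[OF E]]] by blast
  then have "Gi.fin_cover (carrier (G i)) {x \<in> carrier (G i). (x, \<one>\<^bsub>G j\<^esub>) \<in> ?B}"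
    by (rule e.fin_cover_preimage[OF B order_refl])
  moreover have "{x \<in> carrier (G i). (x, \<one>\<^bsub>G j\<^esub>) \<in> ?B} \<subseteq> N i {j}"
  proof
    fix x assume "x \<in> {x \<in> carrier (G i). (x, \<one>\<^bsub>G j\<^esub>) \<in> ?B}"
    then obtain s where "s \<in> S" "x = s i" "\<one>\<^bsub>G j\<^esub> = s j" by blast
    then show "x \<in> N i {j}" unfolding N_def by (intro image_eqI[of _ _ s]) auto
  qed
  ultimately show ?thesis by (rule Gi.fin_cover_mono)
qed

text \<open>Each element of \<open>M i\<close> is, for every other index \<open>j\<close>, the
  coordinate of an element of \<open>S\<close> that is trivial at \<open>j\<close>; the witness may
  change with \<open>j\<close>. The set \<open>N i {}\<close> keeps \<open>M i\<close> inside the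
  projection of \<open>S\<close> even when there is no other index.\<close>

definition "M i = carrier (G i) \<inter> (\<Inter>J\<in>insert {} ((\<lambda>j. {j}) ` (I - {i})). N i J)"

lemma M_props:
  assumes i: "i \<in> I"
  shows "subgroup (M i) (G i)" "group.fin_cover (G i) (carrier (G i)) (M i)"
    "M i \<subseteq> N i {}" "\<And>j. j \<in> I \<Longrightarrow> j \<noteq> i \<Longrightarrow> M i \<subseteq> N i {j}"
proof -
  interpret Gi: group "G i" by (rule grp[OF i])
  have N0: "N i {} = (\<lambda>x. x i) ` S" by (simp add: N_def)
  have "subgroup (N i J) (G i) \<and> Gi.fin_cover (carrier (G i)) (N i J)"
    if "J \<in> insert {} ((\<lambda>j. {j}) ` (I - {i}))" for J
  proof -
    have "subgroup (N i {}) (G i)" using N_subgroup[OF i] by simp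
    moreover from this have "Gi.fin_cover (carrier (G i)) (N i {})"
      using single[OF i] Gi.finite_index_iff_fin_cover unfolding N0 by blast
    ultimately show ?thesis using that N_subgroup[OF i] N_fin_cover[OF i] by blast
  qed
  then show "subgroup (M i) (G i)" "Gi.fin_cover (carrier (G i)) (M i)"
    unfolding M_def using Gi.fin_cover_Inter[of "insert {} ((\<lambda>j. {j}) ` (I - {i}))" "N i"] finI by auto
  show "M i \<subseteq> N i {}" "\<And>j. j \<in> I \<Longrightarrow> j \<noteq> i \<Longrightarrow> M i \<subseteq> N i {j}" by (auto simp: M_def)
qed

lemma M_generated:
  assumes i: "i \<in> I"
  shows "\<exists>Y. finite Y \<and> Y \<subseteq> M i \<and> generate (G i) Y = M i"
proof -
  interpret Gi: group "G i" by (rule grp[OF i])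
  obtain E where "finite E" "E \<subseteq> carrier (G i)" "generate (G i) E = carrier (G i)"
    using finitely_presented_fin_gen[OF fp[OF i]] by blast
  then show ?thesis by (rule Gi.fin_cover_finitely_generated[OF M_props(1)[OF i] _ _ _ M_props(2)[OF i]])
qed

text \<open>Commutators with the generators \<open>Y\<close> of \<open>M i\<close> lie in
  \<open>N i\<close> of a set with one more index, because \<open>Y \<subseteq> N i {j}\<close>.
  Each such round is one step down the lower central series, and after finitely many rounds all
  other coordinates can be made trivial.\<close>

lemma nilpotent_chain:
  assumes i: "i \<in> I"
  shows "\<exists>E. finite E \<and> E \<subseteq> M i \<and> E \<subseteq> N i (I - {i}) \<and> pc_chain (G i) (conj_span (G i) (M i) {} E) (M i)"
proof -
  interpret Gi: group "G i" by (rule grp[OF i])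
  note M = M_props[OF i]
  obtain Y where Y: "finite Y" "Y \<subseteq> M i" "generate (G i) Y = M i" using M_generated[OF i] by blast
  have Yc: "Y \<subseteq> carrier (G i)" using Y(2) subgroup.subset[OF M(1)] by blast
  have "\<exists>E. finite E \<and> E \<subseteq> M i \<and> E \<subseteq> N i J \<and> pc_chain (G i) (conj_span (G i) (M i) {} E) (M i)"
    if "finite J" "J \<subseteq> I - {i}" for J
    using that
  proof (induction rule: finite_induct)
    case empty
    have "conj_span (G i) (M i) {} Y = M i"
    proof
      show "conj_span (G i) (M i) {} Y \<subseteq> M i"
        by (rule Gi.conj_span_least[OF M(1)])
          (use Y(2) subgroup.m_closed[OF M(1)] subgroup.m_inv_closed[OF M(1)] in \<open>auto simp: subset_iff\<close>)
      have "generate (G i) Y \<subseteq> conj_span (G i) (M i) {} Y"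
        by (rule Gi.generate_subgroup_incl[OF Gi.conj_span_incl(2)[OF M(1) Yc]])
          (rule Gi.conj_span_subgroup[OF subgroup.subset[OF M(1)] _ Yc], simp)
      then show "M i \<subseteq> conj_span (G i) (M i) {} Y" using Y(3) by simp
    qed
    then show ?case using Y M(3) pc_chain.base[OF M(1)] by (intro exI[of _ Y]) auto
  next
    case (insert j J)
    then obtain E where E: "finite E" "E \<subseteq> M i" "E \<subseteq> N i J" "pc_chain (G i) (conj_span (G i) (M i) {} E) (M i)"
      by auto
    let ?E = "(\<lambda>(e, y). e \<otimes>\<^bsub>G i\<^esub> y \<otimes>\<^bsub>G i\<^esub> inv\<^bsub>G i\<^esub> e \<otimes>\<^bsub>G i\<^esub> inv\<^bsub>G i\<^esub> y) ` (E \<times> Y)"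
    have "pc_chain (G i) (conj_span (G i) (M i) {} ?E) (conj_span (G i) (M i) {} E)"
      by (rule Gi.pc_chain_commutators[OF Y(1) Yc Y(3)[symmetric] E(1,2) refl])
    then have "pc_chain (G i) (conj_span (G i) (M i) {} ?E) (M i)" by (rule pc_chain_trans[OF E(4)])
    moreover have "?E \<subseteq> M i"
    proof (rule image_subsetI)
      fix p assume "p \<in> E \<times> Y"
      then obtain e y where p: "p = (e, y)" "e \<in> M i" "y \<in> M i" using E(2) Y(2) by blast
      then have "e \<otimes>\<^bsub>G i\<^esub> y \<otimes>\<^bsub>G i\<^esub> inv\<^bsub>G i\<^esub> e \<otimes>\<^bsub>G i\<^esub> inv\<^bsub>G i\<^esub> y \<in> M i"
        using subgroup.m_closed[OF M(1)] subgroup.m_inv_closed[OF M(1)] by blast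
      then show "(case p of (e, y) \<Rightarrow> e \<otimes>\<^bsub>G i\<^esub> y \<otimes>\<^bsub>G i\<^esub> inv\<^bsub>G i\<^esub> e \<otimes>\<^bsub>G i\<^esub> inv\<^bsub>G i\<^esub> y) \<in> M i" by (simp add: p(1))
    qed
    moreover have "?E \<subseteq> N i (insert j J)"
    proof (rule image_subsetI)
      fix p assume "p \<in> E \<times> Y"
      then obtain e y where p: "p = (e, y)" "e \<in> N i J" "y \<in> N i {j}"
        using E(3) Y(2) M(4)[of j] insert.prems by blast
      have "e \<otimes>\<^bsub>G i\<^esub> y \<otimes>\<^bsub>G i\<^esub> inv\<^bsub>G i\<^esub> e \<otimes>\<^bsub>G i\<^esub> inv\<^bsub>G i\<^esub> y \<in> N i (J \<union> {j})"
        by (rule N_commutator[OF i _ _ p(2,3)]) (use insert.prems in auto)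
      then show "(case p of (e, y) \<Rightarrow> e \<otimes>\<^bsub>G i\<^esub> y \<otimes>\<^bsub>G i\<^esub> inv\<^bsub>G i\<^esub> e \<otimes>\<^bsub>G i\<^esub> inv\<^bsub>G i\<^esub> y) \<in> N i (insert j J)" by (simp add: p(1))
    qed
    ultimately show ?case using E(1) Y(1) by (intro exI[of _ ?E]) simp
  qed
  then show ?thesis using finI by blast
qed

definition "E i = (SOME E. finite E \<and> E \<subseteq> M i \<and> E \<subseteq> N i (I - {i}) \<and> pc_chain (G i) (conj_span (G i) (M i) {} E) (M i))"

text \<open>A subgroup normal in \<open>M i\<close> with polycyclic quotient whose embedded copy
  lies in \<open>S\<close>. That it is the normal closure of the finite set \<open>E i\<close> later
  gives finite generation of kernels in \<open>S\<close>.\<close>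

definition "L i = conj_span (G i) (M i) {} (E i)"

lemma E_props:
  assumes "i \<in> I"
  shows "finite (E i)" "E i \<subseteq> M i" "E i \<subseteq> N i (I - {i})" "pc_chain (G i) (L i) (M i)"
  using someI_ex[OF nilpotent_chain[OF assms]] unfolding E_def[symmetric] L_def[symmetric] by blast+

lemma L_props:
  assumes i: "i \<in> I"
  shows "subgroup (L i) (G i)" "L i \<subseteq> M i" "L i \<subseteq> N i (I - {i})"
    "\<And>m x. m \<in> M i \<Longrightarrow> x \<in> L i \<Longrightarrow> m \<otimes>\<^bsub>G i\<^esub> x \<otimes>\<^bsub>G i\<^esub> inv\<^bsub>G i\<^esub> m \<in> L i"
proof -
  interpret Gi: group "G i" by (rule grp[OF i])
  note M = M_props[OF i]
  have Ec: "E i \<subseteq> carrier (G i)" using E_props(2)[OF i] subgroup.subset[OF M(1)] by blast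
  show "subgroup (L i) (G i)" "L i \<subseteq> M i" using Gi.pc_chain_subgroup[OF E_props(4)[OF i]] by auto
  show "L i \<subseteq> N i (I - {i})"
    unfolding L_def
  proof (rule Gi.conj_span_least[OF N_subgroup[OF i]])
    fix p e assume "p \<in> M i" "e \<in> E i"
    then show "p \<otimes>\<^bsub>G i\<^esub> e \<otimes>\<^bsub>G i\<^esub> inv\<^bsub>G i\<^esub> p \<in> N i (I - {i})"
      using N_conj[OF i, of "I - {i}" p e] M(3) E_props(3)[OF i] by blast
  qed auto
  show "m \<otimes>\<^bsub>G i\<^esub> x \<otimes>\<^bsub>G i\<^esub> inv\<^bsub>G i\<^esub> m \<in> L i" if "m \<in> M i" "x \<in> L i" for m x
    using Gi.conj_span_conj[OF M(1) _ Ec _ that(1), of "{}" x] that(2) by (simp add: L_def)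
qed

lemma PiE_L_S: "PiE I L \<subseteq> S"
proof
  fix x assume x: "x \<in> PiE I L"
  have "x \<in> carrier \<Gamma>" using x subgroup.mem_carrier[OF L_props(1)] by (auto simp: \<Gamma>_carrier PiE_iff)
  moreover have "emb i (x i) \<in> S" if "i \<in> I" for i
    using N_emb[OF that] L_props(3)[OF that] x that by (auto simp: PiE_iff)
  ultimately show "x \<in> S" by (rule mem_of_components[OF S'])
qed

end

context vsp
begin

text \<open>Only \<open>?J\<close> lies inside the chain from \<open>?N\<close> to
  \<open>?P\<close>, and it has finite index in \<open>S\<close>. The element \<open>g\<close> is
  therefore separated from each of the finitely many cosets of \<open>?J\<close> that make up
  \<open>S\<close>.\<close>

theorem separable_S: "separable \<Gamma> S"
  unfolding separable_def
proof
  fix g assume g: "g \<in> carrier \<Gamma> - S"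
  let ?P = "PiE I M" and ?N = "PiE I L"
  let ?J = "?P \<inter> S"
  have P: "subgroup ?P \<Gamma>" "\<Gamma>.fin_cover (carrier \<Gamma>) ?P" using fin_cover_PiE[of M] M_props by auto
  have pc: "pc_chain \<Gamma> ?N ?P" by (rule pc_chain_PiE[OF E_props(4)])
  have NP: "?N \<subseteq> ?P" using \<Gamma>.pc_chain_subgroup[OF pc] by blast
  have Nn: "p \<otimes>\<^bsub>\<Gamma>\<^esub> x \<otimes>\<^bsub>\<Gamma>\<^esub> inv\<^bsub>\<Gamma>\<^esub> p \<in> ?N" if p: "p \<in> ?P" and x: "x \<in> ?N" for p x
  proof (rule PiE_I)
    have pc: "p \<in> carrier \<Gamma>" "x \<in> carrier \<Gamma>" using p x NP subgroup.mem_carrier[OF P(1)] by blast+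
    fix i assume i: "i \<in> I"
    have "(p \<otimes>\<^bsub>\<Gamma>\<^esub> x \<otimes>\<^bsub>\<Gamma>\<^esub> inv\<^bsub>\<Gamma>\<^esub> p) i = p i \<otimes>\<^bsub>G i\<^esub> x i \<otimes>\<^bsub>G i\<^esub> inv\<^bsub>G i\<^esub> (p i)"
      using i pc by (simp add: \<Gamma>_mult \<Gamma>_inv)
    then show "(p \<otimes>\<^bsub>\<Gamma>\<^esub> x \<otimes>\<^bsub>\<Gamma>\<^esub> inv\<^bsub>\<Gamma>\<^esub> p) i \<in> L i"
      using L_props(4)[OF i PiE_mem[OF p i] PiE_mem[OF x i]] by simp
  next
    fix i assume "i \<notin> I"
    then show "(p \<otimes>\<^bsub>\<Gamma>\<^esub> x \<otimes>\<^bsub>\<Gamma>\<^esub> inv\<^bsub>\<Gamma>\<^esub> p) i = undefined" by (simp add: \<Gamma>_def)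
  qed
  have J: "subgroup ?J \<Gamma>" by (rule \<Gamma>.subgroups_Inter_pair[OF P(1) S'])
  have "\<Gamma>.fin_cover S ?J"
    by (rule \<Gamma>.fin_cover_subset[OF P(1) \<Gamma>.subgroup_self S' P(2) subgroup.subset[OF S']])
  then obtain T where T: "finite T" "T \<subseteq> S" "\<forall>s\<in>S. \<exists>t\<in>T. s \<otimes>\<^bsub>\<Gamma>\<^esub> inv\<^bsub>\<Gamma>\<^esub> t \<in> ?J"
    by (auto simp: \<Gamma>.fin_cover_def)
  \<comment> \<open>For \<open>g = s \<otimes> c\<close> with \<open>s\<close> in the coset of
    \<open>t\<close>, the element \<open>g \<otimes> inv t\<close> is a conjugate of
    \<open>c\<close> times an element of \<open>?J\<close>. A normal subgroup inside all the
    \<open>K\<close> obtained here thus separates \<open>g\<close> from \<open>S\<close>.\<close>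
  have "\<exists>K. subgroup K \<Gamma> \<and> ?J \<subseteq> K \<and> \<Gamma>.fin_cover (carrier \<Gamma>) K \<and> g \<otimes>\<^bsub>\<Gamma>\<^esub> inv\<^bsub>\<Gamma>\<^esub> t \<notin> K"
    if t: "t \<in> T" for t
  proof (cases "g \<otimes>\<^bsub>\<Gamma>\<^esub> inv\<^bsub>\<Gamma>\<^esub> t \<in> ?P")
    case False
    then show ?thesis using P by blast
  next
    case True
    have tS: "t \<in> S" "t \<in> carrier \<Gamma>" using t T(2) S_carrier by blast+
    have "g \<otimes>\<^bsub>\<Gamma>\<^esub> inv\<^bsub>\<Gamma>\<^esub> t \<notin> ?J"
    proof
      assume "g \<otimes>\<^bsub>\<Gamma>\<^esub> inv\<^bsub>\<Gamma>\<^esub> t \<in> ?J"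
      then have "g \<otimes>\<^bsub>\<Gamma>\<^esub> inv\<^bsub>\<Gamma>\<^esub> t \<otimes>\<^bsub>\<Gamma>\<^esub> t \<in> S" using tS(1) subgroup.m_closed[OF S'] by blast
      then show False using g tS by (simp add: \<Gamma>.m_assoc)
    qed
    moreover have "?N \<subseteq> ?J" using NP PiE_L_S by blast
    ultimately obtain K where K: "subgroup K \<Gamma>" "?J \<subseteq> K" "K \<subseteq> ?P" "\<Gamma>.fin_cover ?P K"
      "g \<otimes>\<^bsub>\<Gamma>\<^esub> inv\<^bsub>\<Gamma>\<^esub> t \<notin> K"
      using \<Gamma>.pc_chain_separable[OF pc Nn J _ _ True] by blast
    then show ?thesis using \<Gamma>.fin_cover_trans[OF K(1) P(1) \<Gamma>.subgroup_self subgroup.subset[OF P(1)] P(2) K(4)] by blast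
  qed
  then obtain K where K: "\<And>t. t \<in> T \<Longrightarrow> subgroup (K t) \<Gamma> \<and> ?J \<subseteq> K t \<and> \<Gamma>.fin_cover (carrier \<Gamma>) (K t) \<and>
      g \<otimes>\<^bsub>\<Gamma>\<^esub> inv\<^bsub>\<Gamma>\<^esub> t \<notin> K t" by metis
  let ?K = "carrier \<Gamma> \<inter> (\<Inter>t\<in>T. K t)"
  have sK: "subgroup ?K \<Gamma>" "\<Gamma>.fin_cover (carrier \<Gamma>) ?K"
    using \<Gamma>.fin_cover_Inter[OF T(1), of K] K by blast+
  obtain C where C: "C \<lhd> \<Gamma>" "C \<subseteq> ?K" "finite_index \<Gamma> C" using \<Gamma>.normal_core[OF sK] by blast
  have "g \<notin> S <#>\<^bsub>\<Gamma>\<^esub> C"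
  proof
    assume "g \<in> S <#>\<^bsub>\<Gamma>\<^esub> C"
    then obtain s c where sc: "s \<in> S" "c \<in> C" "g = s \<otimes>\<^bsub>\<Gamma>\<^esub> c" by (auto simp: set_mult_def)
    obtain t where t: "t \<in> T" "s \<otimes>\<^bsub>\<Gamma>\<^esub> inv\<^bsub>\<Gamma>\<^esub> t \<in> ?J" using T(3) sc(1) by blast
    have cc: "s \<in> carrier \<Gamma>" "c \<in> carrier \<Gamma>" "t \<in> carrier \<Gamma>"
      using sc t T(2) S_carrier subgroup.mem_carrier[OF normal_imp_subgroup[OF C(1)]] by blast+
    have Kt: "subgroup (K t) \<Gamma>" "?J \<subseteq> K t" "g \<otimes>\<^bsub>\<Gamma>\<^esub> inv\<^bsub>\<Gamma>\<^esub> t \<notin> K t" using K[OF t(1)] by auto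
    have "s \<otimes>\<^bsub>\<Gamma>\<^esub> c \<otimes>\<^bsub>\<Gamma>\<^esub> inv\<^bsub>\<Gamma>\<^esub> s \<in> K t" using \<Gamma>.normal_conjD(1)[OF C(1) cc(1) sc(2)] C(2) t(1) by blast
    then have "(s \<otimes>\<^bsub>\<Gamma>\<^esub> c \<otimes>\<^bsub>\<Gamma>\<^esub> inv\<^bsub>\<Gamma>\<^esub> s) \<otimes>\<^bsub>\<Gamma>\<^esub> (s \<otimes>\<^bsub>\<Gamma>\<^esub> inv\<^bsub>\<Gamma>\<^esub> t) \<in> K t"
      using t(2) Kt(2) subgroup.m_closed[OF Kt(1)] by blast
    then show False using Kt(3) cc sc(3) by (simp add: \<Gamma>.word_simps)
  qed
  then show "\<exists>K. K \<lhd> \<Gamma> \<and> finite_index \<Gamma> K \<and> g \<notin> S <#>\<^bsub>\<Gamma>\<^esub> K" using C by blast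
qed

text \<open>Modulo the product of the \<open>L i\<close> the kernel is virtually polycyclic, hence
  finitely generated. Each \<open>L i\<close> with \<open>i \<noteq> j\<close> is the normal closure
  of \<open>E i\<close> in \<open>M i\<close>, and elements of the kernel itself realise conjugation
  by all of \<open>M i\<close>.\<close>

lemma kernel_generated:
  assumes j: "j \<in> I"
  shows "\<exists>E'. finite E' \<and> generate \<Gamma> E' = {s \<in> S. s j = \<one>\<^bsub>G j\<^esub>}"
proof -
  let ?K = "{s \<in> S. s j = \<one>\<^bsub>G j\<^esub>}"
  have K: "subgroup ?K \<Gamma>" using kernel_subgroup[of "{j}"] j by simp
  note Kc = subgroup.mem_carrier[OF K]
  \<comment> \<open>A trivial factor at \<open>j\<close> adapts both ends of the chain to the kernel
    of the coordinate \<open>j\<close>.\<close>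
  define A where "A i = (if i = j then {\<one>\<^bsub>G j\<^esub>} else L i)" for i
  define B where "B i = (if i = j then {\<one>\<^bsub>G j\<^esub>} else M i)" for i
  have pc: "pc_chain \<Gamma> (PiE I A) (PiE I B)"
  proof (rule pc_chain_PiE)
    fix i assume i: "i \<in> I"
    have "pc_chain (G j) {\<one>\<^bsub>G j\<^esub>} {\<one>\<^bsub>G j\<^esub>}" using group.triv_subgroup[OF grp[OF j]] by (rule pc_chain.base)
    then show "pc_chain (G i) (A i) (B i)" using E_props(4)[OF i] by (simp add: A_def B_def)
  qed
  note AB = \<Gamma>.pc_chain_subgroup[OF pc]
  have B_eq: "PiE I B \<inter> ?K = PiE I M \<inter> ?K"
  proof (intro Set.set_eqI iffI)
    fix x assume x: "x \<in> PiE I B \<inter> ?K"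
    then have "x i \<in> M i" if "i \<in> I" for i
      using PiE_mem[of x I B, OF _ that] subgroup.one_closed[OF M_props(1)[OF j]]
      by (cases "i = j") (simp_all add: B_def)
    then show "x \<in> PiE I M \<inter> ?K" using x by (auto simp: PiE_def Pi_def)
  next
    fix x assume "x \<in> PiE I M \<inter> ?K"
    then show "x \<in> PiE I B \<inter> ?K" by (auto simp: PiE_def Pi_def B_def)
  qed
  let ?J = "PiE I B \<inter> ?K"
  have P: "subgroup (PiE I M) \<Gamma>" "\<Gamma>.fin_cover (carrier \<Gamma>) (PiE I M)" using fin_cover_PiE[of M] M_props by auto
  have "\<Gamma>.fin_cover ?K ?J"
    unfolding B_eq by (rule \<Gamma>.fin_cover_subset[OF P(1) \<Gamma>.subgroup_self K P(2) subgroup.subset[OF K]])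
  then obtain T where T: "finite T" "T \<subseteq> ?K" "\<forall>s\<in>?K. \<exists>t\<in>T. s \<otimes>\<^bsub>\<Gamma>\<^esub> inv\<^bsub>\<Gamma>\<^esub> t \<in> ?J"
    by (auto simp: \<Gamma>.fin_cover_def)
  have "A i \<subseteq> L i" if "i \<in> I" for i
    using that subgroup.one_closed[OF L_props(1)[OF j]] by (auto simp: A_def)
  then have "PiE I A \<subseteq> PiE I L" by (rule PiE_mono)
  then have AS: "PiE I A \<subseteq> S" using PiE_L_S by blast
  have "PiE I A \<subseteq> ?J"
  proof
    fix x assume x: "x \<in> PiE I A"
    then have "x j = \<one>\<^bsub>G j\<^esub>" using PiE_mem[OF x j] by (simp add: A_def)
    then show "x \<in> ?J" using x AS AB by blast
  qed
  moreover have "subgroup ?J \<Gamma>" using AB by (intro \<Gamma>.subgroups_Inter_pair K) blast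
  ultimately obtain E1 where E1: "finite E1" "E1 \<subseteq> ?J" "generate \<Gamma> (PiE I A \<union> E1) = ?J"
    using \<Gamma>.pc_chain_max[OF pc, of ?J] by blast
  have "\<exists>Y. finite Y \<and> Y \<subseteq> ?K \<and> generate (G i) ((\<lambda>x. x i) ` Y) = M i" if i: "i \<in> I - {j}" for i
  proof -
    obtain Y where Y: "finite Y" "Y \<subseteq> M i" "generate (G i) Y = M i" using M_generated[of i] i by blast
    have "i \<in> I" "j \<noteq> i" using i by auto
    then have "M i \<subseteq> (\<lambda>x. x i) ` ?K" using M_props(4)[of i j] j by (simp add: N_def)
    then have "Y \<subseteq> (\<lambda>x. x i) ` ?K" using Y(2) by blast
    then obtain Y' where "Y' \<subseteq> ?K" "finite Y'" "Y = (\<lambda>x. x i) ` Y'"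
      using finite_subset_image[OF Y(1)] by blast
    then show ?thesis using Y(3) by blast
  qed
  then have "\<forall>i\<in>I - {j}. \<exists>Y. finite Y \<and> Y \<subseteq> ?K \<and> generate (G i) ((\<lambda>x. x i) ` Y) = M i" by blast
  from bchoice[OF this] obtain Y where
    Y: "\<forall>i\<in>I - {j}. finite (Y i) \<and> Y i \<subseteq> ?K \<and> generate (G i) ((\<lambda>x. x i) ` Y i) = M i" ..
  \<comment> \<open>Besides coset representatives and generators modulo the product of the
    \<open>A i\<close>, this contains the embedded sets \<open>E i\<close> and the lifts
    \<open>Y i\<close>, whose coordinates generate \<open>M i\<close> and spread \<open>E i\<close>
    over \<open>L i\<close>.\<close>
  define E0 where "E0 = E1 \<union> T \<union> (\<Union>i\<in>I - {j}. emb i ` E i \<union> Y i)"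
  have E0_fin: "finite E0" unfolding E0_def using E1(1) T(1) finI E_props(1) Y by simp
  have embK: "emb i ` E i \<subseteq> ?K" if i: "i \<in> I - {j}" for i
    using N_emb[of i] E_props(3)[of i] i emb_at[OF j, of i] by auto
  have "E0 \<subseteq> ?K" unfolding E0_def using E1(2) T(2) embK Y by blast
  then have E0K: "generate \<Gamma> E0 \<subseteq> ?K" by (rule \<Gamma>.generate_subgroup_incl[OF _ K])
  have E0c: "E0 \<subseteq> carrier \<Gamma>" using \<open>E0 \<subseteq> ?K\<close> Kc by blast
  have sE0: "subgroup (generate \<Gamma> E0) \<Gamma>" by (rule \<Gamma>.generate_is_subgroup[OF E0c])
  have incl: "E0 \<subseteq> generate \<Gamma> E0" by (blast intro: generate.incl)
  have L_E0: "emb i x \<in> generate \<Gamma> E0" if i: "i \<in> I - {j}" and x: "x \<in> L i" for i x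
  proof -
    have iI: "i \<in> I" using i by blast
    interpret p: group_hom \<Gamma> "G i" "\<lambda>x. x i" by (rule proj_hom[OF iI])
    interpret e: group_hom "G i" \<Gamma> "emb i" by (rule emb_hom[OF iI])
    have YE0: "Y i \<subseteq> E0" unfolding E0_def using i by blast
    have Mi: "M i \<subseteq> (\<lambda>x. x i) ` generate \<Gamma> E0"
    proof -
      have "M i = generate (G i) ((\<lambda>x. x i) ` Y i)" using Y i by blast
      also have "\<dots> = (\<lambda>x. x i) ` generate \<Gamma> (Y i)"
        using \<Gamma>.hom_image_generate[OF grp[OF iI] p.homh subset_trans[OF YE0 E0c]] by simp
      also have "\<dots> \<subseteq> (\<lambda>x. x i) ` generate \<Gamma> E0" using \<Gamma>.mono_generate[OF YE0] by blast
      finally show ?thesis .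
    qed
    have "L i \<subseteq> {y \<in> carrier (G i). emb i y \<in> generate \<Gamma> E0}"
      unfolding L_def
    proof (rule p.H.conj_span_least[OF e.subgroup_preimage[OF sE0]])
      fix m y assume m: "m \<in> M i" and y: "y \<in> E i"
      obtain k where k: "k \<in> generate \<Gamma> E0" "m = k i" using m Mi by blast
      have yc: "y \<in> carrier (G i)" using y E_props(2)[OF iI] subgroup.mem_carrier[OF M_props(1)[OF iI]] by blast
      have kc: "k \<in> carrier \<Gamma>" using k(1) subgroup.mem_carrier[OF sE0] by blast
      have ki: "k i \<in> carrier (G i)" by (rule \<Gamma>_at[OF kc iI])
      have "emb i y \<in> generate \<Gamma> E0" using i y incl unfolding E0_def by blast
      then have "k \<otimes>\<^bsub>\<Gamma>\<^esub> emb i y \<otimes>\<^bsub>\<Gamma>\<^esub> inv\<^bsub>\<Gamma>\<^esub> k \<in> generate \<Gamma> E0"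
        using k(1) subgroup.m_closed[OF sE0] subgroup.m_inv_closed[OF sE0] by blast
      \<comment> \<open>Conjugating an element supported at \<open>i\<close> involves only the
        coordinate \<open>k i\<close>, so the uncontrolled other coordinates of \<open>k\<close> do
        no harm.\<close>
      moreover have "k \<otimes>\<^bsub>\<Gamma>\<^esub> emb i y \<otimes>\<^bsub>\<Gamma>\<^esub> inv\<^bsub>\<Gamma>\<^esub> k = emb i (k i \<otimes>\<^bsub>G i\<^esub> y \<otimes>\<^bsub>G i\<^esub> inv\<^bsub>G i\<^esub> (k i))"
      proof (rule \<Gamma>_eqI)
        show "k \<otimes>\<^bsub>\<Gamma>\<^esub> emb i y \<otimes>\<^bsub>\<Gamma>\<^esub> inv\<^bsub>\<Gamma>\<^esub> k \<in> carrier \<Gamma>" using kc emb_carrier[OF iI yc] by simp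
        show "emb i (k i \<otimes>\<^bsub>G i\<^esub> y \<otimes>\<^bsub>G i\<^esub> inv\<^bsub>G i\<^esub> (k i)) \<in> carrier \<Gamma>"
          by (rule emb_carrier[OF iI]) (use ki yc in simp)
        fix l assume l: "l \<in> I"
        interpret Gl: group "G l" by (rule grp[OF l])
        have kl: "k l \<in> carrier (G l)" by (rule \<Gamma>_at[OF kc l])
        have "(k \<otimes>\<^bsub>\<Gamma>\<^esub> emb i y \<otimes>\<^bsub>\<Gamma>\<^esub> inv\<^bsub>\<Gamma>\<^esub> k) l = k l \<otimes>\<^bsub>G l\<^esub> emb i y l \<otimes>\<^bsub>G l\<^esub> inv\<^bsub>G l\<^esub> (k l)"
          using l kc by (simp add: \<Gamma>_mult \<Gamma>_inv)
        then show "(k \<otimes>\<^bsub>\<Gamma>\<^esub> emb i y \<otimes>\<^bsub>\<Gamma>\<^esub> inv\<^bsub>\<Gamma>\<^esub> k) l = emb i (k i \<otimes>\<^bsub>G i\<^esub> y \<otimes>\<^bsub>G i\<^esub> inv\<^bsub>G i\<^esub> (k i)) l"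
          using kl by (simp add: emb_at[OF l])
      qed
      ultimately show "m \<otimes>\<^bsub>G i\<^esub> y \<otimes>\<^bsub>G i\<^esub> inv\<^bsub>G i\<^esub> m \<in> {y \<in> carrier (G i). emb i y \<in> generate \<Gamma> E0}"
        using ki yc by (simp add: k(2))
    qed simp
    then show ?thesis using x by blast
  qed
  have AE0: "PiE I A \<subseteq> generate \<Gamma> E0"
  proof
    fix x assume x: "x \<in> PiE I A"
    have xc: "x \<in> carrier \<Gamma>" using x AS S_carrier by blast
    show "x \<in> generate \<Gamma> E0"
    proof (rule mem_of_components[OF sE0 xc])
      fix i assume i: "i \<in> I"
      show "emb i (x i) \<in> generate \<Gamma> E0"
      proof (cases "i = j")
        case True
        have "x j = \<one>\<^bsub>G j\<^esub>" using PiE_mem[OF x j] by (simp add: A_def)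
        then have "emb i (x i) = \<one>\<^bsub>\<Gamma>\<^esub>" using group_hom.hom_one[OF emb_hom[OF j]] True by simp
        then show ?thesis using subgroup.one_closed[OF sE0] by simp
      next
        case False
        have "x i \<in> L i" using PiE_mem[OF x i] False by (simp add: A_def)
        then show ?thesis using L_E0 i False by blast
      qed
    qed
  qed
  have "generate \<Gamma> (PiE I A \<union> E1) \<subseteq> generate \<Gamma> E0"
    by (rule \<Gamma>.generate_subgroup_incl[OF _ sE0]) (use AE0 incl in \<open>auto simp: E0_def\<close>)
  then have JE0: "?J \<subseteq> generate \<Gamma> E0" unfolding E1(3) .
  have "k \<in> generate \<Gamma> E0" if k: "k \<in> ?K" for k
  proof -
    obtain t where t: "t \<in> T" "k \<otimes>\<^bsub>\<Gamma>\<^esub> inv\<^bsub>\<Gamma>\<^esub> t \<in> ?J" using T(3) k by blast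
    have "t \<in> generate \<Gamma> E0" using t(1) incl by (auto simp: E0_def)
    then have "k \<otimes>\<^bsub>\<Gamma>\<^esub> inv\<^bsub>\<Gamma>\<^esub> t \<otimes>\<^bsub>\<Gamma>\<^esub> t \<in> generate \<Gamma> E0" using t(2) JE0 subgroup.m_closed[OF sE0] by blast
    moreover have "k \<in> carrier \<Gamma>" "t \<in> carrier \<Gamma>" using k t(1) T(2) Kc by blast+
    ultimately show ?thesis by (simp add: \<Gamma>.m_assoc)
  qed
  then have "generate \<Gamma> E0 = ?K" using E0K by blast
  then show ?thesis using E0_fin by blast
qed

text \<open>Finite generation of \<open>S\<close> is a consequence, not an assumption:
  \<open>S\<close> is an extension of its projection, which has finite index in \<open>G j\<close>,
  by a finitely generated kernel.\<close>

lemma S_generated: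
  assumes j: "j \<in> I"
  shows "\<exists>E'. finite E' \<and> E' \<subseteq> S \<and> generate \<Gamma> E' = S"
proof -
  let ?K = "{s \<in> S. s j = \<one>\<^bsub>G j\<^esub>}"
  obtain E1 where E1: "finite E1" "generate \<Gamma> E1 = ?K" using kernel_generated[OF j] by blast
  interpret p: group_hom \<Gamma> "G j" "\<lambda>x. x j" by (rule proj_hom[OF j])
  have H: "subgroup ((\<lambda>x. x j) ` S) (G j)" by (rule p.subgroup_img_is_subgroup[OF S'])
  have cov: "p.H.fin_cover (carrier (G j)) ((\<lambda>x. x j) ` S)" using single[OF j] p.H.finite_index_iff_fin_cover[OF H] by blast
  obtain X where X: "finite X" "X \<subseteq> carrier (G j)" "generate (G j) X = carrier (G j)"
    using finitely_presented_fin_gen[OF fp[OF j]] by blast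
  obtain Y where Y: "finite Y" "Y \<subseteq> (\<lambda>x. x j) ` S" "generate (G j) Y = (\<lambda>x. x j) ` S"
    using p.H.fin_cover_finitely_generated[OF H X cov] by blast
  obtain Z where Z: "Z \<subseteq> S" "finite Z" "Y = (\<lambda>x. x j) ` Z" using finite_subset_image[OF Y(1,2)] by blast
  have Zc: "Z \<subseteq> carrier \<Gamma>" using Z(1) S_carrier by blast
  have E1S: "E1 \<subseteq> ?K" unfolding E1(2)[symmetric] by (blast intro: generate.incl)
  have sub: "E1 \<union> Z \<subseteq> S" using E1S Z(1) by blast
  have c: "E1 \<union> Z \<subseteq> carrier \<Gamma>" using sub S_carrier by blast
  have sg: "subgroup (generate \<Gamma> (E1 \<union> Z)) \<Gamma>" by (rule \<Gamma>.generate_is_subgroup[OF c])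
  have "s \<in> generate \<Gamma> (E1 \<union> Z)" if s: "s \<in> S" for s
  proof -
    have "s j \<in> generate (G j) ((\<lambda>x. x j) ` Z)" using Y(3) Z(3) s by blast
    also have "\<dots> = (\<lambda>x. x j) ` generate \<Gamma> Z" using \<Gamma>.hom_image_generate[OF grp[OF j] p.homh Zc] by simp
    finally obtain z where z: "z \<in> generate \<Gamma> Z" "s j = z j" by blast
    have zS: "z \<in> S" using z(1) \<Gamma>.generate_subset[OF S' Z(1)] by blast
    have cc: "s \<in> carrier \<Gamma>" "z \<in> carrier \<Gamma>" "z j \<in> carrier (G j)" using s zS S_carrier \<Gamma>_at[OF S_carrier j] by auto
    have "s \<otimes>\<^bsub>\<Gamma>\<^esub> inv\<^bsub>\<Gamma>\<^esub> z \<in> S" using s zS subgroup.m_closed[OF S'] subgroup.m_inv_closed[OF S'] by blast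
    moreover have "(s \<otimes>\<^bsub>\<Gamma>\<^esub> inv\<^bsub>\<Gamma>\<^esub> z) j = \<one>\<^bsub>G j\<^esub>" using j cc z(2) by (simp add: \<Gamma>_mult \<Gamma>_inv)
    ultimately have "s \<otimes>\<^bsub>\<Gamma>\<^esub> inv\<^bsub>\<Gamma>\<^esub> z \<in> generate \<Gamma> E1" using E1(2) by blast
    then have "s \<otimes>\<^bsub>\<Gamma>\<^esub> inv\<^bsub>\<Gamma>\<^esub> z \<in> generate \<Gamma> (E1 \<union> Z)" using \<Gamma>.mono_generate[of E1 "E1 \<union> Z"] by blast
    moreover have "z \<in> generate \<Gamma> (E1 \<union> Z)" using z(1) \<Gamma>.mono_generate[of Z "E1 \<union> Z"] by blast
    ultimately have "s \<otimes>\<^bsub>\<Gamma>\<^esub> inv\<^bsub>\<Gamma>\<^esub> z \<otimes>\<^bsub>\<Gamma>\<^esub> z \<in> generate \<Gamma> (E1 \<union> Z)" using subgroup.m_closed[OF sg] by blast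
    then show ?thesis using cc by (simp add: \<Gamma>.m_assoc)
  qed
  then have "generate \<Gamma> (E1 \<union> Z) = S" using \<Gamma>.generate_subset[OF S' sub] by blast
  then show ?thesis using E1(1) Z(2) sub by (intro exI[of _ "E1 \<union> Z"]) simp
qed

lemma restrict_hom: "J \<subseteq> I \<Longrightarrow> group_hom \<Gamma> (product_group J G) (\<lambda>x. restrict x J)"
  using grp \<Gamma>.group_axioms unfolding group_hom_def group_hom_axioms_def hom_def
  by (auto simp: \<Gamma>_def subset_iff restrict_def intro!: ext)

lemma vsp_restrict:
  assumes J: "J \<subseteq> I"
  shows "vsp J G ((\<lambda>x. restrict x J) ` S)"
proof (rule vsp.intro)
  show "finite J" using finite_subset[OF J finI] .
  show "finitely_presented (G i)" if "i \<in> J" for i using fp J that by blast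
  show "subgroup ((\<lambda>x. restrict x J) ` S) (product_group J G)"
    by (rule group_hom.subgroup_img_is_subgroup[OF restrict_hom[OF J] S'])
  have "(\<lambda>x. x i) ` (\<lambda>x. restrict x J) ` S = (\<lambda>x. x i) ` S" if "i \<in> J" for i
    unfolding image_image using that by simp
  then show "finite_index (G i) ((\<lambda>x. x i) ` (\<lambda>x. restrict x J) ` S)" if "i \<in> J" for i
    using single J that by auto
  have "(\<lambda>x. (x i, x j)) ` (\<lambda>x. restrict x J) ` S = (\<lambda>x. (x i, x j)) ` S" if "i \<in> J" "j \<in> J" for i j
    unfolding image_image using that by simp
  then show "finite_index (G i \<times>\<times> G j) ((\<lambda>x. (x i, x j)) ` (\<lambda>x. restrict x J) ` S)"
    if "i \<in> J" "j \<in> J" "i \<noteq> j" for i j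
    using pair[of i j] J that by (auto simp: subset_iff)
qed

text \<open>The kernel of a surjection from a free group onto \<open>S\<close> is the intersection
  of the kernels \<open>U\<close> and \<open>V\<close> onto the two projections. Both are finitely
  normally generated because the projections are finitely presented.\<close>

lemma finitely_presented_step:
  assumes j: "j \<in> I"
    and fpT: "finitely_presented (product_group (I - {j}) G\<lparr>carrier := (\<lambda>x. restrict x (I - {j})) ` S\<rparr>)"
  shows "finitely_presented (\<Gamma>\<lparr>carrier := S\<rparr>)"
proof -
  let ?r = "\<lambda>x. restrict x (I - {j})"
  let ?\<Gamma>' = "product_group (I - {j}) G"
  let ?T = "?\<Gamma>'\<lparr>carrier := ?r ` S\<rparr>"
  let ?H = "(\<lambda>x. x j) ` S"
  let ?GH = "G j\<lparr>carrier := ?H\<rparr>"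
  let ?S = "\<Gamma>\<lparr>carrier := S\<rparr>"
  interpret p: group_hom \<Gamma> "G j" "\<lambda>x. x j" by (rule proj_hom[OF j])
  interpret r: group_hom \<Gamma> ?\<Gamma>' ?r by (rule restrict_hom) blast
  have H: "subgroup ?H (G j)" by (rule p.subgroup_img_is_subgroup[OF S'])
  have Hcov: "p.H.fin_cover (carrier (G j)) ?H" using single[OF j] p.H.finite_index_iff_fin_cover[OF H] by blast
  have fpH: "finitely_presented ?GH" by (rule finitely_presented_finite_index[OF fp[OF j] H Hcov])
  have gS: "group ?S" by (rule \<Gamma>.subgroup_imp_group[OF S'])
  obtain ES where ES: "finite ES" "ES \<subseteq> S" "generate \<Gamma> ES = S" using S_generated[OF j] by blast
  obtain X :: "nat set" and \<pi> where X: "finite X" and \<pi>: "\<pi> \<in> hom (free_group X) ?S"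
    "\<pi> ` carrier (free_group X) = S"
    using free_group_onto[OF gS ES(1)] ES(2,3) \<Gamma>.generate_consistent[OF ES(2) S'] by auto
  define F where "F = free_group X"
  interpret F: group F unfolding F_def by (rule group_free_group)
  have \<pi>F: "\<pi> \<in> hom F ?S" "\<pi> ` carrier F = S" using \<pi> by (simp_all add: F_def)
  interpret \<pi>: group_hom F \<Gamma> \<pi>
    using \<pi>F(1) F.group_axioms \<Gamma>.group_axioms S_carrier
    by (auto simp: group_hom_def group_hom_axioms_def hom_def)
  have \<pi>S: "\<pi> w \<in> S" if "w \<in> carrier F" for w using \<pi>F(2) that by blast
  have hp: "(\<lambda>w. \<pi> w j) \<in> hom F ?GH" "(\<lambda>w. \<pi> w j) ` carrier F = ?H"
    using \<pi>S \<pi>F(2) \<Gamma>_mult[OF j] by (auto simp: hom_def image_image[symmetric, of "\<lambda>x. x j" \<pi>])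
  have hr: "(\<lambda>w. ?r (\<pi> w)) \<in> hom F ?T" "(\<lambda>w. ?r (\<pi> w)) ` carrier F = ?r ` S"
  proof -
    have "?r (\<pi> (v \<otimes>\<^bsub>F\<^esub> w)) = ?r (\<pi> v) \<otimes>\<^bsub>?\<Gamma>'\<^esub> ?r (\<pi> w)" if "v \<in> carrier F" "w \<in> carrier F" for v w
      using that r.hom_mult[of "\<pi> v" "\<pi> w"] by (simp only: \<pi>.hom_mult \<pi>.hom_closed)
    then show "(\<lambda>w. ?r (\<pi> w)) \<in> hom F ?T" using \<pi>S unfolding hom_def by auto
    show "(\<lambda>w. ?r (\<pi> w)) ` carrier F = ?r ` S" unfolding \<pi>F(2)[symmetric] image_image ..
  qed
  define V where "V = kernel F ?GH (\<lambda>w. \<pi> w j)"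
  define U where "U = kernel F ?T (\<lambda>w. ?r (\<pi> w))"
  obtain RV where RV: "finite RV" "RV \<subseteq> carrier F" "V = normal_closure F RV"
    using finitely_presented_kernel[OF fpH X hp(1)[unfolded F_def]] hp(2) unfolding V_def F_def by auto
  obtain RU where RU: "finite RU" "RU \<subseteq> carrier F" "U = normal_closure F RU"
    using finitely_presented_kernel[OF fpT X hr(1)[unfolded F_def]] hr(2) unfolding U_def F_def by auto
  have Vmem: "w \<in> V \<longleftrightarrow> w \<in> carrier F \<and> \<pi> w j = \<one>\<^bsub>G j\<^esub>" for w by (simp add: V_def kernel_def)
  have Umem: "w \<in> U \<longleftrightarrow> w \<in> carrier F \<and> (\<forall>i\<in>I - {j}. \<pi> w i = \<one>\<^bsub>G i\<^esub>)" for w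
  proof -
    have "?r (\<pi> w) = (\<lambda>i\<in>I - {j}. \<one>\<^bsub>G i\<^esub>) \<longleftrightarrow> (\<forall>i\<in>I - {j}. \<pi> w i = \<one>\<^bsub>G i\<^esub>)"
      by (auto simp: restrict_def fun_eq_iff)
    then show ?thesis by (simp add: U_def kernel_def)
  qed
  have UV: "U \<inter> V = kernel F ?S \<pi>"
  proof (intro Set.set_eqI iffI)
    fix w assume w: "w \<in> U \<inter> V"
    then have wc: "w \<in> carrier F" using Vmem by blast
    have "\<pi> w = \<one>\<^bsub>\<Gamma>\<^esub>"
    proof (rule \<Gamma>_eqI)
      fix i assume "i \<in> I"
      then show "\<pi> w i = \<one>\<^bsub>\<Gamma>\<^esub> i" using w Umem Vmem \<Gamma>_one by (cases "i = j") auto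
    qed (use wc in auto)
    then show "w \<in> kernel F ?S \<pi>" using wc by (simp add: kernel_def)
  next
    fix w assume "w \<in> kernel F ?S \<pi>"
    then have "w \<in> carrier F" "\<pi> w = \<one>\<^bsub>\<Gamma>\<^esub>" by (auto simp: kernel_def)
    then show "w \<in> U \<inter> V" using Umem Vmem \<Gamma>_one j by simp
  qed
  have sV: "subgroup V F" using F.normal_closure_normal[OF RV(2)] RV(3) normal_imp_subgroup by blast
  have sU: "subgroup U F" using F.normal_closure_normal[OF RU(2)] RU(3) normal_imp_subgroup by blast
  let ?K = "{s \<in> S. s j = \<one>\<^bsub>G j\<^esub>}"
  obtain EK where EK: "finite EK" "generate \<Gamma> EK = ?K" using kernel_generated[OF j] by blast
  have EKK: "EK \<subseteq> ?K" unfolding EK(2)[symmetric] by (blast intro: generate.incl)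
  then have "EK \<subseteq> \<pi> ` carrier F" unfolding \<pi>F(2) by blast
  then obtain W where W: "W \<subseteq> carrier F" "finite W" "EK = \<pi> ` W" using finite_subset_image[OF EK(1)] by blast
  have WV: "W \<subseteq> V" using W EKK Vmem by blast
  \<comment> \<open>Modulo \<open>U \<inter> V\<close>, the group \<open>V\<close> is the kernel of
    coordinate \<open>j\<close> on \<open>S\<close>, and \<open>W\<close> lifts generators of that
    kernel.\<close>
  have gen: "generate F (W \<union> (U \<inter> V)) = V"
  proof
    show "generate F (W \<union> (U \<inter> V)) \<subseteq> V" by (rule F.generate_subgroup_incl[OF _ sV]) (use WV in blast)
    have sg: "subgroup (generate F (W \<union> (U \<inter> V))) F"
      by (rule F.generate_is_subgroup) (use W(1) subgroup.subset[OF sU] in blast)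
    show "V \<subseteq> generate F (W \<union> (U \<inter> V))"
    proof
      fix v assume v: "v \<in> V"
      then have vc: "v \<in> carrier F" "\<pi> v \<in> ?K" using Vmem \<pi>S by auto
      have "\<pi> v \<in> \<pi> ` generate F W"
        using vc(2) EK(2) W(3) F.hom_image_generate[OF \<Gamma>.group_axioms \<pi>.homh W(1)] by simp
      then obtain w where w: "w \<in> generate F W" "\<pi> v = \<pi> w" by blast
      have wc: "w \<in> carrier F" using w(1) F.generate_in_carrier[OF W(1)] by blast
      have "inv\<^bsub>F\<^esub> w \<otimes>\<^bsub>F\<^esub> v \<in> U \<inter> V" unfolding UV using wc vc w(2) by (simp add: kernel_def)
      then have "inv\<^bsub>F\<^esub> w \<otimes>\<^bsub>F\<^esub> v \<in> generate F (W \<union> (U \<inter> V))" by (blast intro: generate.incl)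
      moreover have "w \<in> generate F (W \<union> (U \<inter> V))" using w(1) F.mono_generate[of W "W \<union> (U \<inter> V)"] by blast
      ultimately have "w \<otimes>\<^bsub>F\<^esub> (inv\<^bsub>F\<^esub> w \<otimes>\<^bsub>F\<^esub> v) \<in> generate F (W \<union> (U \<inter> V))" using subgroup.m_closed[OF sg] by blast
      then show "v \<in> generate F (W \<union> (U \<inter> V))" using wc vc by simp
    qed
  qed
  define h where "h w = \<pi> w j" for w
  interpret h: group_hom F "G j" h
    using F.group_axioms p.H.group_axioms \<Gamma>_mult[OF j] \<Gamma>_at[OF _ j]
    by (simp add: group_hom_def group_hom_axioms_def hom_def h_def)
  have hF: "h ` carrier F = ?H" using hp(2) by (simp add: h_def)
  note Mj = M_props[OF j]
  have MH: "M j \<subseteq> ?H" using Mj(3) by (simp add: N_def)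
  let ?P = "{w \<in> carrier F. h w \<in> M j}" and ?N = "{w \<in> carrier F. h w \<in> L j}"
  have pc: "pc_chain F ?N ?P"
    by (rule h.pc_chain_preimage[OF E_props(4)[OF j] F.subgroup_self]) (use MH hF in simp)
  have cov: "F.fin_cover (carrier F) ?P"
  proof (rule h.fin_cover_preimage[OF Mj(1) order_refl])
    show "p.H.fin_cover (h ` carrier F) (M j)"
      unfolding hF
      using p.H.fin_cover_mono[OF p.H.fin_cover_subset[OF Mj(1) p.H.subgroup_self H Mj(2) subgroup.subset[OF H]]]
      by blast
  qed
  \<comment> \<open>If the coordinate of \<open>f\<close> lies in \<open>L j\<close>, its embedded
    copy belongs to \<open>S\<close>. A preimage \<open>u\<close> of that copy lies in
    \<open>U\<close> and agrees with \<open>f\<close> at \<open>j\<close>, so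
    \<open>inv u \<otimes> f\<close> lies in \<open>V\<close>.\<close>
  have NUV: "?N \<subseteq> U <#>\<^bsub>F\<^esub> V"
  proof
    fix f assume f: "f \<in> ?N"
    then have fc: "f \<in> carrier F" and "h f \<in> N j (I - {j})" using L_props(3)[OF j] by auto
    then have "emb j (h f) \<in> \<pi> ` carrier F" using N_emb[OF j] \<pi>F(2) by simp
    then obtain u where u: "u \<in> carrier F" "\<pi> u = emb j (h f)" by force
    have "u \<in> U" using u by (simp add: Umem emb_at)
    moreover have "h u = h f" using u emb_at[OF j] by (simp add: h_def)
    then have "h (inv\<^bsub>F\<^esub> u \<otimes>\<^bsub>F\<^esub> f) = \<one>\<^bsub>G j\<^esub>" using u(1) fc by simp
    then have "inv\<^bsub>F\<^esub> u \<otimes>\<^bsub>F\<^esub> f \<in> V" unfolding Vmem using u(1) fc by (simp add: h_def)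
    ultimately have "u \<otimes>\<^bsub>F\<^esub> (inv\<^bsub>F\<^esub> u \<otimes>\<^bsub>F\<^esub> f) \<in> U <#>\<^bsub>F\<^esub> V" by (rule set_multI)
    then show "f \<in> U <#>\<^bsub>F\<^esub> V" using u(1) fc by simp
  qed
  have "\<exists>R. finite R \<and> R \<subseteq> carrier F \<and> U \<inter> V = normal_closure F R"
    unfolding F_def
    by (rule free_group_Int_normal_closure[OF X RU[unfolded F_def] RV[unfolded F_def] W(2) WV gen[unfolded F_def]
          pc[unfolded F_def] NUV[unfolded F_def] cov[unfolded F_def]])
  then obtain R where "finite R" "R \<subseteq> carrier F" "kernel F ?S \<pi> = normal_closure F R" using UV by auto
  then show ?thesis
    unfolding finitely_presented_iff using gS X \<pi>F unfolding F_def
    by (intro conjI exI[of _ X] exI[of _ R] exI[of _ \<pi>]) simp_all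
qed

end

section \<open>Induction on the number of factors, and the final assembly\<close>

lemma finitely_presented_trivial:
  assumes "group G" "carrier G = {\<one>\<^bsub>G\<^esub>}"
  shows "finitely_presented G"
proof -
  let ?F = "free_group ({} :: nat set)"
  interpret F: group ?F by (rule group_free_group)
  interpret G: group G by fact
  have F: "carrier ?F = {\<one>\<^bsub>?F\<^esub>}" by (auto simp: free_group_def)
  have "normal_closure ?F {} = {\<one>\<^bsub>?F\<^esub>}"
    using F.normal_closure_subset_carrier[of "{}"] subgroup.one_closed[OF normal_imp_subgroup[OF F.normal_closure_normal[of "{}"]]]
    unfolding F by auto
  moreover have "kernel ?F G (\<lambda>_. \<one>\<^bsub>G\<^esub>) = {\<one>\<^bsub>?F\<^esub>}" unfolding kernel_def F by auto
  moreover have "(\<lambda>_. \<one>\<^bsub>G\<^esub>) \<in> hom ?F G" by (simp add: hom_def)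
  moreover have "(\<lambda>_. \<one>\<^bsub>G\<^esub>) ` carrier ?F = carrier G" using assms(2) F by simp
  ultimately show ?thesis
    unfolding finitely_presented_iff using assms(1)
    by (intro conjI exI[of _ "{}"] exI[of _ "\<lambda>_. \<one>\<^bsub>G\<^esub>"]) simp_all
qed

theorem vsp_finitely_presented:
  assumes "vsp I G S"
  shows "finitely_presented (product_group I G\<lparr>carrier := S\<rparr>)"
proof -
  have "finite I" using assms by (simp add: vsp_def)
  then show ?thesis using assms
  proof (induction arbitrary: S rule: finite_induct)
    case empty
    \<comment> \<open>Starting from the empty product lets the same induction step handle a single
      factor, where the remaining projection is trivial.\<close>
    interpret vsp "{}" G S by (rule empty)
    have "carrier \<Gamma> = {\<one>\<^bsub>\<Gamma>\<^esub>}" by (simp add: \<Gamma>_def restrict_def)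
    then have "S = {\<one>\<^bsub>\<Gamma>\<^esub>}" using subgroup.one_closed[OF S'] subgroup.subset[OF S'] by blast
    then show ?case
      using finitely_presented_trivial[OF \<Gamma>.subgroup_imp_group[OF S']] by (simp add: \<Gamma>_def)
  next
    case (insert j I)
    interpret vsp "insert j I" G S by (rule insert.prems)
    have "insert j I - {j} = I" using insert.hyps by blast
    moreover have "vsp I G ((\<lambda>x. restrict x I) ` S)" by (rule vsp_restrict) blast
    ultimately show ?case using finitely_presented_step[of j] insert.IH by (simp add: \<Gamma>_def)
  qed
qed

theorem theoremA:
  fixes n :: nat
    and G :: "nat \<Rightarrow> ('a, 'b) monoid_scheme"
    and S :: "(nat \<Rightarrow> 'a) set"
  assumes "n \<ge> 2"
    and "\<And>i. i \<in> {1..n} \<Longrightarrow> group (G i)"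
    and "\<And>i. i \<in> {1..n} \<Longrightarrow> finitely_presented (G i)"
    and "subgroup S (product_group {1..n} G)"
    and "virtually_surjective_on_pairs {1..n} G S"
  shows "finitely_presented ((product_group {1..n} G)\<lparr>carrier := S\<rparr>) \<and>
         separable (product_group {1..n} G) S"
proof -
  have pair: "finite_index (G i \<times>\<times> G j) ((\<lambda>x. (x i, x j)) ` S)"
    if "i \<in> {1..n}" "j \<in> {1..n}" "i \<noteq> j" for i j
    using assms(5) that by (auto simp: virtually_surjective_on_pairs_def)
  \<comment> \<open>The bound on \<open>n\<close> supplies a second index. The image in two factors
    has finite index, and projecting it to one of them preserves this.\<close>
  have single: "finite_index (G i) ((\<lambda>x. x i) ` S)" if i: "i \<in> {1..n}" for i
  proof -
    have "\<exists>j\<in>{1..n}. i \<noteq> j"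
      using assms(1) by (intro bexI[of _ "if i = 1 then 2 else 1"]) auto
    then obtain j where j: "j \<in> {1..n}" "i \<noteq> j" by blast
    interpret Gi: group "G i" by (rule assms(2)[OF i])
    interpret Gj: group "G j" by (rule assms(2)[OF j(1)])
    interpret D: group "G i \<times>\<times> G j" by (rule DirProd_group[OF Gi.group_axioms Gj.group_axioms])
    interpret P: group "product_group {1..n} G" by (rule product_group) (rule assms(2))
    let ?B = "(\<lambda>x. (x i, x j)) ` S"
    have "group_hom (product_group {1..n} G) (G i \<times>\<times> G j) (\<lambda>x. (x i, x j))"
      using P.group_axioms D.group_axioms i j by (auto simp: group_hom_def group_hom_axioms_def hom_def)
    then have B: "subgroup ?B (G i \<times>\<times> G j)" by (rule group_hom.subgroup_img_is_subgroup[OF _ assms(4)])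
    then have cov: "D.fin_cover (carrier (G i \<times>\<times> G j)) ?B"
      using pair[OF i j] D.finite_index_iff_fin_cover by blast
    interpret f: group_hom "G i \<times>\<times> G j" "G i" fst
      using D.group_axioms Gi.group_axioms by (auto simp: group_hom_def group_hom_axioms_def hom_def)
    have "fst ` carrier (G i \<times>\<times> G j) = carrier (G i)" using Gj.one_closed by force
    moreover have "fst ` ?B = (\<lambda>x. x i) ` S" by (simp add: image_image)
    ultimately show ?thesis
      using f.fin_cover_image[OF cov order_refl] f.subgroup_img_is_subgroup[OF B]
        Gi.finite_index_iff_fin_cover by simp
  qed
  interpret vsp "{1..n}" G S
    by (rule vsp.intro[OF finite_atLeastAtMost assms(3,4) single pair])
  show ?thesis
    using vsp_finitely_presented[OF vsp_axioms] separable_S[unfolded \<Gamma>_def] by blast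
qed

end
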